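(* Let $\beta>0$, let $(\mu_n)_{n\ge1}$ be a sequence of nonnegative real numbers, and assume that $\lim_{n\to\infty}\frac{\mu_n}{n}=c$ for some $c\ge 0$. For each $n$ let $\mathbb{P}_{n,\mu_n}$ be the probability measure on $\mathbb{R}^n$ $$\mathbb{P}_{n,\mu_n}(d\lambda)=\frac{1}{Z_n}e^{-n\sum_{i=1}^{n}\lambda_i^2}\prod_{i=1}^{n}|\lambda_i|^{2\mu_n}\prod_{1\le i<j\le n}|\lambda_i-\lambda_j|^{\beta}\,d\lambda_1\cdots d\lambda_n ,$$ where $Z_n$ is the normalizing constant, and let $\nu_n$ be the probability measure on $\mathbb{R}$ defined by $\int_{\mathbb{R}}f(t)\,\nu_n(dt)=\mathbb{E}_{n,\mu_n}\big(\frac1n\sum_{i=1}^n f(\lambda_i)\big)$ for bounded measurable $f$, $\mathbb{E}_{n,\mu_n}$ denoting expectation with respect to $\mathbb{P}_{n,\mu_n}$. Put $$a=\sqrt{\tfrac{\beta}{2}}\sqrt{1+\tfrac{2c}{\beta}-\sqrt{1+\tfrac{4c}{\beta}}},\qquad b=\sqrt{\tfrac{\beta}{2}}\sqrt{1+\tfrac{2c}{\beta}+\sqrt{1+\tfrac{4c}{\beta}}},\qquad S=[-b,-a]\cup[a,b],$$ and let $\nu_{\beta,c}$ be the probability measure on $\mathbb{R}$ with density $$f_{\beta,c}(t)=\frac{2}{\pi\beta}\frac{1}{|t|}\sqrt{(t^2-a^2)(b^2-t^2)}\ \text{ for } t\in S,\qquad f_{\beta,c}(t)=0\ \text{ for }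 t\notin S .$$ Then $\nu_n$ converges weakly to $\nu_{\beta,c}$, i.e. $\lim_{n\to\infty}\int_{\mathbb{R}}f\,d\nu_n=\int_{\mathbb{R}}f\,d\nu_{\beta,c}$ for every bounded continuous $f$ on $\mathbb{R}$. Moreover, the energy of the equilibrium measure $\nu_{\beta,c}$ is $$E^*_{\beta,c}=\frac{3\beta}{8}+\frac{\beta}{4}\log\frac{4}{\beta}+c\Big(\frac{3}{2}+\log\frac4{\beta}\Big)+\frac{2c^2}{\beta}\log\frac{4c}{\beta}-\Big(\frac{2c^2}{\beta}+c+\frac\beta8\Big)\log\Big(1+\frac{4c}{\beta}\Big).$$
   Context: For $\delta\ge0$ let $Q_\delta(t)=t^2+2\delta\log\frac{1}{|t|}$ (with value $+\infty$ at $t=0$ if $\delta>0$). For a Borel probability measure $\nu$ on $\mathbb{R}$ the energy is $E_{\beta,\delta}(\nu)=\frac{\beta}{2}\int_{\mathbb{R}^2}\log\frac{1}{|s-t|}\,\nu(ds)\nu(dt)+\int_{\mathbb{R}}Q_\delta(t)\,\nu(dt)$ (with values in $(-\infty,+\infty]$), and $E^*_{\beta,\delta}=\inf\{E_{\beta,\delta}(\nu):\nu$ a probability measure on $\mathbb{R}\}$. The energy of the equilibrium measure means $E^*_{\beta,c}$ (attained at $\nu_{\beta,c}$). In the formula, the term $\frac{2c^2}{\beta}\log\frac{4c}{\beta}$ is interpreted as $0$ when $c=0$. *)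

theory Defs
  imports "HOL-Probability.Probability"
begin

text \<open>Power |x|^p with the convention 0^0 = 1 (Isabelle's powr has 0 powr 0 = 0).\<close>
definition abs_pow :: "real \<Rightarrow> real \<Rightarrow> real" where
  "abs_pow x p = (if p = 0 then 1 else \<bar>x\<bar> powr p)"

definition weight :: "real \<Rightarrow> nat \<Rightarrow> real \<Rightarrow> (nat \<Rightarrow> real) \<Rightarrow> real" where
  "weight \<beta> n \<mu> l =
     exp (- real n * (\<Sum>i<n. (l i)\<^sup>2))
     * (\<Prod>i<n. abs_pow (l i) (2 * \<mu>))
     * (\<Prod>p\<in>{(i, j). i < j \<and> j < n}. abs_pow (l (fst p) - l (snd p)) \<beta>)"

definition Lebn :: "nat \<Rightarrow> (nat \<Rightarrow> real) measure" where
  "Lebn n = PiM {..<n} (\<lambda>_. lborel)"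

definition Zn :: "real \<Rightarrow> nat \<Rightarrow> real \<Rightarrow> real" where
  "Zn \<beta> n \<mu> = (\<integral>l. weight \<beta> n \<mu> l \<partial>Lebn n)"

definition Pn :: "real \<Rightarrow> nat \<Rightarrow> real \<Rightarrow> (nat \<Rightarrow> real) measure" where
  "Pn \<beta> n \<mu> = density (Lebn n) (\<lambda>l. ennreal (weight \<beta> n \<mu> l / Zn \<beta> n \<mu>))"

definition nun :: "real \<Rightarrow> nat \<Rightarrow> real \<Rightarrow> real measure" where
  "nun \<beta> n \<mu> = measure_of UNIV (sets borel)
     (\<lambda>A. \<integral>\<^sup>+ l. ennreal (card {i\<in>{..<n}. l i \<in> A} / real n) \<partial>Pn \<beta> n \<mu>)"

definition edge_a :: "real \<Rightarrow> real \<Rightarrow> real" where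
  "edge_a \<beta> c = sqrt (\<beta>/2) * sqrt (1 + 2*c/\<beta> - sqrt (1 + 4*c/\<beta>))"

definition edge_b :: "real \<Rightarrow> real \<Rightarrow> real" where
  "edge_b \<beta> c = sqrt (\<beta>/2) * sqrt (1 + 2*c/\<beta> + sqrt (1 + 4*c/\<beta>))"

definition eq_density :: "real \<Rightarrow> real \<Rightarrow> real \<Rightarrow> real" where
  "eq_density \<beta> c t =
     (let a = edge_a \<beta> c; b = edge_b \<beta> c in
      if a \<le> \<bar>t\<bar> \<and> \<bar>t\<bar> \<le> b
      then 2 / (pi * \<beta>) * (1 / \<bar>t\<bar>) * sqrt ((t\<^sup>2 - a\<^sup>2) * (b\<^sup>2 - t\<^sup>2))
      else 0)"

definition nu_eq :: "real \<Rightarrow> real \<Rightarrow> real measure" where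
  "nu_eq \<beta> c = density lborel (\<lambda>t. ennreal (eq_density \<beta> c t))"

definition Qd :: "real \<Rightarrow> real \<Rightarrow> ereal" where
  "Qd \<delta> t = (if t = 0 \<and> \<delta> > 0 then \<infinity> else ereal (t\<^sup>2 + 2 * \<delta> * ln (1 / \<bar>t\<bar>)))"

definition logk :: "real \<Rightarrow> real \<Rightarrow> ereal" where
  "logk s t = (if s = t then \<infinity> else ereal (ln (1 / \<bar>s - t\<bar>)))"

definition eint :: "'a measure \<Rightarrow> ('a \<Rightarrow> ereal) \<Rightarrow> ereal" where
  "eint M f = enn2ereal (\<integral>\<^sup>+ x. e2ennreal (f x) \<partial>M)
              - enn2ereal (\<integral>\<^sup>+ x. e2ennreal (- f x) \<partial>M)"

text \<open>Energy E_{beta,delta}(nu), written with the symmetrised kernel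
  (beta/2) log(1/|s-t|) + Q(s)/2 + Q(t)/2, which is bounded below.\<close>
definition energy :: "real \<Rightarrow> real \<Rightarrow> real measure \<Rightarrow> ereal" where
  "energy \<beta> \<delta> \<nu> = eint (\<nu> \<Otimes>\<^sub>M \<nu>)
     (\<lambda>(s, t). ereal (\<beta>/2) * logk s t + Qd \<delta> s / 2 + Qd \<delta> t / 2)"

definition energy_star :: "real \<Rightarrow> real \<Rightarrow> ereal" where
  "energy_star \<beta> \<delta> =
     (INF \<nu> \<in> {\<nu>. prob_space \<nu> \<and> sets \<nu> = sets (borel :: real measure)}. energy \<beta> \<delta> \<nu>)"

end

theory Submission
  imports Defs "HOL-Complex_Analysis.Complex_Analysis" "HOL-Real_Asymp.Real_Asymp"
begin

text \<open>
  Potential theory. With \<open>p = sqrt (c + \<beta>/4)\<close>, \<open>r = sqrt \<beta> / 2\<close> and \<open>q = r/p\<close>, the image of the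
  equilibrium measure under squaring is carried to the unit circle by
  \<open>t\<^sup>2 = \<bar>p + r e\<bar>\<^sup>2\<close>, \<open>e = exp (2 \<pi> i \<tau>)\<close>, where it has a rational density; Cauchy's formula then
  gives its logarithmic potential in closed form, and the effective potential
  \<open>\<beta> U(x) + x\<^sup>2 - 2 c log \<bar>x\<bar>\<close> turns out to be constant on the support and no smaller elsewhere.

  A truncated logarithmic kernel is a positive mixture of products \<open>1\<^bsub>I\<^esub>(x) 1\<^bsub>I\<^esub>(y)\<close> of indicators of
  intervals, hence positive definite on signed measures of total mass 0. Linearising the energy at
  the equilibrium measure \<open>\<nu>\<close> therefore gives \<open>E(m) \<ge> E(\<nu>) + \<beta>/2 D(m - \<nu>)\<close> with \<open>D \<ge> 0\<close>,
  which proves minimality. The same inequality, applied to the empirical measure of the particles,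
  bounds the joint density by \<open>exp (- n\<^sup>2 (E(\<nu>) + \<beta>/2 D))\<close> up to exponentials of order \<open>n\<close>, and
  Jensen's inequality on \<open>\<nu>\<^sup>n\<close> bounds the normalising constant below by \<open>exp (- n\<^sup>2 E(\<nu>) - O(n))\<close>.
  Since an interval carrying too little mass forces \<open>D\<close> to be bounded away from 0, the distribution
  functions converge. For finite \<open>n\<close> all estimates are made with \<open>\<mu>\<^sub>n / n\<close> in place of \<open>c\<close>, so that
  they are exact, and the limit in \<open>c\<close> is taken only at the end.
\<close>

section \<open>A positive definite truncation of the logarithm\<close>

text \<open>The logarithm is unbounded both at 0 and at infinity, and each end gets its own cut.
  Near 0 the graph of \<open>-ln\<close> is replaced by its tangent at \<epsilon>. By convexity the
  result lies below \<open>-ln\<close>, so lower bounds for truncated energies pass to the true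
  ones, and the diagonal of an empirical measure, where the true energy is infinite, costs only
  order n in the exponent. The tangent is forced: it is what a mixture over interval lengths r in
  [\<epsilon>, R] with density 1/r^2 produces. The upper cut R adds the constant ln R - 1, which
  cancels on signed measures of mass 0, so R can be sent to infinity with \<epsilon> fixed.

  The circle coordinate works because x^2 - |p + r e|^2 factors as (p r / \<zeta>) |1 - \<zeta> e|^2
  when x^2 = p^2 + r^2 + p r (\<zeta> + 1/\<zeta>). The logarithm of this is, up to a constant,
  twice the real part of a function holomorphic in e.

  The lower bound for the normalising constant contains no entropy term: the equilibrium density is
  bounded, so its n-fold product is at most a constant to the power n times Lebesgue
  measure.\<close>

definition Lk :: "real \<Rightarrow> real \<Rightarrow> real" where
  "Lk \<epsilon> x = (if \<epsilon> \<le> \<bar>x\<bar> then - ln \<bar>x\<bar> else 1 - ln \<epsilon> - \<bar>x\<bar> / \<epsilon>)"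

text \<open>The integral of \<open>max 0 (r - |x|) / r^2\<close> over r in [\<epsilon>, R], written
  out. The upper limit contributes \<open>ln R + |x| / R\<close>, the lower one
  \<open>Lk \<epsilon> x - 1\<close>.\<close>

definition Tk :: "real \<Rightarrow> real \<Rightarrow> real \<Rightarrow> real" where
  "Tk \<epsilon> R x = (if \<bar>x\<bar> \<le> R then ln R - 1 + \<bar>x\<bar> / R + Lk \<epsilon> x else 0)"

lemma Lk_measurable [measurable]: "Lk \<epsilon> \<in> borel_measurable borel"
  unfolding Lk_def by measurable

lemma Tk_measurable [measurable]: "Tk \<epsilon> R \<in> borel_measurable borel"
  unfolding Tk_def by measurable

lemma ln_le_self_diff:
  assumes "0 < x" "0 < (y::real)"
  shows "ln x - ln y \<le> x / y - 1"
  using ln_le_minus_one[of "x / y"] assms by (simp add: ln_div)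

text \<open>The tangent of the convex function \<open>-ln\<close> at \<epsilon> lies below its
  graph. The origin is left out because \<open>ln 0 = 0\<close> by convention.\<close>

lemma Lk_le_log:
  assumes "0 < \<epsilon>" "x \<noteq> 0"
  shows "Lk \<epsilon> x \<le> - ln \<bar>x\<bar>"
  using ln_le_self_diff[of "\<bar>x\<bar>" \<epsilon>] assms unfolding Lk_def by auto

lemma abs_Lk_le:
  assumes "0 < \<epsilon>"
  shows "\<bar>Lk \<epsilon> x\<bar> \<le> 1 + \<bar>ln \<epsilon>\<bar> + \<bar>x\<bar>"
proof (cases "\<epsilon> \<le> \<bar>x\<bar>")
  case True
  then have "ln \<epsilon> \<le> ln \<bar>x\<bar>" using assms by (subst ln_le_cancel_iff) auto
  moreover have "ln \<bar>x\<bar> \<le> \<bar>x\<bar>" using True assms ln_bound[of "\<bar>x\<bar>"] by linarith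
  ultimately show ?thesis using True unfolding Lk_def by auto
next
  case False
  then have "0 \<le> \<bar>x\<bar> / \<epsilon>" "\<bar>x\<bar> / \<epsilon> \<le> 1" using assms by auto
  moreover have "Lk \<epsilon> x = 1 - ln \<epsilon> - \<bar>x\<bar> / \<epsilon>" using False unfolding Lk_def by simp
  ultimately show ?thesis by linarith
qed

lemma Lk_0: "0 < \<epsilon> \<Longrightarrow> Lk \<epsilon> 0 = 1 - ln \<epsilon>"
  unfolding Lk_def by simp

lemma Lk_minus: "Lk \<epsilon> (x - y) = Lk \<epsilon> (y - x)"
  unfolding Lk_def by (simp add: abs_minus_commute)

text \<open>Up to R the error is exactly |x|/R. Beyond R the kernel \<open>Tk\<close> is 0, and 1 +
  ln (|x|/R) \<le> |x|/R takes over. An error linear in |x| is what a finite first moment can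
  absorb.\<close>

lemma Lk_approx_Tk:
  assumes "0 < \<epsilon>" "\<epsilon> \<le> R"
  shows "\<bar>Lk \<epsilon> x - (Tk \<epsilon> R x - ln R + 1)\<bar> \<le> \<bar>x\<bar> / R"
proof (cases "\<bar>x\<bar> \<le> R")
  case True then show ?thesis using assms unfolding Tk_def by auto
next
  case False
  then have x: "\<epsilon> \<le> \<bar>x\<bar>" "0 < \<bar>x\<bar>" "R < \<bar>x\<bar>" "0 < R" using assms by auto
  have "ln R \<le> ln \<bar>x\<bar>" using x by (subst ln_le_cancel_iff) auto
  moreover have "ln \<bar>x\<bar> - ln R \<le> \<bar>x\<bar> / R - 1" using ln_le_self_diff x by blast
  moreover have "1 \<le> \<bar>x\<bar> / R" using x by simp
  moreover have "Lk \<epsilon> x = - ln \<bar>x\<bar>" "Tk \<epsilon> R x = 0" using False x(1) by (simp_all add: Lk_def Tk_def)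
  ultimately show ?thesis by (simp add: abs_if)
qed

section \<open>Triangle kernels and their mixture over interval lengths\<close>

lemma triangle_kernel_integral:
  assumes "0 < L" "L \<le> R" "\<bar>x\<bar> \<le> R" "0 < max L \<bar>x\<bar>"
  shows "(\<integral>\<^sup>+r. ennreal (max 0 (r - \<bar>x\<bar>) / r\<^sup>2) * indicator {L..R} r \<partial>lborel)
     = ennreal (ln R - ln (max L \<bar>x\<bar>) + \<bar>x\<bar> / R - \<bar>x\<bar> / max L \<bar>x\<bar>)"
proof -
  \<comment> \<open>The integrand vanishes for r below |x|, so the integration effectively starts at
    the larger of L and |x|.\<close>
  let ?M = "max L \<bar>x\<bar>"
  have M: "0 < ?M" "?M \<le> R" using assms by auto
  have "(\<integral>\<^sup>+r. ennreal (max 0 (r - \<bar>x\<bar>) / r\<^sup>2) * indicator {L..R} r \<partial>lborel)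
      = (\<integral>\<^sup>+r. ennreal ((r - \<bar>x\<bar>) / r\<^sup>2) * indicator {?M..R} r \<partial>lborel)"
    by (intro nn_integral_cong) (auto simp: indicator_def max_def)
  also have "\<dots> = ennreal ((ln R + \<bar>x\<bar> / R) - (ln ?M + \<bar>x\<bar> / ?M))"
  proof (rule nn_integral_FTC_Icc)
    fix r assume r: "r \<in> {?M..R}"
    then have "0 < r" using M by (meson atLeastAtMost_iff less_le_trans)
    then show "((\<lambda>r. ln r + \<bar>x\<bar> / r) has_real_derivative (r - \<bar>x\<bar>) / r\<^sup>2) (at r)"
      by (auto intro!: derivative_eq_intros simp: power2_eq_square field_simps)
    show "0 \<le> (r - \<bar>x\<bar>) / r\<^sup>2" using r by auto
  qed (use M in auto)
  finally show ?thesis by (simp add: algebra_simps)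
qed

lemma nn_integral_Tk:
  assumes "0 < \<epsilon>" "\<epsilon> \<le> R"
  shows "(\<integral>\<^sup>+r. ennreal (max 0 (r - \<bar>x\<bar>) / r\<^sup>2) * indicator {\<epsilon>..R} r \<partial>lborel) = ennreal (Tk \<epsilon> R x)"
proof (cases "\<bar>x\<bar> \<le> R")
  case True
  have "ln R - ln (max \<epsilon> \<bar>x\<bar>) + \<bar>x\<bar> / R - \<bar>x\<bar> / max \<epsilon> \<bar>x\<bar> = Tk \<epsilon> R x"
    using True assms unfolding Tk_def Lk_def by (auto simp: max_def)
  then show ?thesis using triangle_kernel_integral[of \<epsilon> R x] True assms by auto
next
  case False
  have "(\<integral>\<^sup>+r. ennreal (max 0 (r - \<bar>x\<bar>) / r\<^sup>2) * indicator {\<epsilon>..R} r \<partial>lborel) = (\<integral>\<^sup>+r. 0 \<partial>(lborel :: real measure))"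
    by (intro nn_integral_cong) (use False in \<open>auto simp: indicator_def max_def\<close>)
  then show ?thesis using False by (simp add: Tk_def)
qed

lemma Tk_nonneg:
  assumes "0 < \<epsilon>" "\<epsilon> \<le> R"
  shows "0 \<le> Tk \<epsilon> R x"
proof (cases "\<bar>x\<bar> \<le> R")
  case True
  show ?thesis
  proof (cases "\<epsilon> \<le> \<bar>x\<bar>")
    case t: True
    then have "0 < \<bar>x\<bar>" "0 < R" using assms by auto
    then have "ln \<bar>x\<bar> - ln R \<le> \<bar>x\<bar> / R - 1" by (rule ln_le_self_diff)
    then show ?thesis using True t by (simp add: Tk_def Lk_def)
  next
    case f: False
    have "ln \<epsilon> - ln R \<le> \<epsilon> / R - 1" by (rule ln_le_self_diff) (use assms in auto)
    moreover have "(\<epsilon> - \<bar>x\<bar>) / R \<le> (\<epsilon> - \<bar>x\<bar>) / \<epsilon>" using f assms by (intro divide_left_mono) auto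
    then have "\<epsilon> / R - \<bar>x\<bar> / R \<le> 1 - \<bar>x\<bar> / \<epsilon>" using assms by (simp add: diff_divide_distrib)
    ultimately show ?thesis using True f unfolding Tk_def Lk_def by auto
  qed
qed (simp add: Tk_def)

text \<open>Both points lie in (u, u + r] exactly when u is at least max x y - r and less than min x
  y, an interval of length r - |x - y| if that is nonnegative.\<close>

lemma nn_integral_interval_overlap:
  assumes "0 \<le> r"
  shows "(\<integral>\<^sup>+u. indicator {u<..u+r} x * indicator {u<..u+r} y \<partial>lborel) = ennreal (max 0 (r - \<bar>x - y\<bar>))"
proof -
  have "(\<integral>\<^sup>+u. indicator {u<..u+r} x * indicator {u<..u+r} y \<partial>lborel)
     = (\<integral>\<^sup>+u. indicator {max x y - r ..< min x y} u \<partial>lborel)"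
    by (intro nn_integral_cong) (auto simp: indicator_def)
  also have "\<dots> = ennreal (max 0 (r - \<bar>x - y\<bar>))"
    using assms by (auto simp: max_def min_def ennreal_neg)
  finally show ?thesis .
qed

text \<open>The truncated logarithm is, up to an affine function of \<open>\<bar>x - y\<bar>\<close>, a positive mixture of products
  \<open>1\<^bsub>I\<^esub>(x) 1\<^bsub>I\<^esub>(y)\<close> of indicators of intervals \<open>I = (u, u + r]\<close>, hence positive definite.\<close>

definition scale_lborel :: "real \<Rightarrow> real \<Rightarrow> (real \<times> real) measure" where
  "scale_lborel \<epsilon> R = density lborel (\<lambda>r. ennreal (1 / r\<^sup>2) * indicator {\<epsilon>..R} r) \<Otimes>\<^sub>M lborel"

definition cell :: "real \<times> real \<Rightarrow> real set" where
  "cell w = {snd w<..snd w + fst w}"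

lemma sets_scale_lborel [measurable_cong]: "sets (scale_lborel \<epsilon> R) = sets (borel \<Otimes>\<^sub>M borel)"
  unfolding scale_lborel_def by (rule sets_pair_measure_cong) auto

lemma sigma_finite_scale_lborel: 
  assumes "0 < \<epsilon>"
  shows "sigma_finite_measure (scale_lborel \<epsilon> R)"
proof -
  have "emeasure (density lborel (\<lambda>r. ennreal (1 / r\<^sup>2) * indicator {\<epsilon>..R} r)) UNIV
      \<le> (\<integral>\<^sup>+r. ennreal (1 / \<epsilon>\<^sup>2) * indicator {\<epsilon>..R} r \<partial>lborel)"
    using assms
    by (subst emeasure_density) (auto intro!: nn_integral_mono ennreal_leI divide_left_mono power_mono simp: indicator_def)
  also have "\<dots> < \<infinity>"
    by (subst nn_integral_cmult_indicator) (auto simp: ennreal_mult_less_top emeasure_lborel_Icc_eq)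
  finally have fin: "emeasure (density lborel (\<lambda>r. ennreal (1 / r\<^sup>2) * indicator {\<epsilon>..R} r)) UNIV < \<infinity>" .
  interpret A: finite_measure "density lborel (\<lambda>r. ennreal (1 / r\<^sup>2) * indicator {\<epsilon>..R} r)"
    by (rule finite_measureI) (use fin in simp)
  interpret P: pair_sigma_finite "density lborel (\<lambda>r. ennreal (1 / r\<^sup>2) * indicator {\<epsilon>..R} r)" lborel
    by unfold_locales
  show ?thesis unfolding scale_lborel_def ..
qed

lemma indicator_cell_measurable [measurable]:
  "(\<lambda>(w, x). indicator (cell w) x :: ennreal) \<in> borel_measurable ((borel \<Otimes>\<^sub>M borel) \<Otimes>\<^sub>M borel)"
proof -
  have "(\<lambda>(w, x). indicator (cell w) x :: ennreal)
     = (\<lambda>z. if snd (fst z) < snd z \<and> snd z \<le> snd (fst z) + fst (fst z) then 1 else 0)"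
    by (auto simp: cell_def indicator_def fun_eq_iff)
  then show ?thesis by simp
qed

lemma indicator_cell_measurable' [measurable]:
  "(\<lambda>w. indicator (cell w) x :: ennreal) \<in> borel_measurable (borel \<Otimes>\<^sub>M borel)"
proof -
  have "(\<lambda>w. indicator (cell w) x :: ennreal) = (\<lambda>w. if snd w < x \<and> x \<le> snd w + fst w then 1 else 0)"
    by (auto simp: cell_def indicator_def fun_eq_iff)
  then show ?thesis by simp
qed

lemma emeasure_cell_measurable [measurable]:
  assumes "prob_space m" and [measurable_cong]: "sets m = sets borel"
  shows "(\<lambda>w. emeasure m (cell w)) \<in> borel_measurable (borel \<Otimes>\<^sub>M borel)"
proof -
  interpret prob_space m by fact
  have "(\<lambda>w. \<integral>\<^sup>+x. indicator (cell w) x \<partial>m) \<in> borel_measurable (borel \<Otimes>\<^sub>M borel)"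
    by measurable
  also have "(\<lambda>w. \<integral>\<^sup>+x. indicator (cell w) x \<partial>m) = (\<lambda>w. emeasure m (cell w))"
    by (auto simp: cell_def assms(2))
  finally show ?thesis .
qed

lemma nn_integral_cells:
  assumes "0 < \<epsilon>" "\<epsilon> \<le> R"
  shows "(\<integral>\<^sup>+w. indicator (cell w) x * indicator (cell w) y \<partial>scale_lborel \<epsilon> R) = ennreal (Tk \<epsilon> R (x - y))"
proof -
  have m: "(\<lambda>w. indicator (cell w) x * indicator (cell w) y :: ennreal) \<in> borel_measurable (scale_lborel \<epsilon> R)"
    by measurable
  have "(\<integral>\<^sup>+w. indicator (cell w) x * indicator (cell w) y \<partial>scale_lborel \<epsilon> R)
      = (\<integral>\<^sup>+r. (\<integral>\<^sup>+u. indicator {u<..u+r} x * indicator {u<..u+r} y \<partial>lborel)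
          \<partial>density lborel (\<lambda>r. ennreal (1 / r\<^sup>2) * indicator {\<epsilon>..R} r))"
    unfolding scale_lborel_def
    using m by (subst lborel.nn_integral_fst[symmetric]) (auto simp: cell_def)
  also have "\<dots> = (\<integral>\<^sup>+r. ennreal (1 / r\<^sup>2) * indicator {\<epsilon>..R} r * (\<integral>\<^sup>+u. indicator {u<..u+r} x * indicator {u<..u+r} y \<partial>lborel) \<partial>lborel)"
  proof (rule nn_integral_density)
    have "(\<lambda>r. \<integral>\<^sup>+u. indicator (cell (r, u)) x * indicator (cell (r, u)) y \<partial>lborel) \<in> borel_measurable lborel"
      by measurable
    then show "(\<lambda>r. \<integral>\<^sup>+u. indicator {u<..u+r} x * indicator {u<..u+r} y \<partial>lborel) \<in> borel_measurable lborel"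
      by (simp add: cell_def)
  qed simp
  also have "\<dots> = (\<integral>\<^sup>+r. ennreal (max 0 (r - \<bar>x - y\<bar>) / r\<^sup>2) * indicator {\<epsilon>..R} r \<partial>lborel)"
    using assms by (intro nn_integral_cong) (auto simp: nn_integral_interval_overlap ennreal_mult[symmetric] max_def split: split_indicator)
  also have "\<dots> = ennreal (Tk \<epsilon> R (x - y))"
    using assms by (rule nn_integral_Tk)
  finally show ?thesis .
qed

text \<open>Tonelli in three variables: after the mixture over cells is moved outside, each
  indicator integrates to the mass of the cell. The right-hand side is a bilinear form that is
  visibly a square on the diagonal.\<close>

lemma nn_integral_Tk_pair:
  assumes "0 < \<epsilon>" "\<epsilon> \<le> R" "prob_space m" "prob_space N" and [measurable_cong]: "sets m = sets borel" "sets N = sets borel"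
  shows "(\<integral>\<^sup>+z. ennreal (Tk \<epsilon> R (fst z - snd z)) \<partial>(m \<Otimes>\<^sub>M N))
     = (\<integral>\<^sup>+w. emeasure m (cell w) * emeasure N (cell w) \<partial>scale_lborel \<epsilon> R)"
proof -
  interpret m: prob_space m by fact
  interpret N: prob_space N by fact
  interpret W: sigma_finite_measure "scale_lborel \<epsilon> R" using assms(1) by (rule sigma_finite_scale_lborel)
  interpret mW: pair_sigma_finite m "scale_lborel \<epsilon> R" by unfold_locales
  interpret NW: pair_sigma_finite N "scale_lborel \<epsilon> R" by unfold_locales
  have s: "cell w \<in> sets borel" for w by (auto simp: cell_def)
  note [measurable] = emeasure_cell_measurable[OF assms(3,5)] emeasure_cell_measurable[OF assms(4,6)]
  have "(\<integral>\<^sup>+z. ennreal (Tk \<epsilon> R (fst z - snd z)) \<partial>(m \<Otimes>\<^sub>M N))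
     = (\<integral>\<^sup>+x. \<integral>\<^sup>+y. ennreal (Tk \<epsilon> R (x - y)) \<partial>N \<partial>m)"
    by (subst N.nn_integral_fst[symmetric]) auto
  also have "\<dots> = (\<integral>\<^sup>+x. \<integral>\<^sup>+y. (\<integral>\<^sup>+w. indicator (cell w) x * indicator (cell w) y \<partial>scale_lborel \<epsilon> R) \<partial>N \<partial>m)"
    by (simp add: nn_integral_cells assms(1,2))
  also have "\<dots> = (\<integral>\<^sup>+x. \<integral>\<^sup>+w. (\<integral>\<^sup>+y. indicator (cell w) x * indicator (cell w) y \<partial>N) \<partial>scale_lborel \<epsilon> R \<partial>m)"
    by (intro nn_integral_cong NW.Fubini'[symmetric]) measurable
  also have "\<dots> = (\<integral>\<^sup>+x. \<integral>\<^sup>+w. indicator (cell w) x * emeasure N (cell w) \<partial>scale_lborel \<epsilon> R \<partial>m)"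
    by (intro nn_integral_cong) (simp add: nn_integral_cmult_indicator s assms)
  also have "\<dots> = (\<integral>\<^sup>+w. \<integral>\<^sup>+x. indicator (cell w) x * (\<integral>\<^sup>+y. indicator (cell w) y \<partial>N) \<partial>m \<partial>scale_lborel \<epsilon> R)"
    by (subst mW.Fubini'[symmetric]) (auto simp: s assms)
  also have "\<dots> = (\<integral>\<^sup>+w. emeasure m (cell w) * emeasure N (cell w) \<partial>scale_lborel \<epsilon> R)"
    by (intro nn_integral_cong) (subst nn_integral_multc, auto simp: s assms)
  finally show ?thesis .
qed


section \<open>Mutual energies for the truncated kernel\<close>

definition log_pair :: "real \<Rightarrow> real measure \<Rightarrow> real measure \<Rightarrow> real" where
  "log_pair \<epsilon> m N = (\<integral>z. Lk \<epsilon> (fst z - snd z) \<partial>(m \<Otimes>\<^sub>M N))"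

lemma distr_snd_pair:
  assumes "prob_space M" "sigma_finite_measure N"
  shows "distr (M \<Otimes>\<^sub>M N) N snd = N"
proof (rule measure_eqI)
  interpret M: prob_space M by fact
  interpret N: sigma_finite_measure N by fact
  fix A assume "A \<in> sets (distr (M \<Otimes>\<^sub>M N) N snd)"
  then have A: "A \<in> sets N" by simp
  have "snd -` A \<inter> space (M \<Otimes>\<^sub>M N) = space M \<times> A"
    using sets.sets_into_space[OF A] by (auto simp: space_pair_measure)
  then show "emeasure (distr (M \<Otimes>\<^sub>M N) N snd) A = emeasure N A"
    using A by (simp add: emeasure_distr N.emeasure_pair_measure_Times M.emeasure_space_1)
qed simp

lemma integral_pair_fst:
  fixes f :: "'a \<Rightarrow> real"
  assumes "prob_space M" "prob_space N" "integrable M f"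
  shows "integrable (M \<Otimes>\<^sub>M N) (\<lambda>z. f (fst z))" "(\<integral>z. f (fst z) \<partial>(M \<Otimes>\<^sub>M N)) = (\<integral>x. f x \<partial>M)"
proof -
  interpret N: prob_space N by fact
  note d = N.distr_pair_fst[of M]
  have f: "f \<in> borel_measurable M" using assms(3) by simp
  show "integrable (M \<Otimes>\<^sub>M N) (\<lambda>z. f (fst z))"
    using integrable_distr_eq[OF measurable_fst f, of N] assms(3) unfolding d by simp
  show "(\<integral>z. f (fst z) \<partial>(M \<Otimes>\<^sub>M N)) = (\<integral>x. f x \<partial>M)"
    using integral_distr[OF measurable_fst f, of N] unfolding d by simp
qed

lemma integral_pair_snd:
  fixes f :: "'a \<Rightarrow> real"
  assumes "prob_space M" "prob_space N" "integrable N f"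
  shows "integrable (M \<Otimes>\<^sub>M N) (\<lambda>z. f (snd z))" "(\<integral>z. f (snd z) \<partial>(M \<Otimes>\<^sub>M N)) = (\<integral>x. f x \<partial>N)"
proof -
  interpret N: prob_space N by fact
  have d: "distr (M \<Otimes>\<^sub>M N) N snd = N" using distr_snd_pair assms(1) N.sigma_finite_measure .
  have f: "f \<in> borel_measurable N" using assms(3) by simp
  show "integrable (M \<Otimes>\<^sub>M N) (\<lambda>z. f (snd z))"
    using integrable_distr_eq[OF measurable_snd f, of M] assms(3) unfolding d by simp
  show "(\<integral>z. f (snd z) \<partial>(M \<Otimes>\<^sub>M N)) = (\<integral>x. f x \<partial>N)"
    using integral_distr[OF measurable_snd f, of M] unfolding d by simp
qed

lemma integrable_abs_diff_pair:
  assumes "prob_space m" "prob_space N" and [measurable_cong]: "sets m = sets borel" "sets N = sets borel"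
    and "integrable m (\<lambda>x. x)" "integrable N (\<lambda>x. x :: real)"
  shows "integrable (m \<Otimes>\<^sub>M N) (\<lambda>z. \<bar>fst z - snd z\<bar>)"
    and "(\<integral>z. \<bar>fst z - snd z\<bar> \<partial>(m \<Otimes>\<^sub>M N)) \<le> (\<integral>x. \<bar>x\<bar> \<partial>m) + (\<integral>x. \<bar>x\<bar> \<partial>N)"
proof -
  note 1 = integral_pair_fst[OF assms(1,2), of abs, OF integrable_abs[OF assms(5)]]
  note 2 = integral_pair_snd[OF assms(1,2), of abs, OF integrable_abs[OF assms(6)]]
  have 3: "integrable (m \<Otimes>\<^sub>M N) (\<lambda>z. \<bar>fst z\<bar> + \<bar>snd z\<bar>)" using 1 2 by auto
  show i: "integrable (m \<Otimes>\<^sub>M N) (\<lambda>z. \<bar>fst z - snd z\<bar>)"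
    by (rule Bochner_Integration.integrable_bound[OF 3]) auto
  have "(\<integral>z. \<bar>fst z - snd z\<bar> \<partial>(m \<Otimes>\<^sub>M N)) \<le> (\<integral>z. \<bar>fst z\<bar> + \<bar>snd z\<bar> \<partial>(m \<Otimes>\<^sub>M N))"
    using i 3 by (rule integral_mono) auto
  then show "(\<integral>z. \<bar>fst z - snd z\<bar> \<partial>(m \<Otimes>\<^sub>M N)) \<le> (\<integral>x. \<bar>x\<bar> \<partial>m) + (\<integral>x. \<bar>x\<bar> \<partial>N)"
    using 1 2 by simp
qed

lemma integrable_Lk_pair:
  assumes "prob_space m" "prob_space N" and [measurable_cong]: "sets m = sets borel" "sets N = sets borel"
    and "integrable m (\<lambda>x. x)" "integrable N (\<lambda>x. x :: real)" and "0 < \<epsilon>"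
  shows "integrable (m \<Otimes>\<^sub>M N) (\<lambda>z. Lk \<epsilon> (fst z - snd z))"
proof -
  interpret m: prob_space m by fact
  interpret N: prob_space N by fact
  interpret P: pair_prob_space m N ..
  have "integrable (m \<Otimes>\<^sub>M N) (\<lambda>z. 1 + \<bar>ln \<epsilon>\<bar> + \<bar>fst z - snd z\<bar>)"
    using integrable_abs_diff_pair(1)[OF assms(1-6)] by auto
  then show ?thesis
    by (rule Bochner_Integration.integrable_bound) (use abs_Lk_le[OF assms(7)] in auto)
qed

text \<open>The pointwise comparison of \<open>Lk\<close> with \<open>Tk\<close>, integrated. The
  error is a sum of first moments divided by R, so it disappears as R grows while \<epsilon> stays
  fixed.\<close>

lemma log_pair_approx:
  assumes "prob_space m" "prob_space N" and [measurable_cong]: "sets m = sets borel" "sets N = sets borel"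
    and "integrable m (\<lambda>x. x)" "integrable N (\<lambda>x. x :: real)" and "0 < \<epsilon>" "\<epsilon> \<le> R"
  shows "integrable (m \<Otimes>\<^sub>M N) (\<lambda>z. Tk \<epsilon> R (fst z - snd z))"
    and "\<bar>log_pair \<epsilon> m N - ((\<integral>z. Tk \<epsilon> R (fst z - snd z) \<partial>(m \<Otimes>\<^sub>M N)) - ln R + 1)\<bar>
       \<le> ((\<integral>x. \<bar>x\<bar> \<partial>m) + (\<integral>x. \<bar>x\<bar> \<partial>N)) / R"
proof -
  interpret m: prob_space m by fact
  interpret N: prob_space N by fact
  interpret P: pair_prob_space m N ..
  note iL = integrable_Lk_pair[OF assms(1-7)]
  note ia = integrable_abs_diff_pair[OF assms(1-6)]
  have "integrable (m \<Otimes>\<^sub>M N) (\<lambda>z. \<bar>Lk \<epsilon> (fst z - snd z)\<bar> + \<bar>fst z - snd z\<bar> / R + \<bar>ln R\<bar> + 1)"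
    using iL ia(1) by auto
  then show iT: "integrable (m \<Otimes>\<^sub>M N) (\<lambda>z. Tk \<epsilon> R (fst z - snd z))"
  proof (rule Bochner_Integration.integrable_bound)
    have "norm (Tk \<epsilon> R x) \<le> norm (\<bar>Lk \<epsilon> x\<bar> + \<bar>x\<bar> / R + \<bar>ln R\<bar> + 1)" for x
    proof -
      have "0 \<le> \<bar>x\<bar> / R" using assms by auto
      then show ?thesis using Lk_approx_Tk[OF assms(7,8), of x] unfolding real_norm_def by linarith
    qed
    then show "AE z in m \<Otimes>\<^sub>M N. norm (Tk \<epsilon> R (fst z - snd z)) \<le> norm (\<bar>Lk \<epsilon> (fst z - snd z)\<bar> + \<bar>fst z - snd z\<bar> / R + \<bar>ln R\<bar> + 1)"
      by simp
  qed measurable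
  have "log_pair \<epsilon> m N - ((\<integral>z. Tk \<epsilon> R (fst z - snd z) \<partial>(m \<Otimes>\<^sub>M N)) - ln R + 1)
     = (\<integral>z. Lk \<epsilon> (fst z - snd z) - (Tk \<epsilon> R (fst z - snd z) - ln R + 1) \<partial>(m \<Otimes>\<^sub>M N))"
    unfolding log_pair_def using iL iT by (simp add: P.prob_space)
  also have "\<bar>\<dots>\<bar> \<le> (\<integral>z. \<bar>fst z - snd z\<bar> / R \<partial>(m \<Otimes>\<^sub>M N))"
  proof (rule order_trans[OF integral_abs_bound integral_mono])
    show "integrable (m \<Otimes>\<^sub>M N) (\<lambda>z. \<bar>Lk \<epsilon> (fst z - snd z) - (Tk \<epsilon> R (fst z - snd z) - ln R + 1)\<bar>)"
      using iL iT by auto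
  qed (use ia(1) Lk_approx_Tk[OF assms(7,8)] in auto)
  also have "\<dots> \<le> ((\<integral>x. \<bar>x\<bar> \<partial>m) + (\<integral>x. \<bar>x\<bar> \<partial>N)) / R"
    using ia(2) assms by (simp add: divide_right_mono)
  finally show "\<bar>log_pair \<epsilon> m N - ((\<integral>z. Tk \<epsilon> R (fst z - snd z) \<partial>(m \<Otimes>\<^sub>M N)) - ln R + 1)\<bar>
       \<le> ((\<integral>x. \<bar>x\<bar> \<partial>m) + (\<integral>x. \<bar>x\<bar> \<partial>N)) / R" .
qed

text \<open>The expansion of (a - b)^2 with the mixed term moved to the other side, since
  subtraction in \<open>ennreal\<close> is truncated at 0.\<close>

lemma ennreal_add_squares:
  fixes a b :: real
  assumes "0 \<le> a" "0 \<le> b"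
  shows "ennreal a * ennreal a + ennreal b * ennreal b
    = ennreal a * ennreal b + ennreal a * ennreal b + ennreal ((a - b)\<^sup>2)"
proof -
  have "ennreal a * ennreal a + ennreal b * ennreal b = ennreal (a * a + b * b)"
    using assms by (simp only: ennreal_mult ennreal_plus mult_nonneg_nonneg)
  also have "a * a + b * b = a * b + a * b + (a - b)\<^sup>2"
    by (simp add: power2_eq_square algebra_simps)
  also have "ennreal \<dots> = ennreal a * ennreal b + ennreal a * ennreal b + ennreal ((a - b)\<^sup>2)"
    using assms by (simp only: ennreal_mult ennreal_plus mult_nonneg_nonneg add_nonneg_nonneg zero_le_power2)
  finally show ?thesis .
qed

text \<open>Positive definiteness in explicit form: the quadratic form of the difference of the two
  measures is the integral, over all cells, of the squared difference of their masses.\<close>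

lemma Tk_energy:
  assumes "prob_space m" "prob_space N" and [measurable_cong]: "sets m = sets borel" "sets N = sets borel"
    and "integrable m (\<lambda>x. x)" "integrable N (\<lambda>x. x :: real)" and "0 < \<epsilon>" "\<epsilon> \<le> R"
  shows "(\<integral>\<^sup>+w. ennreal ((measure m (cell w) - measure N (cell w))\<^sup>2) \<partial>scale_lborel \<epsilon> R)
    = ennreal ((\<integral>z. Tk \<epsilon> R (fst z - snd z) \<partial>(m \<Otimes>\<^sub>M m)) + (\<integral>z. Tk \<epsilon> R (fst z - snd z) \<partial>(N \<Otimes>\<^sub>M N))
        - 2 * (\<integral>z. Tk \<epsilon> R (fst z - snd z) \<partial>(m \<Otimes>\<^sub>M N)))"
    and "0 \<le> (\<integral>z. Tk \<epsilon> R (fst z - snd z) \<partial>(m \<Otimes>\<^sub>M m)) + (\<integral>z. Tk \<epsilon> R (fst z - snd z) \<partial>(N \<Otimes>\<^sub>M N))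
        - 2 * (\<integral>z. Tk \<epsilon> R (fst z - snd z) \<partial>(m \<Otimes>\<^sub>M N))"
proof -
  interpret m: prob_space m by fact
  interpret N: prob_space N by fact
  define T where "T M M' = (\<integral>z. Tk \<epsilon> R (fst z - snd z) \<partial>(M \<Otimes>\<^sub>M M'))" for M M' :: "real measure"
  note [measurable] = emeasure_cell_measurable[OF assms(1,3)] emeasure_cell_measurable[OF assms(2,4)]
  have [measurable]: "(\<lambda>w. measure m (cell w)) \<in> borel_measurable (borel \<Otimes>\<^sub>M borel)"
     "(\<lambda>w. measure N (cell w)) \<in> borel_measurable (borel \<Otimes>\<^sub>M borel)"
    unfolding measure_def by measurable
  have T: "ennreal (T M M') = (\<integral>\<^sup>+w. emeasure M (cell w) * emeasure M' (cell w) \<partial>scale_lborel \<epsilon> R)" "0 \<le> T M M'"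
    if "prob_space M" "prob_space M'" "sets M = sets borel" "sets M' = sets borel"
      "integrable M (\<lambda>x. x)" "integrable M' (\<lambda>x. x)" for M M'
    unfolding T_def nn_integral_Tk_pair[OF assms(7,8) that(1-4), symmetric]
    using nn_integral_eq_integral[OF log_pair_approx(1)[OF that assms(7,8)]] Tk_nonneg[OF assms(7,8)]
    by (auto simp: integral_nonneg)
  let ?D = "\<integral>\<^sup>+w. ennreal ((measure m (cell w) - measure N (cell w))\<^sup>2) \<partial>scale_lborel \<epsilon> R"
  have "ennreal (T m m) + ennreal (T N N)
      = (\<integral>\<^sup>+w. emeasure m (cell w) * emeasure m (cell w) + emeasure N (cell w) * emeasure N (cell w) \<partial>scale_lborel \<epsilon> R)"
    by (simp add: T assms nn_integral_add)
  also have "\<dots> = (\<integral>\<^sup>+w. emeasure m (cell w) * emeasure N (cell w) + emeasure m (cell w) * emeasure N (cell w)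
       + ennreal ((measure m (cell w) - measure N (cell w))\<^sup>2) \<partial>scale_lborel \<epsilon> R)"
    by (intro nn_integral_cong) (simp add: m.emeasure_eq_measure N.emeasure_eq_measure ennreal_add_squares)
  also have "\<dots> = ennreal (T m N) + ennreal (T m N) + ?D"
    by (simp add: T assms nn_integral_add)
  finally have e: "ennreal (T m m + T N N) = ennreal (2 * T m N) + ?D"
    using T(2) assms by (simp add: ennreal_plus[symmetric] del: ennreal_plus)
  \<comment> \<open>The other side is a finite real number, so \<open>?D\<close> is finite and the
    equation may be solved for it in the reals.\<close>
  then have "?D \<noteq> \<infinity>" by (metis ennreal_add_eq_top ennreal_neq_top infinity_ennreal_def)
  then obtain d where d: "?D = ennreal d" "0 \<le> d" by (cases ?D) auto
  have "T m m + T N N = 2 * T m N + d"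
    using e T(2) assms d by (simp add: ennreal_plus[symmetric] del: ennreal_plus)
  then have "d = T m m + T N N - 2 * T m N" by simp
  with d show "?D = ennreal ((\<integral>z. Tk \<epsilon> R (fst z - snd z) \<partial>(m \<Otimes>\<^sub>M m)) + (\<integral>z. Tk \<epsilon> R (fst z - snd z) \<partial>(N \<Otimes>\<^sub>M N))
        - 2 * (\<integral>z. Tk \<epsilon> R (fst z - snd z) \<partial>(m \<Otimes>\<^sub>M N)))"
   "0 \<le> (\<integral>z. Tk \<epsilon> R (fst z - snd z) \<partial>(m \<Otimes>\<^sub>M m)) + (\<integral>z. Tk \<epsilon> R (fst z - snd z) \<partial>(N \<Otimes>\<^sub>M N))
        - 2 * (\<integral>z. Tk \<epsilon> R (fst z - snd z) \<partial>(m \<Otimes>\<^sub>M N))"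
    unfolding T_def by auto
qed

definition log_energy :: "real \<Rightarrow> real measure \<Rightarrow> real measure \<Rightarrow> real" where
  "log_energy \<epsilon> m N = log_pair \<epsilon> m m + log_pair \<epsilon> N N - 2 * log_pair \<epsilon> m N"

text \<open>The limit of large R. The constant ln R - 1 enters with total coefficient 1 + 1 - 2 = 0,
  because both measures have mass 1, and the errors are of order 1/R. The bound B is carried along
  so that strictly positive lower bounds survive the limit, not only nonnegativity.\<close>

lemma log_energy_ge:
  assumes "prob_space m" "prob_space N" and "sets m = sets borel" "sets N = sets borel"
    and "integrable m (\<lambda>x. x)" "integrable N (\<lambda>x. x :: real)" and "0 < \<epsilon>"
    and B: "\<And>R. R \<ge> K \<Longrightarrow> ennreal B \<le> (\<integral>\<^sup>+w. ennreal ((measure m (cell w) - measure N (cell w))\<^sup>2) \<partial>scale_lborel \<epsilon> R)"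
    and "0 \<le> B"
  shows "B \<le> log_energy \<epsilon> m N"
proof (rule tendsto_lowerbound)
  \<comment> \<open>The three approximation errors have numerators 2 A(m), 2 A(N) and, counted
    twice, A(m) + A(N), where A is the first absolute moment. They add up to 4 (A(m) +
    A(N)).\<close>
  let ?C = "4 * ((\<integral>x. \<bar>x\<bar> \<partial>m) + (\<integral>x. \<bar>x\<bar> \<partial>N))"
  show "((\<lambda>R. log_energy \<epsilon> m N + ?C / R) \<longlongrightarrow> log_energy \<epsilon> m N) at_top"
    using tendsto_add[OF tendsto_const tendsto_divide_0[OF tendsto_const filterlim_at_top_imp_at_infinity[OF filterlim_ident]]]
    by simp
  show "\<forall>\<^sub>F R in at_top. B \<le> log_energy \<epsilon> m N + ?C / R"
    using eventually_ge_at_top[of "max K \<epsilon>"]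
  proof eventually_elim
    case (elim R)
    then have R: "K \<le> R" "\<epsilon> \<le> R" by auto
    define T where "T M M' = (\<integral>z. Tk \<epsilon> R (fst z - snd z) \<partial>(M \<Otimes>\<^sub>M M'))" for M M' :: "real measure"
    define A where "A M = (\<integral>x. \<bar>x\<bar> \<partial>M)" for M :: "real measure"
    have 1: "B \<le> T m m + T N N - 2 * T m N"
      using B[OF R(1)] Tk_energy[OF assms(1-7) R(2)] by (simp add: T_def)
    note approx = log_pair_approx(2)[OF _ _ _ _ _ _ assms(7) R(2), folded T_def A_def]
    have 2: "\<bar>log_pair \<epsilon> m m - (T m m - ln R + 1)\<bar> \<le> (A m + A m) / R"
      "\<bar>log_pair \<epsilon> N N - (T N N - ln R + 1)\<bar> \<le> (A N + A N) / R"
      "\<bar>log_pair \<epsilon> m N - (T m N - ln R + 1)\<bar> \<le> (A m + A N) / R"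
      by (rule approx assms)+
    have 3: "4 * (A m + A N) / R = (A m + A m) / R + (A N + A N) / R + 2 * ((A m + A N) / R)"
      by (simp add: add_divide_distrib)
    have 4: "b \<le> x + y - 2 * w + k"
      if "b \<le> x' + y' - 2 * w'" "\<bar>x - (x' - l + 1)\<bar> \<le> u" "\<bar>y - (y' - l + 1)\<bar> \<le> v" "\<bar>w - (w' - l + 1)\<bar> \<le> t" "k = u + v + 2 * t"
      for b x y w k x' y' w' l u v t :: real
      using that unfolding abs_le_iff by linarith
    show ?case unfolding log_energy_def A_def[symmetric] by (rule 4[OF 1 2 3])
  qed
qed simp

lemma log_energy_nonneg:
  assumes "prob_space m" "prob_space N" and "sets m = sets borel" "sets N = sets borel"
    and "integrable m (\<lambda>x. x)" "integrable N (\<lambda>x. x :: real)" and "0 < \<epsilon>"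
  shows "0 \<le> log_energy \<epsilon> m N"
  by (rule log_energy_ge[OF assms]) auto

text \<open>If a slightly larger interval carries too little mass under m, then so does every cell
  that fits between the two intervals, and these cells form a set of positive measure. The condition
  \<epsilon> \<le> q - p guarantees that the truncation has not removed their lengths.\<close>

lemma log_energy_detects_deficit:
  assumes "prob_space m" "prob_space N" and s: "sets m = sets borel" "sets N = sets borel"
    and "integrable m (\<lambda>x. x)" "integrable N (\<lambda>x. x :: real)" and "0 < \<epsilon>" "\<epsilon> \<le> q - p" "0 < \<delta>" "0 \<le> \<eta>"
    and deficit: "measure m {p<..q + 2 * \<delta>} \<le> measure N {p + 2 * \<delta>..q} - \<eta>"
  shows "(\<delta> * \<eta> / (q - p + \<delta>))\<^sup>2 \<le> log_energy \<epsilon> m N"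
proof (rule log_energy_ge[OF assms(1-7), where K = "q - p + \<delta>"])
  interpret m: prob_space m by fact
  interpret N: prob_space N by fact
  fix R assume R: "q - p + \<delta> \<le> R"
  \<comment> \<open>For a length in \<open>?X\<close> and a left end in \<open>?Y\<close> the cell
    contains [p + 2 \<delta>, q] and stays inside (p, q + 2 \<delta>]. Both sides of this rectangle
    have length \<delta>, and 1/r^2 is at least 1/(q - p + \<delta>)^2 on it, which gives the
    claimed constant.\<close>
  let ?X = "{q - p..q - p + \<delta>} :: real set" and ?Y = "{p..p + \<delta>}"
  have cellbound: "\<eta>\<^sup>2 \<le> (measure m (cell w) - measure N (cell w))\<^sup>2" if "w \<in> ?X \<times> ?Y" for w
  proof -
    obtain r u where w: "w = (r, u)" by (cases w)
    have ru: "q - p \<le> r" "r \<le> q - p + \<delta>" "p \<le> u" "u \<le> p + \<delta>" using that unfolding w by auto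
    have "cell w \<subseteq> {p<..q + 2 * \<delta>}" unfolding cell_def w using ru by auto
    then have 1: "measure m (cell w) \<le> measure m {p<..q + 2 * \<delta>}"
      by (rule m.finite_measure_mono) (simp add: s)
    have "{p + 2 * \<delta>..q} \<subseteq> cell w" unfolding cell_def w using ru \<open>0 < \<delta>\<close> by auto
    then have 2: "measure N {p + 2 * \<delta>..q} \<le> measure N (cell w)"
      by (rule N.finite_measure_mono) (simp add: s cell_def)
    have "\<eta> \<le> measure N (cell w) - measure m (cell w)" using deficit 1 2 by linarith
    then have "\<eta>\<^sup>2 \<le> (measure N (cell w) - measure m (cell w))\<^sup>2" using \<open>0 \<le> \<eta>\<close> by (rule power_mono)
    then show ?thesis unfolding power2_commute[of "measure N (cell w)"] .
  qed
  let ?W = "density lborel (\<lambda>r. ennreal (1 / r\<^sup>2) * indicator {\<epsilon>..R} r)"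
  have pos: "0 < q - p + \<delta>" using assms by linarith
  have "ennreal ((\<delta> * \<eta> / (q - p + \<delta>))\<^sup>2) = ennreal (\<eta>\<^sup>2) * (ennreal (1 / (q - p + \<delta>)\<^sup>2 * \<delta>) * ennreal \<delta>)"
  proof -
    have "(\<delta> * \<eta> / s)\<^sup>2 = \<eta>\<^sup>2 * (1 / s\<^sup>2 * \<delta> * \<delta>)" for s
      by (simp add: power2_eq_square)
    moreover have "0 \<le> 1 / (q - p + \<delta>)\<^sup>2 * \<delta>" "0 \<le> \<delta>" using \<open>0 < \<delta>\<close> by auto
    ultimately show ?thesis by (subst ennreal_mult[symmetric], simp, simp, subst ennreal_mult[symmetric], simp, simp, simp)
  qed
  also have "\<dots> \<le> ennreal (\<eta>\<^sup>2) * (emeasure ?W ?X * emeasure lborel ?Y)"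
  proof (rule mult_left_mono)
    have "ennreal (1 / (q - p + \<delta>)\<^sup>2 * \<delta>) = (\<integral>\<^sup>+r. ennreal (1 / (q - p + \<delta>)\<^sup>2) * indicator ?X r \<partial>lborel)"
      using \<open>0 < \<delta>\<close> by (subst nn_integral_cmult_indicator) (simp_all add: ennreal_mult[symmetric])
    also have "\<dots> \<le> emeasure ?W ?X"
    proof -
      have "1 / (q - p + \<delta>)\<^sup>2 \<le> 1 / r\<^sup>2" "r \<in> {\<epsilon>..R}" if "r \<in> ?X" for r
      proof -
        have r: "0 < r" "\<epsilon> \<le> r" "r \<le> q - p + \<delta>" using that assms(7,8) by auto
        then show "r \<in> {\<epsilon>..R}" using R by simp
        have "r\<^sup>2 \<le> (q - p + \<delta>)\<^sup>2" by (rule power_mono) (use r in simp_all)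
        then show "1 / (q - p + \<delta>)\<^sup>2 \<le> 1 / r\<^sup>2"
          by (rule divide_left_mono) (use r pos in simp_all)
      qed
      then have "ennreal (1 / (q - p + \<delta>)\<^sup>2) * indicator ?X r \<le> ennreal (1 / r\<^sup>2) * indicator {\<epsilon>..R} r * indicator ?X r" for r
        by (cases "r \<in> ?X") (simp_all add: ennreal_leI del: atLeastAtMost_iff)
      then show ?thesis by (subst emeasure_density) (auto intro!: nn_integral_mono simp del: atLeastAtMost_iff)
    qed
    finally have "ennreal (1 / (q - p + \<delta>)\<^sup>2 * \<delta>) \<le> emeasure ?W ?X" .
    then show "ennreal (1 / (q - p + \<delta>)\<^sup>2 * \<delta>) * ennreal \<delta> \<le> emeasure ?W ?X * emeasure lborel ?Y"
      using \<open>0 < \<delta>\<close> mult_right_mono[of _ _ "ennreal \<delta>"] by simp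
  qed auto
  also have "\<dots> = ennreal (\<eta>\<^sup>2) * emeasure (scale_lborel \<epsilon> R) (?X \<times> ?Y)"
    unfolding scale_lborel_def by (subst lborel.emeasure_pair_measure_Times) auto
  also have "\<dots> = (\<integral>\<^sup>+w. ennreal (\<eta>\<^sup>2) * indicator (?X \<times> ?Y) w \<partial>scale_lborel \<epsilon> R)"
    by (subst nn_integral_cmult_indicator) (auto simp: sets_scale_lborel)
  also have "\<dots> \<le> (\<integral>\<^sup>+w. ennreal ((measure m (cell w) - measure N (cell w))\<^sup>2) \<partial>scale_lborel \<epsilon> R)"
    using cellbound by (intro nn_integral_mono) (auto simp: indicator_def)
  finally show "ennreal ((\<delta> * \<eta> / (q - p + \<delta>))\<^sup>2) \<le> (\<integral>\<^sup>+w. ennreal ((measure m (cell w) - measure N (cell w))\<^sup>2) \<partial>scale_lborel \<epsilon> R)" .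
qed simp

section \<open>Integrals over the unit circle\<close>

abbreviation e2 :: "real \<Rightarrow> complex" where "e2 \<tau> \<equiv> cis (2 * pi * \<tau>)"

text \<open>Cauchy's formula with dz = 2 \<pi> i e d\<tau>. Dividing by 2 \<pi> i leaves the extra
  factor \<open>e2 \<tau>\<close> in the integrand.\<close>

lemma circle_Cauchy_derivative:
  assumes "f holomorphic_on ball 0 R" "1 < R" "norm w < 1"
  shows "((\<lambda>\<tau>. f (e2 \<tau>) * e2 \<tau> / (e2 \<tau> - w) ^ Suc k) has_integral (deriv ^^ k) f w / fact k) {0..1}"
proof -
  have "((\<lambda>u. f u / (u - w) ^ Suc k) has_contour_integral ((2 * pi * \<i>) / fact k * (deriv ^^ k) f w)) (circlepath 0 1)"
    using assms
    by (intro Cauchy_has_contour_integral_higher_derivative_circlepath holomorphic_on_imp_continuous_on holomorphic_on_subset[OF assms(1)])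
       (auto simp: dist_norm)
  then have "((\<lambda>x. f (circlepath 0 1 x) / (circlepath 0 1 x - w) ^ Suc k * vector_derivative (circlepath 0 1) (at x within {0..1}))
      has_integral ((2 * pi * \<i>) / fact k * (deriv ^^ k) f w)) {0..1}"
    unfolding has_contour_integral_def .
  then have "((\<lambda>x. f (e2 x) / (e2 x - w) ^ Suc k * (2 * pi * \<i> * e2 x))
      has_integral ((2 * pi * \<i>) / fact k * (deriv ^^ k) f w)) {0..1}"
  proof (rule has_integral_eq[rotated])
    fix x :: real assume "x \<in> {0..1}"
    then have "vector_derivative (circlepath 0 1) (at x within {0..1}) = 2 * pi * \<i> * e2 x"
      by (simp add: vector_derivative_circlepath01 cis_conv_exp mult_ac)
    moreover have "circlepath 0 1 x = e2 x" by (simp add: circlepath cis_conv_exp mult_ac)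
    ultimately show "f (circlepath 0 1 x) / (circlepath 0 1 x - w) ^ Suc k * vector_derivative (circlepath 0 1) (at x within {0..1})
        = f (e2 x) / (e2 x - w) ^ Suc k * (2 * pi * \<i> * e2 x)" by simp
  qed
  from has_integral_mult_right[OF this, of "1 / (2 * pi * \<i>)"]
  show ?thesis by (simp add: field_simps)
qed

lemma circle_Cauchy:
  assumes "f holomorphic_on ball 0 R" "1 < R" "norm w < 1"
  shows "((\<lambda>\<tau>. f (e2 \<tau>) * e2 \<tau> / (e2 \<tau> - w)) has_integral f w) {0..1}"
  using circle_Cauchy_derivative[OF assms, of 0] by simp

lemma circle_mean_value:
  assumes "f holomorphic_on ball 0 R" "1 < R"
  shows "((\<lambda>\<tau>. f (e2 \<tau>)) has_integral f 0) {0..1}"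
  using circle_Cauchy[OF assms, of 0] by simp

text \<open>The circle density: with \<open>q = r/p\<close>, the image of the equilibrium measure under squaring is
  the image of \<open>circle_weight q \<tau> d\<tau>\<close> under \<open>\<tau> \<mapsto> p\<^sup>2 + r\<^sup>2 + 2 p r cos (2 \<pi> \<tau>)\<close>.
  It equals \<open>2 sin\<^sup>2 (2 \<pi> \<tau>) / \<bar>1 + q e\<bar>\<^sup>2\<close>, \<open>e = exp (2 \<pi> i \<tau>)\<close>, in partial fractions; for \<open>q = 1\<close>
  the last term vanishes, also at its pole.\<close>

definition circle_weight :: "real \<Rightarrow> real \<Rightarrow> real" where
  "circle_weight q \<tau> = (1 + q\<^sup>2) / (2 * q\<^sup>2) - cos (2 * pi * \<tau>) / q
     - (1 - q\<^sup>2)\<^sup>2 / (2 * q\<^sup>2) / (1 + q\<^sup>2 + 2 * q * cos (2 * pi * \<tau>))"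

lemma circle_denom_pos:
  fixes q x :: real
  assumes "0 < q" "q < 1"
  shows "0 < 1 + q\<^sup>2 + 2 * q * cos x"
proof -
  have "0 < (1 - q) ^ 2" by (rule zero_less_power) (use assms in simp)
  moreover have "q * (-1) \<le> q * cos x" by (rule mult_left_mono) (use assms in simp_all)
  ultimately show ?thesis by (simp add: power2_eq_square algebra_simps)
qed

lemma circle_weight_eq:
  assumes "0 < q" "q \<le> 1" "1 + q\<^sup>2 + 2 * q * cos (2 * pi * \<tau>) \<noteq> 0"
  shows "circle_weight q \<tau> = 2 * (sin (2 * pi * \<tau>))\<^sup>2 / (1 + q\<^sup>2 + 2 * q * cos (2 * pi * \<tau>))"
proof -
  define C D where "C = cos (2 * pi * \<tau>)" and "D = 1 + q\<^sup>2 + 2 * q * C"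
  have e: "(1 + q\<^sup>2 - 2 * q * C) * D - (1 - q\<^sup>2)\<^sup>2 = 2 * q\<^sup>2 * (2 * (1 - C\<^sup>2))"
    by (simp add: D_def power2_eq_square algebra_simps)
  have D: "D \<noteq> 0" using assms(3) by (simp add: D_def C_def)
  have "circle_weight q \<tau> = ((1 + q\<^sup>2 - 2 * q * C) * D - (1 - q\<^sup>2)\<^sup>2) / (2 * q\<^sup>2 * D)"
    unfolding circle_weight_def C_def[symmetric] D_def[symmetric] using D assms(1)
    by (simp add: diff_divide_distrib power2_eq_square)
  also have "\<dots> = 2 * (1 - C\<^sup>2) / D" unfolding e using assms(1) by simp
  finally show ?thesis unfolding sin_squared_eq C_def D_def .
qed

lemma circle_weight_1: "circle_weight 1 \<tau> = 1 - cos (2 * pi * \<tau>)"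
  by (simp add: circle_weight_def)

lemma continuous_on_circle_weight:
  assumes "0 < q" "q \<le> 1"
  shows "continuous_on S (circle_weight q)"
proof (cases "q = 1")
  case True then show ?thesis by (auto simp: circle_weight_1[abs_def] intro!: continuous_intros)
next
  case False
  then have "q < 1" using assms by simp
  then have "1 + q\<^sup>2 + 2 * q * cos x \<noteq> 0" for x using circle_denom_pos[OF assms(1), of x] by linarith
  then show ?thesis unfolding circle_weight_def[abs_def] using assms by (intro continuous_intros) auto
qed

lemma circle_weight_nonneg:
  assumes "0 < q" "q \<le> 1"
  shows "0 \<le> circle_weight q \<tau>"
proof (cases "q = 1")
  case False
  then show ?thesis using circle_denom_pos[of q "2*pi*\<tau>"] assms by (simp add: circle_weight_eq)
qed (simp add: circle_weight_1)

section \<open>Holomorphic functions integrated against the circle weight\<close>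

lemma poisson_partial_fractions:
  fixes z Q :: complex
  assumes "z \<noteq> 0" "1 + Q * z \<noteq> 0" "z + Q \<noteq> 0"
  shows "(1 - Q\<^sup>2)\<^sup>2 / (2 * Q\<^sup>2) / ((1 + Q * z) * (z + Q) / z)
    = (1 - Q\<^sup>2) / (2 * Q\<^sup>2) * (1 / (1 + Q * z) + z / (z + Q) - 1)"
proof -
  have "1 / (1 + Q * z) + z / (z + Q) - 1 = (z + Q + z * (1 + Q * z) - (1 + Q * z) * (z + Q)) / ((1 + Q * z) * (z + Q))"
  proof -
    have "1 / a + z / v - 1 = (v + z * a - a * v) / (a * v)" if "a \<noteq> 0" "v \<noteq> 0" for a v
      using that by (simp add: field_simps)
    then show ?thesis using assms by blast
  qed
  also have "z + Q + z * (1 + Q * z) - (1 + Q * z) * (z + Q) = z * (1 - Q\<^sup>2)"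
    by (simp add: algebra_simps power2_eq_square)
  finally show ?thesis by (simp add: power2_eq_square[of "1 - Q\<^sup>2"])
qed

text \<open>On the circle the weight is rational in z = e. The product g z has mean 0 and g / z has
  mean g'(0), which accounts for the cosine. The last term splits into 1/(1 + q z), regular in the
  closed disc, z/(z + q), whose pole produces g(-q), and -1; the means of the first and third pieces
  cancel. For q = 1 this term is absent.\<close>

lemma circle_integral_weight:
  assumes q: "0 < q" "q \<le> 1" and g: "g holomorphic_on ball 0 R" "1 < R"
  shows "((\<lambda>\<tau>. g (e2 \<tau>) * of_real (circle_weight q \<tau>)) has_integral
     of_real ((1 + q\<^sup>2) / (2 * q\<^sup>2)) * g 0 - of_real (1 / (2 * q)) * deriv g 0
       - of_real ((1 - q\<^sup>2) / (2 * q\<^sup>2)) * g (- of_real q)) {0..1}"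
proof -
  let ?A = "of_real ((1 + q\<^sup>2) / (2 * q\<^sup>2)) :: complex" and ?B = "of_real (1 / (2 * q)) :: complex"
    and ?C = "of_real ((1 - q\<^sup>2) / (2 * q\<^sup>2)) :: complex"
  have distrib: "A * x - B * (x * z + x / z) - C * (x / u + x * z / v - x) = x * (A - B * (z + 1 / z) - C * (1 / u + z / v - 1))"
    for A B C x z u v :: complex by (simp add: algebra_simps)
  have A: "((\<lambda>\<tau>. ?A * g (e2 \<tau>)) has_integral ?A * g 0) {0..1}"
    by (intro has_integral_mult_right circle_mean_value[OF g])
  have B1: "((\<lambda>\<tau>. g (e2 \<tau>) * e2 \<tau>) has_integral g 0 * 0) {0..1}"
    using circle_mean_value[of "\<lambda>z. g z * z" R] g by (simp add: holomorphic_on_mult holomorphic_on_ident)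
  have B2: "((\<lambda>\<tau>. g (e2 \<tau>) / e2 \<tau>) has_integral deriv g 0) {0..1}"
    using circle_Cauchy_derivative[OF g, of 0 1] by (simp add: field_simps)
  have AB: "((\<lambda>\<tau>. ?A * g (e2 \<tau>) - ?B * (g (e2 \<tau>) * e2 \<tau> + g (e2 \<tau>) / e2 \<tau>)) has_integral
     ?A * g 0 - ?B * (g 0 * 0 + deriv g 0)) {0..1}"
    by (intro has_integral_diff has_integral_mult_right has_integral_add A B1 B2)
  have cos2: "complex_of_real (cos (2 * pi * \<tau>)) = (e2 \<tau> + 1 / e2 \<tau>) / 2" for \<tau>
  proof -
    have "1 / e2 \<tau> = cis (- (2 * pi * \<tau>))" by (simp add: divide_inverse)
    then show ?thesis by (simp only:) (simp add: complex_eq_iff)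
  qed
  show ?thesis
  proof (cases "q = 1")
    case True
    have "((\<lambda>\<tau>. g (e2 \<tau>) * of_real (circle_weight q \<tau>)) has_integral ?A * g 0 - ?B * (g 0 * 0 + deriv g 0)) {0..1}"
    proof (rule has_integral_eq[OF _ AB])
      fix \<tau> :: real
      define z where "z = e2 \<tau>"
      have w: "complex_of_real (circle_weight q \<tau>) = 1 - (z + 1 / z) / 2"
        by (simp add: True circle_weight_1 cos2 z_def)
      show "?A * g (e2 \<tau>) - ?B * (g (e2 \<tau>) * e2 \<tau> + g (e2 \<tau>) / e2 \<tau>) = g (e2 \<tau>) * of_real (circle_weight q \<tau>)"
        unfolding w z_def[symmetric] by (simp add: True algebra_simps add_divide_distrib)
    qed
    then show ?thesis using True by simp
  next
    case False
    then have q1: "q < 1" using q by simp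
    \<comment> \<open>The pole of 1/(1 + q z) lies at -1/q, outside the closed unit disc. The radius
      \<open>R'\<close> stays clear of it and still exceeds 1.\<close>
    define R' where "R' = min R (1 / q)"
    have R': "1 < R'" using q1 q g by (auto simp: R'_def)
    have nz: "1 + of_real q * z \<noteq> 0" if "z \<in> ball 0 R'" for z :: complex
    proof
      assume "1 + of_real q * z = 0"
      then have "of_real q * z = -1" by (simp add: eq_neg_iff_add_eq_0 add.commute)
      then have "norm (of_real q * z) = 1" by simp
      moreover have "norm z < 1 / q" using that by (auto simp: R'_def)
      ultimately show False using q by (simp add: norm_mult field_simps)
    qed
    have hol: "(\<lambda>z. g z / (1 + of_real q * z)) holomorphic_on ball 0 R'"
      using nz by (intro holomorphic_intros holomorphic_on_subset[OF g(1)]) (auto simp: R'_def)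
    have C1: "((\<lambda>\<tau>. g (e2 \<tau>) / (1 + of_real q * e2 \<tau>)) has_integral g 0) {0..1}"
      using circle_mean_value[OF hol R'] by simp
    have C2: "((\<lambda>\<tau>. g (e2 \<tau>) * e2 \<tau> / (e2 \<tau> + of_real q)) has_integral g (- of_real q)) {0..1}"
      using circle_Cauchy[OF g, of "- of_real q"] q1 q by simp
    have "((\<lambda>\<tau>. ?A * g (e2 \<tau>) - ?B * (g (e2 \<tau>) * e2 \<tau> + g (e2 \<tau>) / e2 \<tau>)
         - ?C * (g (e2 \<tau>) / (1 + of_real q * e2 \<tau>) + g (e2 \<tau>) * e2 \<tau> / (e2 \<tau> + of_real q) - g (e2 \<tau>))) has_integral
        ?A * g 0 - ?B * (g 0 * 0 + deriv g 0) - ?C * (g 0 + g (- of_real q) - g 0)) {0..1}"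
      by (intro has_integral_diff has_integral_mult_right has_integral_add AB C1 C2 circle_mean_value[OF g])
    then have "((\<lambda>\<tau>. g (e2 \<tau>) * of_real (circle_weight q \<tau>)) has_integral
        ?A * g 0 - ?B * (g 0 * 0 + deriv g 0) - ?C * (g 0 + g (- of_real q) - g 0)) {0..1}"
    proof (rule has_integral_eq[rotated])
      fix \<tau> :: real
      define z where "z = e2 \<tau>"
      have z: "z \<noteq> 0" by (simp add: z_def)
      have z1: "1 + of_real q * z \<noteq> 0" using nz[of z] R' by (simp add: z_def)
      have z2: "z + of_real q \<noteq> 0"
      proof
        assume "z + of_real q = 0"
        then have "z = - of_real q" by (simp add: eq_neg_iff_add_eq_0)
        then have "norm z = q" using q by simp
        then show False using q1 by (simp add: z_def)
      qed
      have den: "1 + of_real q ^ 2 + 2 * of_real q * ((z + 1 / z) / 2) = (1 + of_real q * z) * (z + of_real q) / z"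
        using z by (simp add: field_simps power2_eq_square)
      have w: "complex_of_real (circle_weight q \<tau>) = ?A - ?B * (z + 1 / z)
         - of_real ((1 - q\<^sup>2)\<^sup>2 / (2 * q\<^sup>2)) / ((1 + of_real q * z) * (z + of_real q) / z)"
        unfolding circle_weight_def den[symmetric] by (simp add: cos2 z_def)
      have pf: "of_real ((1 - q\<^sup>2)\<^sup>2 / (2 * q\<^sup>2)) / ((1 + of_real q * z) * (z + of_real q) / z)
         = ?C * (1 / (1 + of_real q * z) + z / (z + of_real q) - 1)"
        using poisson_partial_fractions[OF z z1 z2] by simp
      show "?A * g (e2 \<tau>) - ?B * (g (e2 \<tau>) * e2 \<tau> + g (e2 \<tau>) / e2 \<tau>)
         - ?C * (g (e2 \<tau>) / (1 + of_real q * e2 \<tau>) + g (e2 \<tau>) * e2 \<tau> / (e2 \<tau> + of_real q) - g (e2 \<tau>))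
         = g (e2 \<tau>) * of_real (circle_weight q \<tau>)"
        unfolding w pf z_def[symmetric] by (rule distrib)
    qed
    then show ?thesis by simp
  qed
qed

lemma circle_weight_integral_1:
  assumes "0 < q" "q \<le> 1"
  shows "(circle_weight q has_integral 1) {0..1}"
proof -
  have "((\<lambda>\<tau>. 1 * complex_of_real (circle_weight q \<tau>)) has_integral of_real ((1 + q\<^sup>2) / (2 * q\<^sup>2) - (1 - q\<^sup>2) / (2 * q\<^sup>2))) {0..1}"
    using circle_integral_weight[OF assms, of "\<lambda>z. 1" 2] by simp
  from has_integral_Re[OF this] show ?thesis using assms by (simp add: diff_divide_distrib[symmetric])
qed

lemma circle_weight_integral_cos:
  assumes "0 < q" "q \<le> 1"
  shows "((\<lambda>\<tau>. cos (2 * pi * \<tau>) * circle_weight q \<tau>) has_integral (- q / 2)) {0..1}"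
proof -
  have "((\<lambda>\<tau>. e2 \<tau> * complex_of_real (circle_weight q \<tau>)) has_integral of_real (- (1 / (2 * q)) + (1 - q\<^sup>2) / (2 * q\<^sup>2) * q)) {0..1}"
    using circle_integral_weight[OF assms, of "\<lambda>z. z" 2] by simp
  moreover have "- (1 / (2 * q)) + (1 - q\<^sup>2) / (2 * q\<^sup>2) * q = - q / 2"
    using assms by (simp add: field_simps power2_eq_square)
  ultimately have "((\<lambda>\<tau>. e2 \<tau> * complex_of_real (circle_weight q \<tau>)) has_integral of_real (- q / 2)) {0..1}" by (simp only:)
  from has_integral_Re[OF this] show ?thesis by simp
qed

text \<open>The case g(z) = Ln (1 - \<zeta> z), which is holomorphic for |z| < 1/|\<zeta>| because 1
  - \<zeta> z has positive real part there. It has g(0) = 0 and g'(0) = -\<zeta>; the claim is the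
  real part.\<close>

lemma circle_weight_integral_ln:
  assumes q: "0 < q" "q \<le> 1" and \<zeta>: "norm \<zeta> < 1"
  shows "((\<lambda>\<tau>. ln (norm (1 - \<zeta> * e2 \<tau>)) * circle_weight q \<tau>) has_integral
     Re \<zeta> / (2 * q) - (1 - q\<^sup>2) / (2 * q\<^sup>2) * ln (norm (1 + of_real q * \<zeta>))) {0..1}"
proof -
  define R where "R = (if \<zeta> = 0 then 2 else 1 / norm \<zeta>)"
  have R: "1 < R" using \<zeta> by (auto simp: R_def)
  have pos: "1 - \<zeta> * z \<notin> \<real>\<^sub>\<le>\<^sub>0" if "z \<in> ball 0 R" for z
  proof -
    have "norm (\<zeta> * z) < 1" using that by (auto simp: R_def norm_mult field_simps split: if_splits)
    then have "Re (\<zeta> * z) < 1" using complex_Re_le_cmod[of "\<zeta> * z"] by linarith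
    then show ?thesis by (auto simp: complex_nonpos_Reals_iff)
  qed
  have hol: "(\<lambda>z. Ln (1 - \<zeta> * z)) holomorphic_on ball 0 R"
    using pos by (auto intro!: holomorphic_intros)
  have d: "deriv (\<lambda>z. Ln (1 - \<zeta> * z)) 0 = - \<zeta>"
    by (rule DERIV_imp_deriv) (auto intro!: derivative_eq_intros)
  have "((\<lambda>\<tau>. Re (Ln (1 - \<zeta> * e2 \<tau>) * of_real (circle_weight q \<tau>))) has_integral
     Re (of_real (1 / (2 * q)) * \<zeta> - of_real ((1 - q\<^sup>2) / (2 * q\<^sup>2)) * Ln (1 + \<zeta> * of_real q))) {0..1}"
    using has_integral_Re[OF circle_integral_weight[OF q hol R]] by (simp add: d)
  moreover have "Re (Ln (1 - \<zeta> * e2 \<tau>)) = ln (norm (1 - \<zeta> * e2 \<tau>))" for \<tau>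
    using pos[of "e2 \<tau>"] R by (intro Re_Ln) auto
  moreover have "Re (Ln (1 + \<zeta> * of_real q)) = ln (norm (1 + of_real q * \<zeta>))"
    using pos[of "- of_real q"] R q by (subst Re_Ln) (auto simp: mult.commute)
  ultimately show ?thesis by simp
qed

section \<open>The equilibrium measure\<close>

lemma nn_integral_lborel_reflect:
  fixes g :: "real \<Rightarrow> ennreal"
  assumes [measurable]: "g \<in> borel_measurable borel"
  shows "(\<integral>\<^sup>+t. g (s - t) \<partial>lborel) = (\<integral>\<^sup>+t. g t \<partial>lborel)"
  using nn_integral_real_affine[OF assms, of "-1" s] by simp

lemma AE_lborel_neq: "AE t in lborel. t \<noteq> (x::real)"
  by (rule AE_I[where N="{x}"]) auto

text \<open>The gap is the part of the scale mixture with lengths below \<epsilon>, namely the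
  integral of (r - |y|)/r^2 over r from |y| to \<epsilon>. After exchanging integrals, each r
  contributes at most a box of height 1/r and width 2 r. The bound does not depend on x.\<close>

lemma nn_integral_log_gap:
  assumes "0 < \<epsilon>"
  shows "(\<integral>\<^sup>+y. ennreal (- ln \<bar>x - y\<bar> - Lk \<epsilon> (x - y)) \<partial>lborel) \<le> ennreal (2 * \<epsilon>)"
proof -
  have pw: "ennreal (- ln \<bar>y\<bar> - Lk \<epsilon> y)
     \<le> (\<integral>\<^sup>+r. ennreal (max 0 (r - \<bar>y\<bar>) / r\<^sup>2) * indicator {0<..\<epsilon>} r \<partial>lborel)" if "y \<noteq> 0" for y
  proof (cases "\<bar>y\<bar> \<le> \<epsilon>")
    case True
    have "ennreal (- ln \<bar>y\<bar> - Lk \<epsilon> y) = ennreal (ln \<epsilon> - ln (max \<bar>y\<bar> \<bar>y\<bar>) + \<bar>y\<bar> / \<epsilon> - \<bar>y\<bar> / max \<bar>y\<bar> \<bar>y\<bar>)"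
      using True that assms by (cases "\<bar>y\<bar> = \<epsilon>") (auto simp: Lk_def algebra_simps)
    also have "\<dots> = (\<integral>\<^sup>+r. ennreal (max 0 (r - \<bar>y\<bar>) / r\<^sup>2) * indicator {\<bar>y\<bar>..\<epsilon>} r \<partial>lborel)"
      by (rule triangle_kernel_integral[symmetric]) (use True that in auto)
    also have "\<dots> \<le> (\<integral>\<^sup>+r. ennreal (max 0 (r - \<bar>y\<bar>) / r\<^sup>2) * indicator {0<..\<epsilon>} r \<partial>lborel)"
      using that by (intro nn_integral_mono) (auto split: split_indicator)
    finally show ?thesis .
  next
    case False
    then show ?thesis by (simp add: Lk_def)
  qed
  have "(\<integral>\<^sup>+y. ennreal (- ln \<bar>x - y\<bar> - Lk \<epsilon> (x - y)) \<partial>lborel) = (\<integral>\<^sup>+y. ennreal (- ln \<bar>y\<bar> - Lk \<epsilon> y) \<partial>lborel)"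
    using nn_integral_lborel_reflect[of "\<lambda>y. ennreal (- ln \<bar>y\<bar> - Lk \<epsilon> y)" x] by simp
  also have "\<dots> \<le> (\<integral>\<^sup>+y. \<integral>\<^sup>+r. ennreal (max 0 (r - \<bar>y\<bar>) / r\<^sup>2) * indicator {0<..\<epsilon>} r \<partial>lborel \<partial>lborel)"
    by (rule nn_integral_mono_AE) (use AE_lborel_neq[of 0] pw in auto)
  also have "\<dots> = (\<integral>\<^sup>+r. \<integral>\<^sup>+y. ennreal (max 0 (r - \<bar>y\<bar>) / r\<^sup>2) * indicator {0<..\<epsilon>} r \<partial>lborel \<partial>lborel)"
    by (rule lborel_pair.Fubini'[symmetric]) measurable
  also have "\<dots> \<le> (\<integral>\<^sup>+r. 2 * indicator {0<..\<epsilon>} r \<partial>lborel)"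
  proof (rule nn_integral_mono)
    fix r :: real
    show "(\<integral>\<^sup>+y. ennreal (max 0 (r - \<bar>y\<bar>) / r\<^sup>2) * indicator {0<..\<epsilon>} r \<partial>lborel) \<le> 2 * indicator {0<..\<epsilon>} r"
    proof (cases "r \<in> {0<..\<epsilon>}")
      case True
      have "max 0 (r - \<bar>y\<bar>) / r\<^sup>2 \<le> (1 / r)" if "\<bar>y\<bar> \<le> r" for y
        using that True by (simp add: max_def field_simps power2_eq_square)
      then have "(\<integral>\<^sup>+y. ennreal (max 0 (r - \<bar>y\<bar>) / r\<^sup>2) * indicator {0<..\<epsilon>} r \<partial>lborel)
         \<le> (\<integral>\<^sup>+y. ennreal (1 / r) * indicator {-r..r} y \<partial>lborel)"
        using True by (intro nn_integral_mono) (auto split: split_indicator simp: ennreal_leI max_def)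
      also have "\<dots> = ennreal (1 / r) * ennreal (2 * r)"
        using True by (subst nn_integral_cmult_indicator) auto
      also have "\<dots> = 2" using True by (subst ennreal_mult[symmetric]) auto
      finally show ?thesis using True by simp
    qed simp
  qed
  also have "\<dots> = ennreal (2 * \<epsilon>)"
    using assms by (subst nn_integral_cmult_indicator) (auto simp: ennreal_mult)
  finally show ?thesis .
qed

section \<open>Circle coordinates for the image under squaring\<close>

definition pp :: "real \<Rightarrow> real \<Rightarrow> real" where "pp \<beta> c = sqrt (c + \<beta> / 4)"
definition rr :: "real \<Rightarrow> real" where "rr \<beta> = sqrt \<beta> / 2"
definition qq :: "real \<Rightarrow> real \<Rightarrow> real" where "qq \<beta> c = rr \<beta> / pp \<beta> c"

definition YY :: "real \<Rightarrow> real \<Rightarrow> real \<Rightarrow> real" where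
  "YY \<beta> c \<tau> = (pp \<beta> c)\<^sup>2 + (rr \<beta>)\<^sup>2 + 2 * pp \<beta> c * rr \<beta> * cos (2 * pi * \<tau>)"

definition circle_measure :: "real \<Rightarrow> real measure" where
  "circle_measure q = density lborel (\<lambda>\<tau>. ennreal (circle_weight q \<tau>) * indicator {0..1} \<tau>)"

lemma YY_measurable [measurable]: "YY \<beta> c \<in> borel_measurable borel"
  unfolding YY_def[abs_def] by measurable

lemma circle_weight_measurable [measurable]: "circle_weight q \<in> borel_measurable borel"
  unfolding circle_weight_def[abs_def] by measurable

lemma sets_circle_measure [simp, measurable_cong]: "sets (circle_measure q) = sets borel"
  by (simp add: circle_measure_def)

lemma space_circle_measure [simp]: "space (circle_measure q) = UNIV"
  by (simp add: circle_measure_def)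

text \<open>Passage from the gauge integrals in which Cauchy's formula is stated to Lebesgue
  integrals against \<open>circle_measure\<close>; continuity on the compact interval supplies
  absolute integrability.\<close>

lemma circle_integral_continuous:
  assumes "0 < q" "q \<le> 1" and f: "continuous_on {0..1} f" and I: "((\<lambda>\<tau>. f \<tau> * circle_weight q \<tau>) has_integral I) {0..1}"
    and [measurable]: "f \<in> borel_measurable borel"
  shows "integrable (circle_measure q) f" "(\<integral>\<tau>. f \<tau> \<partial>circle_measure q) = (I :: real)"
proof -
  note w = circle_weight_nonneg[OF assms(1,2)]
  have cm: "circle_measure q = density lborel (\<lambda>\<tau>. ennreal (circle_weight q \<tau> * indicator {0..1} \<tau>))"
    unfolding circle_measure_def by (rule density_cong) (auto split: split_indicator)
  have "set_integrable lborel {0..1} (\<lambda>\<tau>. f \<tau> * circle_weight q \<tau>)"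
    by (rule borel_integrable_atLeastAtMost') (intro continuous_on_mult f continuous_on_circle_weight assms)
  then have i: "integrable lborel (\<lambda>\<tau>. circle_weight q \<tau> * indicator {0..1} \<tau> * f \<tau>)"
    and e: "(\<integral>\<tau>. circle_weight q \<tau> * indicator {0..1} \<tau> * f \<tau> \<partial>lborel) = I"
    using set_borel_integral_eq_integral(2)[of "{0..1}" "\<lambda>\<tau>. f \<tau> * circle_weight q \<tau>"] integral_unique[OF I]
    by (auto simp: set_integrable_def set_lebesgue_integral_def mult_ac)
  show "integrable (circle_measure q) f"
    unfolding cm using i w by (subst integrable_density) auto
  show "(\<integral>\<tau>. f \<tau> \<partial>circle_measure q) = I"
    unfolding cm using e w by (subst integral_density) auto
qed

locale log_gas =
  fixes \<beta> c :: real
  assumes \<beta>: "0 < \<beta>" and c: "0 \<le> c"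
begin

lemma pp_rr:
  "0 < pp \<beta> c" "0 < rr \<beta>" "(pp \<beta> c)\<^sup>2 = c + \<beta> / 4" "(rr \<beta>)\<^sup>2 = \<beta> / 4" "rr \<beta> \<le> pp \<beta> c"
proof -
  show 1: "0 < pp \<beta> c" "0 < rr \<beta>" "(pp \<beta> c)\<^sup>2 = c + \<beta> / 4" "(rr \<beta>)\<^sup>2 = \<beta> / 4"
    using \<beta> c by (simp_all add: pp_def rr_def power_divide)
  show "rr \<beta> \<le> pp \<beta> c" by (rule power2_le_imp_le) (use 1 \<beta> c in simp_all)
qed

lemma qq: "0 < qq \<beta> c" "qq \<beta> c \<le> 1" "rr \<beta> = qq \<beta> c * pp \<beta> c" "c = (pp \<beta> c)\<^sup>2 - (rr \<beta>)\<^sup>2"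
  using pp_rr by (auto simp: qq_def)

text \<open>After squaring, both edges are c + \<beta>/2 plus or minus (\<beta>/2) sqrt (1 + 4
  c/\<beta>). The first term is p^2 + r^2 and the second is 2 p r. Thus p and r are the centre and
  the half-width of [a, b].\<close>

lemma edges: "edge_a \<beta> c = pp \<beta> c - rr \<beta>" "edge_b \<beta> c = pp \<beta> c + rr \<beta>"
proof -
  have s: "\<beta> / 2 * sqrt (1 + 4 * c / \<beta>) = 2 * pp \<beta> c * rr \<beta>"
  proof (rule power2_eq_imp_eq)
    have "0 \<le> 1 + 4 * c / \<beta>" using \<beta> c by simp
    then show "(\<beta> / 2 * sqrt (1 + 4 * c / \<beta>))\<^sup>2 = (2 * pp \<beta> c * rr \<beta>)\<^sup>2"
      using \<beta> by (simp add: power_mult_distrib pp_rr power_divide) (simp add: field_simps power2_eq_square)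
  qed (use pp_rr \<beta> c in auto)
  have "edge_a \<beta> c = sqrt (\<beta> / 2 * (1 + 2 * c / \<beta> - sqrt (1 + 4 * c / \<beta>)))"
    by (simp only: edge_a_def real_sqrt_mult)
  also have "\<beta> / 2 * (1 + 2 * c / \<beta> - sqrt (1 + 4 * c / \<beta>)) = \<beta> / 2 + c - \<beta> / 2 * sqrt (1 + 4 * c / \<beta>)"
    using \<beta> by (simp add: algebra_simps)
  also have "\<dots> = (pp \<beta> c - rr \<beta>)\<^sup>2"
    unfolding s by (simp add: power2_diff pp_rr)
  finally show "edge_a \<beta> c = pp \<beta> c - rr \<beta>" using pp_rr by simp
  have "edge_b \<beta> c = sqrt (\<beta> / 2 * (1 + 2 * c / \<beta> + sqrt (1 + 4 * c / \<beta>)))"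
    by (simp only: edge_b_def real_sqrt_mult)
  also have "\<beta> / 2 * (1 + 2 * c / \<beta> + sqrt (1 + 4 * c / \<beta>)) = \<beta> / 2 + c + \<beta> / 2 * sqrt (1 + 4 * c / \<beta>)"
    using \<beta> by (simp add: algebra_simps)
  also have "\<dots> = (pp \<beta> c + rr \<beta>)\<^sup>2"
    unfolding s by (simp add: power2_sum pp_rr)
  finally show "edge_b \<beta> c = pp \<beta> c + rr \<beta>" using pp_rr by simp
qed

lemma edge_ab: "0 \<le> edge_a \<beta> c" "edge_a \<beta> c < edge_b \<beta> c" "0 < edge_b \<beta> c"
  using pp_rr edges by auto

text \<open>Since a < b, the product under the root is at most 0 off the support, so a positive part
  replaces the case distinction. This form shows measurability and also continuity of the density in
  c.\<close>

lemma eq_density_eq: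
  "eq_density \<beta> c t = 2 / (pi * \<beta>) * (1 / \<bar>t\<bar>) * sqrt (max 0 ((t\<^sup>2 - (edge_a \<beta> c)\<^sup>2) * ((edge_b \<beta> c)\<^sup>2 - t\<^sup>2)))"
proof -
  let ?a = "edge_a \<beta> c" and ?b = "edge_b \<beta> c"
  have ab: "?a\<^sup>2 < ?b\<^sup>2" using edge_ab by (intro power_strict_mono) auto
  have 1: "?a \<le> \<bar>t\<bar> \<longleftrightarrow> ?a\<^sup>2 \<le> t\<^sup>2" using edge_ab abs_le_square_iff[of ?a t] by simp
  have 2: "\<bar>t\<bar> \<le> ?b \<longleftrightarrow> t\<^sup>2 \<le> ?b\<^sup>2" using edge_ab abs_le_square_iff[of t ?b] by simp
  show ?thesis
  proof (cases "?a \<le> \<bar>t\<bar> \<and> \<bar>t\<bar> \<le> ?b")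
    case True
    then have "0 \<le> (t\<^sup>2 - ?a\<^sup>2) * (?b\<^sup>2 - t\<^sup>2)" using 1 2 by (intro mult_nonneg_nonneg) auto
    then show ?thesis using True by (simp add: eq_density_def Let_def)
  next
    case False
    then have "(t\<^sup>2 - ?a\<^sup>2) * (?b\<^sup>2 - t\<^sup>2) \<le> 0" using 1 2 ab by (auto simp: mult_le_0_iff)
    then show ?thesis using False by (auto simp: eq_density_def Let_def max_def)
  qed
qed

lemma eq_density_measurable [measurable]: "eq_density \<beta> c \<in> borel_measurable borel"
  unfolding eq_density_eq[abs_def] by measurable

lemma eq_density_nonneg: "0 \<le> eq_density \<beta> c t"
  unfolding eq_density_eq using \<beta> by simp

lemma eq_density_minus: "eq_density \<beta> c (- t) = eq_density \<beta> c t"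
  by (simp add: eq_density_def Let_def)

text \<open>The product under the root is at most t^2 b^2, so the root cancels the factor 1/|t| even
  when the support reaches 0. This one bound controls the truncation error of the potential, the
  modulus of continuity of the distribution function, and the comparison of product measures with
  Lebesgue measure.\<close>

lemma eq_density_le: "eq_density \<beta> c t \<le> 2 * edge_b \<beta> c / (pi * \<beta>)"
proof (cases "edge_a \<beta> c \<le> \<bar>t\<bar> \<and> \<bar>t\<bar> \<le> edge_b \<beta> c \<and> t \<noteq> 0")
  case True
  let ?a = "edge_a \<beta> c" and ?b = "edge_b \<beta> c"
  have 2: "t\<^sup>2 \<le> ?b\<^sup>2" using True edge_ab abs_le_square_iff[of t ?b] by simp
  have "(t\<^sup>2 - ?a\<^sup>2) * (?b\<^sup>2 - t\<^sup>2) \<le> t\<^sup>2 * ?b\<^sup>2"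
    by (rule mult_mono) (use 2 in simp_all)
  then have "sqrt ((t\<^sup>2 - ?a\<^sup>2) * (?b\<^sup>2 - t\<^sup>2)) \<le> sqrt (t\<^sup>2 * ?b\<^sup>2)" by simp
  also have "\<dots> = \<bar>t\<bar> * ?b" using edge_ab by (simp add: real_sqrt_mult)
  finally have "1 / \<bar>t\<bar> * sqrt ((t\<^sup>2 - ?a\<^sup>2) * (?b\<^sup>2 - t\<^sup>2)) \<le> ?b"
    using True by (simp add: field_simps)
  then have "2 / (pi * \<beta>) * (1 / \<bar>t\<bar> * sqrt ((t\<^sup>2 - ?a\<^sup>2) * (?b\<^sup>2 - t\<^sup>2))) \<le> 2 / (pi * \<beta>) * ?b"
    by (rule mult_left_mono) (use \<beta> in simp)
  then show ?thesis using True by (simp add: eq_density_def Let_def)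
next
  case False
  then have "eq_density \<beta> c t = 0" by (auto simp: eq_density_def Let_def)
  then show ?thesis using edge_ab \<beta> by simp
qed

lemma sets_nu_eq [simp, measurable_cong]: "sets (nu_eq \<beta> c) = sets borel"
  by (simp add: nu_eq_def)

lemma space_nu_eq [simp]: "space (nu_eq \<beta> c) = UNIV"
  by (simp add: nu_eq_def)

lemma nn_integral_nu_eq:
  assumes [measurable]: "F \<in> borel_measurable borel"
  shows "(\<integral>\<^sup>+t. F t \<partial>nu_eq \<beta> c) = (\<integral>\<^sup>+t. ennreal (eq_density \<beta> c t) * F t \<partial>lborel)"
  unfolding nu_eq_def by (rule nn_integral_density) auto

lemma nn_integral_nu_eq_le:
  assumes [measurable]: "F \<in> borel_measurable borel"
  shows "(\<integral>\<^sup>+t. F t \<partial>nu_eq \<beta> c) \<le> ennreal (2 * edge_b \<beta> c / (pi * \<beta>)) * (\<integral>\<^sup>+t. F t \<partial>lborel)"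
  unfolding nn_integral_nu_eq[OF assms]
  by (subst nn_integral_cmult[symmetric]) (auto intro!: nn_integral_mono mult_right_mono ennreal_leI eq_density_le)

lemma nn_integral_nu_eq_minus:
  assumes [measurable]: "F \<in> borel_measurable borel"
  shows "(\<integral>\<^sup>+t. F (- t) \<partial>nu_eq \<beta> c) = (\<integral>\<^sup>+t. F t \<partial>nu_eq \<beta> c)"
  using nn_integral_lborel_reflect[of "\<lambda>t. ennreal (eq_density \<beta> c t) * F t" 0]
  by (simp add: nn_integral_nu_eq eq_density_minus)

lemma YY_eq: "YY \<beta> c \<tau> = (pp \<beta> c)\<^sup>2 * (1 + (qq \<beta> c)\<^sup>2 + 2 * qq \<beta> c * cos (2 * pi * \<tau>))"
  unfolding YY_def qq(3) by (simp add: power_mult_distrib algebra_simps power2_eq_square)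

text \<open>Two monotone substitutions on half of the domain: s = t^2 on [a, b], then s =
  \<open>YY \<beta> c \<tau>\<close> on [1/2, 1], where it increases from a^2 to b^2. Evenness of
  the density and the symmetry \<tau> to 1 - \<tau> double the two sides.\<close>

lemma nn_integral_nu_eq_circle:
  assumes [measurable]: "H \<in> borel_measurable borel"
  shows "(\<integral>\<^sup>+t. H (t\<^sup>2) \<partial>nu_eq \<beta> c) = (\<integral>\<^sup>+\<tau>. H (YY \<beta> c \<tau>) \<partial>circle_measure (qq \<beta> c))"
proof -
  define a where "a = edge_a \<beta> c"
  define b where "b = edge_b \<beta> c"
  define p where "p = pp \<beta> c"
  define r where "r = rr \<beta>"
  define f where "f = eq_density \<beta> c"
  have [measurable]: "f \<in> borel_measurable borel" unfolding f_def by measurable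
  have ab: "0 \<le> a" "a < b" using edge_ab by (auto simp: a_def b_def)
  define h where "h s = sqrt (max 0 ((s - a\<^sup>2) * (b\<^sup>2 - s))) / (pi * \<beta> * s)" for s
  have [measurable]: "h \<in> borel_measurable borel" unfolding h_def[abs_def] by measurable
  define I where "I = (\<integral>\<^sup>+t. ennreal (f t) * H (t\<^sup>2) * indicator {a..b} t \<partial>lborel)"
  define F where "F s = ennreal (h s) * H s" for s
  have [measurable]: "F \<in> borel_measurable borel" unfolding F_def[abs_def] by measurable
  have supp: "f t = 0" if "t = 0 \<or> t \<notin> {a..b} \<and> - t \<notin> {a..b}" for t
    using that by (auto simp: f_def eq_density_def Let_def a_def b_def)
  have split: "ennreal (f t) * H (t\<^sup>2) = ennreal (f t) * H (t\<^sup>2) * indicator {a..b} t + ennreal (f t) * H (t\<^sup>2) * indicator {a..b} (- t)" for t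
    using supp[of t] ab by (cases "t = 0") (auto split: split_indicator)
  have "(\<integral>\<^sup>+t. H (t\<^sup>2) \<partial>nu_eq \<beta> c) = (\<integral>\<^sup>+t. ennreal (f t) * H (t\<^sup>2) \<partial>lborel)"
    by (simp add: nn_integral_nu_eq f_def)
  also have "\<dots> = I + (\<integral>\<^sup>+t. ennreal (f t) * H (t\<^sup>2) * indicator {a..b} (- t) \<partial>lborel)"
    unfolding I_def by (subst split, subst nn_integral_add) auto
  also have "(\<integral>\<^sup>+t. ennreal (f t) * H (t\<^sup>2) * indicator {a..b} (- t) \<partial>lborel) = I"
    unfolding I_def using nn_integral_lborel_reflect[of "\<lambda>t. ennreal (f t) * H (t\<^sup>2) * indicator {a..b} t" 0]
    by (simp add: f_def eq_density_minus del: indicator_simps)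
  finally have 1: "(\<integral>\<^sup>+t. H (t\<^sup>2) \<partial>nu_eq \<beta> c) = I + I" .
  have "I = (\<integral>\<^sup>+t. F (t\<^sup>2) * ennreal (2 * t) * indicator {a..b} t \<partial>lborel)"
    unfolding I_def
  proof (rule nn_integral_cong, cases)
    fix t assume t: "t \<in> {a..b}"
    have "f t = h (t\<^sup>2) * (2 * t)"
      using t ab by (simp add: f_def eq_density_eq h_def a_def b_def power2_eq_square[of t] mult_ac)
    moreover have "0 \<le> h (t\<^sup>2)" using \<beta> by (simp add: h_def)
    ultimately have "ennreal (f t) = ennreal (h (t\<^sup>2)) * ennreal (2 * t)" using t ab by (simp add: ennreal_mult)
    then show "ennreal (f t) * H (t\<^sup>2) * indicator {a..b} t = F (t\<^sup>2) * ennreal (2 * t) * indicator {a..b} t"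
      by (simp add: F_def mult_ac)
  qed simp
  also have "\<dots> = (\<integral>\<^sup>+s. F s * indicator {a\<^sup>2..b\<^sup>2} s \<partial>lborel)"
    by (rule nn_integral_substitution_aux[symmetric])
       (use ab in \<open>auto intro!: derivative_eq_intros continuous_intros\<close>)
  also have "\<dots> = (\<integral>\<^sup>+s. F s * indicator {YY \<beta> c (1 / 2)..YY \<beta> c 1} s \<partial>lborel)"
  proof -
    have "YY \<beta> c (1 / 2) = a\<^sup>2" "YY \<beta> c 1 = b\<^sup>2"
      by (simp_all add: YY_def a_def b_def edges power2_sum power2_diff)
    then show ?thesis by simp
  qed
  also have "\<dots> = (\<integral>\<^sup>+\<tau>. F (YY \<beta> c \<tau>) * ennreal (- 4 * pi * p * r * sin (2 * pi * \<tau>)) * indicator {1 / 2..1} \<tau> \<partial>lborel)"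
  proof (rule nn_integral_substitution_aux)
    show "(YY \<beta> c has_real_derivative - 4 * pi * p * r * sin (2 * pi * \<tau>)) (at \<tau>)" for \<tau>
      unfolding YY_def[abs_def] p_def r_def by (auto intro!: derivative_eq_intros)
    show "continuous_on {1 / 2..1} (\<lambda>\<tau>. - 4 * pi * p * r * sin (2 * pi * \<tau>))"
      by (intro continuous_intros)
    show "0 \<le> - 4 * pi * p * r * sin (2 * pi * \<tau>)" if "\<tau> \<in> {1 / 2..1}" for \<tau>
    proof -
      have "sin (2 * pi * \<tau>) \<le> 0"
        using that sin_ge_zero[of "2 * pi * \<tau> - pi"] by (simp add: sin_diff)
      then show ?thesis using pp_rr by (simp add: p_def r_def mult_nonneg_nonpos)
    qed
  qed auto
  also have "\<dots> = (\<integral>\<^sup>+\<tau>. ennreal (circle_weight (qq \<beta> c) \<tau>) * H (YY \<beta> c \<tau>) * indicator {1 / 2..1} \<tau> \<partial>lborel)"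
  proof (rule nn_integral_cong_AE)
    \<comment> \<open>At \<tau> = 1/2 the value is a^2, which is 0 for c = 0 and would be divided
      by; this null set is dropped.\<close>
    show "AE \<tau> in lborel. F (YY \<beta> c \<tau>) * ennreal (- 4 * pi * p * r * sin (2 * pi * \<tau>)) * indicator {1 / 2..1} \<tau>
       = ennreal (circle_weight (qq \<beta> c) \<tau>) * H (YY \<beta> c \<tau>) * indicator {1 / 2..1} \<tau>"
      using AE_lborel_neq[of "1 / 2"]
    proof eventually_elim
      case (elim \<tau>)
      show ?case
      proof (cases "\<tau> \<in> {1 / 2..1}")
        case True
        define S where "S = sin (2 * pi * \<tau>)"
        define C where "C = cos (2 * pi * \<tau>)"
        have SC: "S\<^sup>2 = 1 - C\<^sup>2" by (simp add: S_def C_def sin_squared_eq)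
        have S0: "S \<le> 0" using True sin_ge_zero[of "2 * pi * \<tau> - pi"] by (simp add: sin_diff S_def)
        have pr: "0 < p" "0 < r" "r \<le> p" "r\<^sup>2 = \<beta> / 4" using pp_rr by (auto simp: p_def r_def)
        have "cos (2 * pi * \<tau>) \<noteq> -1"
        proof
          assume "cos (2 * pi * \<tau>) = -1"
          then have "cos (2 * pi * \<tau> - pi) = 1" by (simp add: cos_diff)
          then obtain n :: int where "2 * pi * \<tau> - pi = of_int n * 2 * pi" using cos_one_2pi_int by blast
          then have "pi * (2 * \<tau>) = pi * (1 + 2 * of_int n)" by (simp add: algebra_simps)
          then have t: "\<tau> = 1 / 2 + of_int n" using pi_neq_zero by simp
          then have "n = 0" using True by auto
          then show False using t elim by simp
        qed
        then have C1: "-1 < C" using cos_ge_minus_one[of "2 * pi * \<tau>"] by (simp add: C_def less_le)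
        have Y: "YY \<beta> c \<tau> = p\<^sup>2 + r\<^sup>2 + 2 * p * r * C" by (simp add: YY_def p_def r_def C_def)
        have "2 * p * r * (-1) < 2 * p * r * C" by (rule mult_strict_left_mono) (use C1 pr in simp_all)
        then have Ypos: "0 < YY \<beta> c \<tau>" unfolding Y using sum_squares_bound[of p r] by linarith
        then have nz: "1 + (qq \<beta> c)\<^sup>2 + 2 * qq \<beta> c * cos (2 * pi * \<tau>) \<noteq> 0" unfolding YY_eq by auto
        have w: "circle_weight (qq \<beta> c) \<tau> = 2 * p\<^sup>2 * S\<^sup>2 / YY \<beta> c \<tau>"
          unfolding circle_weight_eq[OF qq(1,2) nz] YY_eq S_def p_def using pp_rr(1) by simp
        \<comment> \<open>With a = p - r and b = p + r the two factors are 2 p r (1 + C) and 2 p r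
          (1 - C), so the root in the density becomes a sine, like the derivative of the
          substitution.\<close>
        have prod: "(YY \<beta> c \<tau> - a\<^sup>2) * (b\<^sup>2 - YY \<beta> c \<tau>) = (2 * p * r * S)\<^sup>2"
          unfolding power_mult_distrib SC Y a_def b_def edges p_def[symmetric] r_def[symmetric]
          by (simp add: power2_eq_square algebra_simps)
        have "sqrt ((2 * p * r * S)\<^sup>2) = - (2 * p * r * S)"
          using S0 pr by (simp add: abs_mult)
        then have "h (YY \<beta> c \<tau>) = - (2 * p * r * S) / (pi * \<beta> * YY \<beta> c \<tau>)"
          unfolding h_def prod by (simp add: max_absorb2)
        then have "h (YY \<beta> c \<tau>) * (- 4 * pi * p * r * S) = 8 * p\<^sup>2 * r\<^sup>2 * S\<^sup>2 / (\<beta> * YY \<beta> c \<tau>)"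
          using \<beta> Ypos by (simp add: power2_eq_square)
        also have "\<dots> = circle_weight (qq \<beta> c) \<tau>" unfolding w pr(4) using \<beta> by simp
        finally have e: "circle_weight (qq \<beta> c) \<tau> = h (YY \<beta> c \<tau>) * (- 4 * pi * p * r * S)" ..
        have "0 \<le> h (YY \<beta> c \<tau>)" using \<beta> Ypos by (simp add: h_def)
        moreover have "0 \<le> - 4 * pi * p * r * S" using S0 pr by (simp add: mult_nonneg_nonpos)
        ultimately have "ennreal (circle_weight (qq \<beta> c) \<tau>) = ennreal (h (YY \<beta> c \<tau>)) * ennreal (- 4 * pi * p * r * S)"
          unfolding e by (rule ennreal_mult)
        then show ?thesis by (simp add: F_def S_def mult_ac)
      qed simp
    qed
  qed
  finally have 2: "I = (\<integral>\<^sup>+\<tau>. ennreal (circle_weight (qq \<beta> c) \<tau>) * H (YY \<beta> c \<tau>) * indicator {1 / 2..1} \<tau> \<partial>lborel)" .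
  let ?G = "\<lambda>\<tau>. ennreal (circle_weight (qq \<beta> c) \<tau>) * H (YY \<beta> c \<tau>)"
  have "?G (1 - \<tau>) = ?G \<tau>" for \<tau>
    by (simp add: circle_weight_def YY_def right_diff_distrib cos_diff)
  then have 3: "(\<integral>\<^sup>+\<tau>. ?G \<tau> * indicator {1 / 2..1} (1 - \<tau>) \<partial>lborel) = I"
    unfolding 2 using nn_integral_lborel_reflect[of "\<lambda>\<tau>. ?G \<tau> * indicator {1 / 2..1} \<tau>" 1]
    by (simp del: indicator_simps)
  have "(\<integral>\<^sup>+\<tau>. H (YY \<beta> c \<tau>) \<partial>circle_measure (qq \<beta> c)) = (\<integral>\<^sup>+\<tau>. ?G \<tau> * indicator {0..1} \<tau> \<partial>lborel)"
    unfolding circle_measure_def by (subst nn_integral_density) (auto simp: mult_ac)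
  also have "\<dots> = (\<integral>\<^sup>+\<tau>. ?G \<tau> * indicator {1 / 2..1} \<tau> + ?G \<tau> * indicator {1 / 2..1} (1 - \<tau>) \<partial>lborel)"
    by (rule nn_integral_cong_AE) (use AE_lborel_neq[of "1 / 2"] in \<open>eventually_elim, auto split: split_indicator\<close>)
  also have "\<dots> = I + I"
    by (subst nn_integral_add) (auto simp: 3 2[symmetric])
  finally show ?thesis using 1 by simp
qed

lemma prob_space_circle_measure: "prob_space (circle_measure (qq \<beta> c))"
proof (rule prob_spaceI)
  have "((\<lambda>\<tau>. 1 * circle_weight (qq \<beta> c) \<tau>) has_integral 1) {0..1}"
    using circle_weight_integral_1[OF qq(1,2)] by simp
  from circle_integral_continuous[OF qq(1,2) _ this]
  have "integrable (circle_measure (qq \<beta> c)) (\<lambda>\<tau>. 1::real)" "(\<integral>\<tau>. 1 \<partial>circle_measure (qq \<beta> c)) = (1::real)"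
    by auto
  then show "emeasure (circle_measure (qq \<beta> c)) (space (circle_measure (qq \<beta> c))) = 1"
    using nn_integral_eq_integral[of "circle_measure (qq \<beta> c)" "\<lambda>\<tau>. 1"] by simp
qed

lemma distr_nu_eq_square: "distr (nu_eq \<beta> c) borel (\<lambda>t. t\<^sup>2) = distr (circle_measure (qq \<beta> c)) borel (YY \<beta> c)"
proof (rule measure_eqI)
  fix A assume "A \<in> sets (distr (nu_eq \<beta> c) borel (\<lambda>t. t\<^sup>2))"
  then have [measurable]: "A \<in> sets borel" by simp
  have "emeasure (distr (nu_eq \<beta> c) borel (\<lambda>t. t\<^sup>2)) A = (\<integral>\<^sup>+x. indicator A x \<partial>distr (nu_eq \<beta> c) borel (\<lambda>t. t\<^sup>2))" by simp
  also have "\<dots> = (\<integral>\<^sup>+x. indicator A x \<partial>distr (circle_measure (qq \<beta> c)) borel (YY \<beta> c))"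
    using nn_integral_nu_eq_circle[of "indicator A"] by (subst (1 2) nn_integral_distr) auto
  finally show "emeasure (distr (nu_eq \<beta> c) borel (\<lambda>t. t\<^sup>2)) A = emeasure (distr (circle_measure (qq \<beta> c)) borel (YY \<beta> c)) A"
    by simp
qed simp

lemma integral_nu_eq_circle:
  fixes H :: "real \<Rightarrow> real"
  assumes [measurable]: "H \<in> borel_measurable borel"
  shows "(\<integral>t. H (t\<^sup>2) \<partial>nu_eq \<beta> c) = (\<integral>\<tau>. H (YY \<beta> c \<tau>) \<partial>circle_measure (qq \<beta> c))"
    and "integrable (nu_eq \<beta> c) (\<lambda>t. H (t\<^sup>2)) \<longleftrightarrow> integrable (circle_measure (qq \<beta> c)) (\<lambda>\<tau>. H (YY \<beta> c \<tau>))"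
  using integral_distr[of "\<lambda>t. t\<^sup>2" "nu_eq \<beta> c" borel H] integral_distr[of "YY \<beta> c" "circle_measure (qq \<beta> c)" borel H]
    integrable_distr_eq[of "\<lambda>t. t\<^sup>2" "nu_eq \<beta> c" borel H] integrable_distr_eq[of "YY \<beta> c" "circle_measure (qq \<beta> c)" borel H]
  by (auto simp: distr_nu_eq_square)

lemma prob_space_nu_eq: "prob_space (nu_eq \<beta> c)"
proof (rule prob_spaceI)
  interpret prob_space "circle_measure (qq \<beta> c)" by (rule prob_space_circle_measure)
  show "emeasure (nu_eq \<beta> c) (space (nu_eq \<beta> c)) = 1"
    using nn_integral_nu_eq_circle[of "\<lambda>_. 1"] emeasure_space_1 by simp
qed

lemma AE_nu_eq_support: "AE t in nu_eq \<beta> c. edge_a \<beta> c \<le> \<bar>t\<bar> \<and> \<bar>t\<bar> \<le> edge_b \<beta> c"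
  unfolding nu_eq_def by (subst AE_density) (auto simp: eq_density_def Let_def intro!: AE_I2)

lemma AE_nu_eq_neq: "AE t in nu_eq \<beta> c. t \<noteq> x"
  unfolding nu_eq_def by (subst AE_density) (use AE_lborel_neq[of x] in auto)

lemma integrable_nu_eq_id: "integrable (nu_eq \<beta> c) (\<lambda>t. t)"
proof -
  interpret prob_space "nu_eq \<beta> c" by (rule prob_space_nu_eq)
  show ?thesis
    by (rule integrable_const_bound[where B="edge_b \<beta> c"]) (use AE_nu_eq_support in auto)
qed

section \<open>The logarithmic potential and its truncation\<close>

definition nu_pot :: "real \<Rightarrow> real" where "nu_pot x = (\<integral>t. - ln \<bar>x - t\<bar> \<partial>nu_eq \<beta> c)"
definition nu_potL :: "real \<Rightarrow> real \<Rightarrow> real" where "nu_potL \<epsilon> x = (\<integral>t. Lk \<epsilon> (x - t) \<partial>nu_eq \<beta> c)"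

lemma integrable_Lk_nu_eq:
  assumes "0 < \<epsilon>"
  shows "integrable (nu_eq \<beta> c) (\<lambda>t. Lk \<epsilon> (x - t))"
proof -
  interpret prob_space "nu_eq \<beta> c" by (rule prob_space_nu_eq)
  have "integrable (nu_eq \<beta> c) (\<lambda>t. 1 + \<bar>ln \<epsilon>\<bar> + \<bar>x - t\<bar>)" using integrable_nu_eq_id by auto
  then show ?thesis by (rule Bochner_Integration.integrable_bound) (use abs_Lk_le[OF assms] in auto)
qed

text \<open>The truncation error is nonnegative and at most the bound 2 b/(\<pi> \<beta>) on the
  density times the Lebesgue integral 2 \<epsilon> of the gap. Uniformity in x allows one error term
  for all particles at once.\<close>

lemma nu_pot_approx:
  assumes "0 < \<epsilon>"
  shows "integrable (nu_eq \<beta> c) (\<lambda>t. - ln \<bar>x - t\<bar>)"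
    and "nu_potL \<epsilon> x \<le> nu_pot x" and "nu_pot x \<le> nu_potL \<epsilon> x + 4 * edge_b \<beta> c / (pi * \<beta>) * \<epsilon>"
proof -
  let ?g = "\<lambda>t. - ln \<bar>x - t\<bar> - Lk \<epsilon> (x - t)" and ?M = "2 * edge_b \<beta> c / (pi * \<beta>)"
  have M: "0 \<le> ?M" using edge_ab \<beta> by simp
  have nn: "AE t in nu_eq \<beta> c. 0 \<le> ?g t" using AE_nu_eq_neq[of x] Lk_le_log[OF assms] by auto
  have le: "(\<integral>\<^sup>+t. ennreal (?g t) \<partial>nu_eq \<beta> c) \<le> ennreal (?M * (2 * \<epsilon>))"
  proof -
    have "(\<integral>\<^sup>+t. ennreal (?g t) \<partial>nu_eq \<beta> c) \<le> ennreal ?M * (\<integral>\<^sup>+t. ennreal (?g t) \<partial>lborel)"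
      by (rule nn_integral_nu_eq_le) measurable
    also have "\<dots> \<le> ennreal ?M * ennreal (2 * \<epsilon>)"
      by (rule mult_left_mono[OF nn_integral_log_gap[OF assms]]) simp
    also have "\<dots> = ennreal (?M * (2 * \<epsilon>))" by (rule ennreal_mult[symmetric, OF M]) (use assms in simp)
    finally show ?thesis .
  qed
  have ig: "integrable (nu_eq \<beta> c) ?g"
    by (rule integrableI_nonneg) (use nn le_less_trans[OF le] in \<open>auto simp del: minus_diff_eq\<close>)
  have il: "integrable (nu_eq \<beta> c) (\<lambda>t. ?g t + Lk \<epsilon> (x - t))"
    using ig integrable_Lk_nu_eq[OF assms] by (rule Bochner_Integration.integrable_add)
  then show i: "integrable (nu_eq \<beta> c) (\<lambda>t. - ln \<bar>x - t\<bar>)" by simp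
  have e: "nu_pot x - nu_potL \<epsilon> x = (\<integral>t. ?g t \<partial>nu_eq \<beta> c)"
    unfolding nu_pot_def nu_potL_def using i integrable_Lk_nu_eq[OF assms]
    by (rule Bochner_Integration.integral_diff[symmetric])
  have 0: "0 \<le> (\<integral>t. ?g t \<partial>nu_eq \<beta> c)" using nn by (rule integral_nonneg_AE)
  have "ennreal (\<integral>t. ?g t \<partial>nu_eq \<beta> c) \<le> ennreal (?M * (2 * \<epsilon>))"
    using le nn_integral_eq_integral[OF ig nn] by simp
  moreover have "0 \<le> ?M * (2 * \<epsilon>)" by (rule mult_nonneg_nonneg[OF M]) (use assms in simp)
  ultimately have "(\<integral>t. ?g t \<partial>nu_eq \<beta> c) \<le> ?M * (2 * \<epsilon>)" by (simp only: ennreal_le_iff)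
  then show "nu_pot x \<le> nu_potL \<epsilon> x + 4 * edge_b \<beta> c / (pi * \<beta>) * \<epsilon>" using e by simp
  show "nu_potL \<epsilon> x \<le> nu_pot x" using 0 e by simp
qed

text \<open>The measure is even, so the potential may be averaged over t and -t; ln |x - t| + ln |x
  + t| = ln |x^2 - t^2| then depends on t only through t^2, which is what the circle coordinate
  describes.\<close>

lemma nu_pot_circle:
  "integrable (circle_measure (qq \<beta> c)) (\<lambda>\<tau>. ln \<bar>x\<^sup>2 - YY \<beta> c \<tau>\<bar>)"
  "2 * nu_pot x = - (\<integral>\<tau>. ln \<bar>x\<^sup>2 - YY \<beta> c \<tau>\<bar> \<partial>circle_measure (qq \<beta> c))"
proof -
  let ?l = "\<lambda>t. - ln \<bar>x - t\<bar>"
  have i: "integrable (nu_eq \<beta> c) ?l" by (rule nu_pot_approx(1)[of 1]) simp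
  have d: "distr (nu_eq \<beta> c) borel uminus = nu_eq \<beta> c"
  proof (rule measure_eqI)
    fix A assume "A \<in> sets (distr (nu_eq \<beta> c) borel uminus)"
    then have [measurable]: "A \<in> sets borel" by simp
    have "emeasure (distr (nu_eq \<beta> c) borel uminus) A = (\<integral>\<^sup>+x. indicator A x \<partial>distr (nu_eq \<beta> c) borel uminus)" by simp
    also have "\<dots> = (\<integral>\<^sup>+t. indicator A (- t) \<partial>nu_eq \<beta> c)" by (subst nn_integral_distr) auto
    also have "\<dots> = emeasure (nu_eq \<beta> c) A" by (subst nn_integral_nu_eq_minus) auto
    finally show "emeasure (distr (nu_eq \<beta> c) borel uminus) A = emeasure (nu_eq \<beta> c) A" .
  qed simp
  have i': "integrable (nu_eq \<beta> c) (\<lambda>t. ?l (- t))" and e': "(\<integral>t. ?l (- t) \<partial>nu_eq \<beta> c) = (\<integral>t. ?l t \<partial>nu_eq \<beta> c)"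
    using integrable_distr_eq[of uminus "nu_eq \<beta> c" borel ?l] integral_distr[of uminus "nu_eq \<beta> c" borel ?l] i
    unfolding d by auto
  have ae: "AE t in nu_eq \<beta> c. ?l t + ?l (- t) = - ln \<bar>x\<^sup>2 - t\<^sup>2\<bar>"
    using AE_nu_eq_neq[of x] AE_nu_eq_neq[of "-x"]
  proof eventually_elim
    case (elim t)
    then have "x - t \<noteq> 0" "x + t \<noteq> 0" by auto
    moreover have "x\<^sup>2 - t\<^sup>2 = (x - t) * (x + t)" by (simp add: power2_eq_square algebra_simps)
    ultimately show ?case by (simp add: abs_mult ln_mult)
  qed
  have i2: "integrable (nu_eq \<beta> c) (\<lambda>t. - ln \<bar>x\<^sup>2 - t\<^sup>2\<bar>)"
    by (subst integrable_cong_AE[OF _ _ ae, symmetric]) (use i i' in auto)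
  then show "integrable (circle_measure (qq \<beta> c)) (\<lambda>\<tau>. ln \<bar>x\<^sup>2 - YY \<beta> c \<tau>\<bar>)"
    using integral_nu_eq_circle(2)[of "\<lambda>s. - ln \<bar>x\<^sup>2 - s\<bar>"] by simp
  have "2 * nu_pot x = (\<integral>t. ?l t + ?l (- t) \<partial>nu_eq \<beta> c)"
    using i i' e' by (simp add: nu_pot_def)
  also have "\<dots> = (\<integral>t. - ln \<bar>x\<^sup>2 - t\<^sup>2\<bar> \<partial>nu_eq \<beta> c)"
    by (rule integral_cong_AE[OF _ _ ae]) auto
  also have "\<dots> = - (\<integral>\<tau>. ln \<bar>x\<^sup>2 - YY \<beta> c \<tau>\<bar> \<partial>circle_measure (qq \<beta> c))"
    using integral_nu_eq_circle(1)[of "\<lambda>s. - ln \<bar>x\<^sup>2 - s\<bar>"] by simp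
  finally show "2 * nu_pot x = - (\<integral>\<tau>. ln \<bar>x\<^sup>2 - YY \<beta> c \<tau>\<bar> \<partial>circle_measure (qq \<beta> c))" .
qed

lemma AE_circle_YY_neq: "AE \<tau> in circle_measure (qq \<beta> c). YY \<beta> c \<tau> \<noteq> x"
proof -
  have "AE t in nu_eq \<beta> c. t\<^sup>2 \<noteq> x"
    using AE_nu_eq_neq[of "sqrt x"] AE_nu_eq_neq[of "- sqrt x"]
  proof eventually_elim
    case (elim t)
    show ?case
    proof
      assume "t\<^sup>2 = x"
      then have "\<bar>t\<bar> = sqrt x" by (metis real_sqrt_abs)
      then show False using elim by linarith
    qed
  qed
  then have "AE s in distr (nu_eq \<beta> c) borel (\<lambda>t. t\<^sup>2). s \<noteq> x"
    by (subst AE_distr_iff) auto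
  then show ?thesis unfolding distr_nu_eq_square by (subst (asm) AE_distr_iff) auto
qed

end

section \<open>Its logarithmic potential\<close>

lemma circle_norm_pos: 
  assumes "norm \<zeta> < 1"
  shows "0 < norm (1 - \<zeta> * e2 \<tau>)"
proof -
  have "norm (\<zeta> * e2 \<tau>) < 1" using assms by (simp add: norm_mult)
  then have "\<zeta> * e2 \<tau> \<noteq> 1" by auto
  then show ?thesis by auto
qed

lemma circle_log_integral:
  assumes q: "0 < q" "q \<le> 1" and \<zeta>: "norm \<zeta> < 1"
  shows "integrable (circle_measure q) (\<lambda>\<tau>. ln (norm (1 - \<zeta> * e2 \<tau>)))"
    and "(\<integral>\<tau>. ln (norm (1 - \<zeta> * e2 \<tau>)) \<partial>circle_measure q)
      = Re \<zeta> / (2 * q) - (1 - q\<^sup>2) / (2 * q\<^sup>2) * ln (norm (1 + of_real q * \<zeta>))"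
proof -
  have "continuous_on UNIV e2" unfolding cis_conv_exp by (intro continuous_intros)
  then have c: "continuous_on UNIV (\<lambda>\<tau>. ln (norm (1 - \<zeta> * e2 \<tau>)))"
    using circle_norm_pos[OF \<zeta>] by (intro continuous_intros) auto
  have m: "(\<lambda>\<tau>. ln (norm (1 - \<zeta> * e2 \<tau>))) \<in> borel_measurable borel"
    by (rule borel_measurable_continuous_onI[OF c])
  have c': "continuous_on {0..1} (\<lambda>\<tau>. ln (norm (1 - \<zeta> * e2 \<tau>)))" by (rule continuous_on_subset[OF c]) simp
  note r = circle_integral_continuous[OF q c' circle_weight_integral_ln[OF q \<zeta>] m]
  show "integrable (circle_measure q) (\<lambda>\<tau>. ln (norm (1 - \<zeta> * e2 \<tau>)))" by (rule r(1))
  show "(\<integral>\<tau>. ln (norm (1 - \<zeta> * e2 \<tau>)) \<partial>circle_measure q)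
      = Re \<zeta> / (2 * q) - (1 - q\<^sup>2) / (2 * q\<^sup>2) * ln (norm (1 + of_real q * \<zeta>))" by (rule r(2))
qed

text \<open>The two roots of z + 1/z = w have product 1; the rationalised form 2/(|w| + s) is the
  root of smaller modulus, up to sign. That z and w have the same sign later tells the outer region
  from the inner gap.\<close>

lemma joukowski_surj:
  fixes w :: real
  assumes "2 < \<bar>w\<bar>"
  obtains z where "z \<noteq> 0" "\<bar>z\<bar> < 1" "z + 1 / z = w" "0 < z * w"
proof -
  have "2 * 2 < \<bar>w\<bar> * \<bar>w\<bar>" by (rule mult_strict_mono) (use assms in auto)
  then have D: "0 < w\<^sup>2 - 4" by (simp add: power2_eq_square abs_mult_self_eq)
  define s where "s = sqrt (w\<^sup>2 - 4)"
  have s: "s\<^sup>2 = w\<^sup>2 - 4" "0 < s" using D by (auto simp: s_def)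
  have "s\<^sup>2 < \<bar>w\<bar>\<^sup>2" using s by simp
  then have sw: "s < \<bar>w\<bar>" by (rule power2_less_imp_less) simp
  define y where "y = 2 / (\<bar>w\<bar> + s)"
  have y: "0 < y" "y < 1" using s assms by (auto simp: y_def)
  have "y * v = 2" if "v = \<bar>w\<bar> + s" for v
  proof -
    have "v \<noteq> 0" unfolding that using s(2) by linarith
    then show ?thesis by (simp add: y_def flip: that)
  qed
  then have "y * (\<bar>w\<bar> + s) = 2" by simp
  moreover have "(\<bar>w\<bar> + s) * (\<bar>w\<bar> - s) = 4" using s(1) by (simp add: algebra_simps power2_eq_square abs_mult_self_eq)
  ultimately have "2 * (\<bar>w\<bar> - s) = y * 4" by (metis mult.assoc)
  then have y2: "y = (\<bar>w\<bar> - s) / 2" by simp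
  have "1 / y = (\<bar>w\<bar> + s) / 2" by (simp add: y_def)
  then have yw: "y + 1 / y = \<bar>w\<bar>" unfolding y2 by argo
  show ?thesis
  proof (cases "0 < w")
    case True
    then show ?thesis using y yw by (intro that[of y]) auto
  next
    case False
    then have "w < 0" using assms by auto
    then show ?thesis using y yw by (intro that[of "- y"]) (auto simp: mult_pos_neg)
  qed
qed

context log_gas
begin

text \<open>The constant value of the effective potential on the support, read off from the closed
  form of the potential at a parameter on the unit circle.\<close>

definition "ell = (pp \<beta> c)\<^sup>2 + (rr \<beta>)\<^sup>2 - 2 * (rr \<beta>)\<^sup>2 * ln (pp \<beta> c * rr \<beta>) - 2 * c * ln (pp \<beta> c)"

lemma rr_consts:
  "2 * (rr \<beta>)\<^sup>2 * (1 / qq \<beta> c) = 2 * pp \<beta> c * rr \<beta>"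
  "2 * (rr \<beta>)\<^sup>2 * ((1 - (qq \<beta> c)\<^sup>2) / (qq \<beta> c)\<^sup>2) = 2 * c"
  "\<beta> = 4 * (rr \<beta>)\<^sup>2" "pp \<beta> c * qq \<beta> c = rr \<beta>" "(pp \<beta> c)\<^sup>2 * (1 - (qq \<beta> c)\<^sup>2) = c"
proof -
  show "2 * (rr \<beta>)\<^sup>2 * (1 / qq \<beta> c) = 2 * pp \<beta> c * rr \<beta>"
    using pp_rr(1,2) by (simp add: qq_def power2_eq_square)
  have "(1 - (qq \<beta> c)\<^sup>2) / (qq \<beta> c)\<^sup>2 = ((pp \<beta> c)\<^sup>2 - (rr \<beta>)\<^sup>2) / (rr \<beta>)\<^sup>2"
    using pp_rr(1,2) by (simp add: qq_def power_divide field_simps)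
  then show "2 * (rr \<beta>)\<^sup>2 * ((1 - (qq \<beta> c)\<^sup>2) / (qq \<beta> c)\<^sup>2) = 2 * c"
    using pp_rr(1,2) qq(4) by simp
  show "\<beta> = 4 * (rr \<beta>)\<^sup>2" using pp_rr by simp
  show pq: "pp \<beta> c * qq \<beta> c = rr \<beta>" using qq(3) by simp
  have "(pp \<beta> c)\<^sup>2 * (1 - (qq \<beta> c)\<^sup>2) = (pp \<beta> c)\<^sup>2 - (pp \<beta> c * qq \<beta> c)\<^sup>2" by (simp add: algebra_simps)
  then show "(pp \<beta> c)\<^sup>2 * (1 - (qq \<beta> c)\<^sup>2) = c" unfolding pq using qq(4) by simp
qed

text \<open>Multiplication by 2 r^2 = \<beta>/2 clears the denominators in q: the coefficients of x
  and L become 2 p r and 2 c.\<close>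

lemma potential_scaling:
  assumes "2 * U = - k + z - 1 / qq \<beta> c * x + (1 - (qq \<beta> c)\<^sup>2) / (qq \<beta> c)\<^sup>2 * L"
  shows "\<beta> * U = - 2 * (rr \<beta>)\<^sup>2 * k + 2 * (rr \<beta>)\<^sup>2 * z - 2 * pp \<beta> c * rr \<beta> * x + 2 * c * L"
proof -
  have gen: "2 * s * (- k + z - I * x + J * L) = - 2 * s * k + 2 * s * z - 2 * s * I * x + 2 * s * J * L" for s I J
    by (simp add: algebra_simps)
  have "\<beta> * U = 2 * (rr \<beta>)\<^sup>2 * (2 * U)" by (simp add: pp_rr(4))
  then show ?thesis unfolding assms gen rr_consts(1,2) .
qed

text \<open>The factorisation
  \<open>x^2 - YY \<beta> c \<tau> = p r / \<zeta> |1 - \<zeta> e|^2\<close> reduces the potential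
  to a circle integral of a logarithm without singularity. A real parameter inside the unit disc
  corresponds to x^2 outside [a^2, b^2].\<close>

lemma potential_real_parameter:
  fixes \<zeta> :: real
  assumes \<zeta>: "\<zeta> \<noteq> 0" "\<bar>\<zeta>\<bar> < 1" and x: "x\<^sup>2 = (pp \<beta> c)\<^sup>2 + (rr \<beta>)\<^sup>2 + pp \<beta> c * rr \<beta> * (\<zeta> + 1 / \<zeta>)"
  shows "\<beta> * nu_pot x = - 2 * (rr \<beta>)\<^sup>2 * ln (pp \<beta> c * rr \<beta>) + 2 * (rr \<beta>)\<^sup>2 * ln \<bar>\<zeta>\<bar>
     - 2 * pp \<beta> c * rr \<beta> * \<zeta> + 2 * c * ln (1 + qq \<beta> c * \<zeta>)"
proof -
  interpret K: prob_space "circle_measure (qq \<beta> c)" by (rule prob_space_circle_measure)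
  let ?f = "\<lambda>\<tau>. ln (norm (1 - complex_of_real \<zeta> * e2 \<tau>))"
  define m where "m = pp \<beta> c * rr \<beta>"
  have m: "0 < m" using pp_rr by (simp add: m_def)
  have pw: "ln \<bar>x\<^sup>2 - YY \<beta> c \<tau>\<bar> = ln (m / \<bar>\<zeta>\<bar>) + 2 * ?f \<tau>" for \<tau>
  proof -
    define C where "C = cos (2 * pi * \<tau>)"
    define S where "S = sin (2 * pi * \<tau>)"
    define N where "N = norm (1 - complex_of_real \<zeta> * e2 \<tau>)"
    have N: "0 < N" unfolding N_def by (rule circle_norm_pos) (use \<zeta> in simp)
    have "N\<^sup>2 = (1 - \<zeta> * C)\<^sup>2 + (\<zeta> * S)\<^sup>2"
      unfolding N_def cmod_power2 by (simp add: C_def S_def)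
    also have "\<dots> = 1 - 2 * \<zeta> * C + \<zeta>\<^sup>2 * (C\<^sup>2 + S\<^sup>2)" by (simp add: power2_eq_square algebra_simps)
    finally have N2: "N\<^sup>2 = 1 + \<zeta>\<^sup>2 - 2 * \<zeta> * C" by (simp add: C_def S_def)
    have "x\<^sup>2 - YY \<beta> c \<tau> = m * (\<zeta> + 1 / \<zeta> - 2 * C)"
      unfolding x YY_def m_def C_def by (simp add: algebra_simps)
    also have "\<dots> = m / \<zeta> * N\<^sup>2" unfolding N2 using \<zeta> by (simp add: field_simps power2_eq_square)
    finally have "\<bar>x\<^sup>2 - YY \<beta> c \<tau>\<bar> = m / \<bar>\<zeta>\<bar> * N\<^sup>2" using m by (simp add: abs_mult)
    moreover have "0 < m / \<bar>\<zeta>\<bar>" using m \<zeta>(1) by simp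
    ultimately have "ln \<bar>x\<^sup>2 - YY \<beta> c \<tau>\<bar> = ln (m / \<bar>\<zeta>\<bar>) + ln (N\<^sup>2)" using N by (simp only: ln_mult_pos zero_less_power)
    then show ?thesis using N by (simp add: ln_realpow N_def)
  qed
  have n1: "norm (complex_of_real \<zeta>) < 1" using \<zeta> by simp
  note f = circle_log_integral[OF qq(1,2) n1]
  have qz: "\<bar>qq \<beta> c * \<zeta>\<bar> < 1" using qq(1,2) \<zeta>(2) mult_le_one[of "qq \<beta> c" "\<bar>\<zeta>\<bar>"] mult_left_le_one_le[of "\<bar>\<zeta>\<bar>" "qq \<beta> c"]
    by (simp add: abs_mult)
  have nrm: "norm (1 + complex_of_real (qq \<beta> c) * complex_of_real \<zeta>) = 1 + qq \<beta> c * \<zeta>"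
  proof -
    have "1 + complex_of_real (qq \<beta> c) * complex_of_real \<zeta> = of_real (1 + qq \<beta> c * \<zeta>)" by simp
    then show ?thesis using qz by (simp only: norm_of_real)
  qed
  have "2 * nu_pot x = - (\<integral>\<tau>. ln (m / \<bar>\<zeta>\<bar>) + 2 * ?f \<tau> \<partial>circle_measure (qq \<beta> c))"
    unfolding nu_pot_circle(2) pw ..
  also have "\<dots> = - (ln (m / \<bar>\<zeta>\<bar>) + 2 * (\<zeta> / (2 * qq \<beta> c) - (1 - (qq \<beta> c)\<^sup>2) / (2 * (qq \<beta> c)\<^sup>2) * ln (1 + qq \<beta> c * \<zeta>)))"
    using f K.prob_space by (simp add: nrm)
  also have "ln (m / \<bar>\<zeta>\<bar>) = ln m - ln \<bar>\<zeta>\<bar>" using m \<zeta> by (simp add: ln_div)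
  finally have "2 * nu_pot x = - ln m + ln \<bar>\<zeta>\<bar> - 1 / qq \<beta> c * \<zeta> + (1 - (qq \<beta> c)\<^sup>2) / (qq \<beta> c)\<^sup>2 * ln (1 + qq \<beta> c * \<zeta>)"
    by simp
  then show ?thesis unfolding m_def by (rule potential_scaling)
qed

text \<open>From |1 - u| \<le> |1 - s u| + (1 - s) and 1 - s \<le> |1 - s u|. It bounds ln |1 - s u|
  uniformly in s by ln |1 - u| up to a constant, as domination along a radius requires.\<close>

lemma norm_one_minus_scaled:
  fixes u :: complex
  assumes "norm u = 1" "0 \<le> s" "s \<le> 1"
  shows "norm (1 - u) / 2 \<le> norm (1 - of_real s * u)" "norm (1 - of_real s * u) \<le> 2"
proof -
  have su: "norm (of_real s * u) = s" using assms by (simp add: norm_mult)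
  have "norm (1::complex) - norm (of_real s * u) \<le> norm (1 - of_real s * u)" by (rule norm_triangle_ineq2)
  then have 1: "1 - s \<le> norm (1 - of_real s * u)" using su by simp
  have "1 - u = (1 - of_real s * u) - of_real (1 - s) * u" by (simp add: algebra_simps)
  then have "norm (1 - u) \<le> norm (1 - of_real s * u) + norm (of_real (1 - s) * u)" by (metis norm_triangle_ineq4)
  also have "norm (of_real (1 - s) * u) = 1 - s" using assms by (simp only: norm_mult norm_of_real) simp
  finally show "norm (1 - u) / 2 \<le> norm (1 - of_real s * u)" using 1 by simp
  show "norm (1 - of_real s * u) \<le> 2" using norm_triangle_ineq4[of 1 "of_real s * u"] su assms by simp
qed

text \<open>For x in the support the parameter has modulus 1 and the logarithm is singular, so the
  value is reached as a radial limit. The parameters at \<phi> and -\<phi> are treated together: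
  their logarithms add up to ln |x^2 - YY| minus a constant, whose integrability is known from the
  real line, and this sum is the dominating function.\<close>

lemma potential_circle_parameter:
  assumes x: "x\<^sup>2 = (pp \<beta> c)\<^sup>2 + (rr \<beta>)\<^sup>2 + 2 * pp \<beta> c * rr \<beta> * cos \<phi>"
  shows "\<beta> * nu_pot x = - 2 * (rr \<beta>)\<^sup>2 * ln (pp \<beta> c * rr \<beta>) - 2 * pp \<beta> c * rr \<beta> * cos \<phi>
     + 2 * c * ln (norm (1 + of_real (qq \<beta> c) * cis \<phi>))"
proof -
  let ?K = "circle_measure (qq \<beta> c)"
  interpret K: prob_space ?K by (rule prob_space_circle_measure)
  define m where "m = pp \<beta> c * rr \<beta>"
  have m: "0 < m" using pp_rr by (simp add: m_def)
  define q where "q = qq \<beta> c"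
  note q = qq(1,2)[folded q_def]
  define s where "s n = real n / (real n + 1)" for n
  have s: "0 \<le> s n" "s n < 1" for n by (auto simp: s_def)
  have slim: "s \<longlonglongrightarrow> 1" unfolding s_def by real_asymp
  define g where "g v w \<tau> = ln (norm (1 - of_real v * (cis w * e2 \<tau>)))" for v w \<tau>
  let ?L = "\<lambda>\<tau>. ln \<bar>x\<^sup>2 - YY \<beta> c \<tau>\<bar> - ln m"
  have geq: "g v w = (\<lambda>\<tau>. ln (norm (1 - (of_real v * cis w) * e2 \<tau>)))" for v w
    by (simp add: g_def[abs_def] mult.assoc)
  have ig: "integrable ?K (g (s n) w)" 
    and eg: "(\<integral>\<tau>. g (s n) w \<tau> \<partial>?K) = s n * cos w / (2 * q) - (1 - q\<^sup>2) / (2 * q\<^sup>2) * ln (norm (1 + of_real q * (of_real (s n) * cis w)))" for n w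
  proof -
    have "norm (of_real (s n) * cis w) < 1" using s by (simp add: norm_mult)
    from circle_log_integral[OF q this]
    show "integrable ?K (g (s n) w)"
      "(\<integral>\<tau>. g (s n) w \<tau> \<partial>?K) = s n * cos w / (2 * q) - (1 - q\<^sup>2) / (2 * q\<^sup>2) * ln (norm (1 + of_real q * (of_real (s n) * cis w)))"
      unfolding geq by (simp_all add: q_def)
  qed
  have key: "norm (1 - cis \<phi> * e2 \<tau>) * norm (1 - cis (- \<phi>) * e2 \<tau>) = \<bar>x\<^sup>2 - YY \<beta> c \<tau>\<bar> / m" for \<tau>
  proof -
    have a: "(1 - cis \<phi> * z) * (1 - cis (- \<phi>) * z) = z * (z + 1 / z - 2 * of_real (cos \<phi>))" if "z \<noteq> 0" for z
    proof -
      have "cis \<phi> + cis (- \<phi>) = 2 * of_real (cos \<phi>)" "cis \<phi> * cis (- \<phi>) = 1" by (auto simp: complex_eq_iff cis_mult)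
      moreover have "(1 - u * z) * (1 - v * z) = 1 - (u + v) * z + u * v * (z * z)" for u v by (simp add: algebra_simps)
      ultimately have "(1 - cis \<phi> * z) * (1 - cis (- \<phi>) * z) = 1 - 2 * of_real (cos \<phi>) * z + z * z" by (simp only: mult_1)
      then show ?thesis using that by (simp only:) (simp add: algebra_simps)
    qed
    have b: "e2 \<tau> + 1 / e2 \<tau> = 2 * of_real (cos (2 * pi * \<tau>))"
    proof -
      have "1 / e2 \<tau> = cis (- (2 * pi * \<tau>))" by (simp add: divide_inverse)
      then show ?thesis by (simp only:) (simp add: complex_eq_iff)
    qed
    have "norm (1 - cis \<phi> * e2 \<tau>) * norm (1 - cis (- \<phi>) * e2 \<tau>) = norm (of_real (2 * (cos (2 * pi * \<tau>) - cos \<phi>)) :: complex)"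
    proof -
      have eq: "2 * of_real (cos (2 * pi * \<tau>)) - 2 * of_real (cos \<phi>) = (of_real (2 * (cos (2 * pi * \<tau>) - cos \<phi>)) :: complex)"
        by (simp add: right_diff_distrib)
      show ?thesis unfolding norm_mult[symmetric] a[OF cis_neq_zero] b eq by (simp only: norm_mult norm_cis mult_1)
    qed
    also have "\<dots> = \<bar>2 * (cos (2 * pi * \<tau>) - cos \<phi>)\<bar>" by (simp only: norm_of_real)
    also have "x\<^sup>2 - YY \<beta> c \<tau> = - m * (2 * (cos (2 * pi * \<tau>) - cos \<phi>))"
      unfolding x YY_def m_def by (simp add: algebra_simps)
    then have "\<bar>2 * (cos (2 * pi * \<tau>) - cos \<phi>)\<bar> = \<bar>x\<^sup>2 - YY \<beta> c \<tau>\<bar> / m"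
      using m by (simp add: abs_mult)
    finally show ?thesis .
  qed
  have mg: "g (s n) w \<in> borel_measurable borel" for n w
    using borel_measurable_integrable[OF ig[of n w]] by simp
  have pair: "g 1 \<phi> \<tau> + g 1 (- \<phi>) \<tau> = ?L \<tau>" and nz: "1 - cis \<phi> * e2 \<tau> \<noteq> 0" "1 - cis (- \<phi>) * e2 \<tau> \<noteq> 0"
    if "YY \<beta> c \<tau> \<noteq> x\<^sup>2" for \<tau>
  proof -
    have "0 < norm (1 - cis \<phi> * e2 \<tau>) * norm (1 - cis (- \<phi>) * e2 \<tau>)" unfolding key using that m by simp
    then show nz: "1 - cis \<phi> * e2 \<tau> \<noteq> 0" "1 - cis (- \<phi>) * e2 \<tau> \<noteq> 0" by auto
    then have "g 1 \<phi> \<tau> + g 1 (- \<phi>) \<tau> = ln (norm (1 - cis \<phi> * e2 \<tau>) * norm (1 - cis (- \<phi>) * e2 \<tau>))"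
      by (simp add: g_def ln_mult)
    then show "g 1 \<phi> \<tau> + g 1 (- \<phi>) \<tau> = ?L \<tau>" unfolding key using that m by (simp add: ln_div)
  qed
  have bnd: "\<bar>g (s n) w \<tau> + g (s n) w' \<tau>\<bar> \<le> 2 * ln 2 + \<bar>g 1 w \<tau> + g 1 w' \<tau>\<bar>"
    if "1 - cis w * e2 \<tau> \<noteq> 0" "1 - cis w' * e2 \<tau> \<noteq> 0" for n w w' \<tau>
  proof -
    have 1: "g 1 w \<tau> - ln 2 \<le> g (s n) w \<tau> \<and> g (s n) w \<tau> \<le> ln 2" if nz: "1 - cis w * e2 \<tau> \<noteq> 0" for w
    proof -
      have u: "norm (cis w * e2 \<tau>) = 1" by (simp add: norm_mult)
      note b = norm_one_minus_scaled[OF u s(1)[of n] less_imp_le[OF s(2)[of n]]]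
      have p: "0 < norm (1 - cis w * e2 \<tau>)" using nz by simp
      then have "ln (norm (1 - cis w * e2 \<tau>) / 2) \<le> g (s n) w \<tau>" unfolding g_def using b(1) by (intro ln_mono) auto
      moreover have "g (s n) w \<tau> \<le> ln 2" unfolding g_def using b p by (intro ln_mono) auto
      ultimately show ?thesis using p by (simp add: ln_div g_def)
    qed
    have "0 \<le> ln (2::real)" by simp
    then show ?thesis using 1[OF that(1)] 1[OF that(2)] by linarith
  qed
  have "(\<lambda>n. \<integral>\<tau>. g (s n) \<phi> \<tau> + g (s n) (- \<phi>) \<tau> \<partial>?K) \<longlonglongrightarrow> (\<integral>\<tau>. ?L \<tau> \<partial>?K)"
  proof (rule integral_dominated_convergence[where w = "\<lambda>\<tau>. 2 * ln 2 + \<bar>?L \<tau>\<bar>"])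
    show "integrable ?K (\<lambda>\<tau>. 2 * ln 2 + \<bar>?L \<tau>\<bar>)" using nu_pot_circle(1)[of x] by auto
    show "AE \<tau> in ?K. (\<lambda>n. g (s n) \<phi> \<tau> + g (s n) (- \<phi>) \<tau>) \<longlonglongrightarrow> ?L \<tau>"
      using AE_circle_YY_neq[of "x\<^sup>2"]
    proof eventually_elim
      case (elim \<tau>)
      have "(\<lambda>n. g (s n) w \<tau>) \<longlonglongrightarrow> g 1 w \<tau>" if "1 - cis w * e2 \<tau> \<noteq> 0" for w
        unfolding g_def
        by (intro tendsto_ln tendsto_norm tendsto_diff tendsto_mult tendsto_of_real tendsto_const slim) (use that in simp)
      from tendsto_add[OF this[OF nz(1)[OF elim]] this[OF nz(2)[OF elim]]]
      show ?case unfolding pair[OF elim] .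
    qed
    show "AE \<tau> in ?K. norm (g (s n) \<phi> \<tau> + g (s n) (- \<phi>) \<tau>) \<le> 2 * ln 2 + \<bar>?L \<tau>\<bar>" for n
      using AE_circle_YY_neq[of "x\<^sup>2"]
    proof eventually_elim
      case (elim \<tau>)
      show ?case using bnd[OF nz[OF elim], of n] unfolding pair[OF elim] by simp
    qed
  qed (use mg in \<open>auto intro!: borel_measurable_add\<close>)
  moreover have "(\<integral>\<tau>. ?L \<tau> \<partial>?K) = - 2 * nu_pot x - ln m"
    using nu_pot_circle[of x] K.prob_space by simp
  moreover have "(\<integral>\<tau>. g (s n) \<phi> \<tau> + g (s n) (- \<phi>) \<tau> \<partial>?K)
      = s n * cos \<phi> / q - (1 - q\<^sup>2) / q\<^sup>2 * ln (norm (1 + of_real q * (of_real (s n) * cis \<phi>)))" for n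
  proof -
    have "1 + of_real q * (of_real (s n) * cis (- \<phi>)) = cnj (1 + of_real q * (of_real (s n) * cis \<phi>))"
      by (simp add: cis_cnj)
    then have "norm (1 + of_real q * (of_real (s n) * cis (- \<phi>))) = norm (1 + of_real q * (of_real (s n) * cis \<phi>))"
      by (simp only: complex_mod_cnj)
    then show ?thesis using ig[of n] eg[of n] by simp
  qed
  ultimately have l1: "(\<lambda>n. s n * cos \<phi> / q - (1 - q\<^sup>2) / q\<^sup>2 * ln (norm (1 + of_real q * (of_real (s n) * cis \<phi>)))) \<longlonglongrightarrow> - 2 * nu_pot x - ln m"
    by simp
  have l2: "(\<lambda>n. s n * cos \<phi> / q - (1 - q\<^sup>2) / q\<^sup>2 * ln (norm (1 + of_real q * (of_real (s n) * cis \<phi>))))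
     \<longlonglongrightarrow> 1 * cos \<phi> / q - (1 - q\<^sup>2) / q\<^sup>2 * ln (norm (1 + of_real q * (of_real 1 * cis \<phi>)))"
  \<comment> \<open>For q = 1 the argument of the last logarithm may tend to 0, but its coefficient
    1 - q^2 is 0. For q < 1 it stays away from 0.\<close>
  proof (cases "q = 1")
    case True
    then show ?thesis using tendsto_mult[OF slim tendsto_const[of "cos \<phi>"]] by simp
  next
    case False
    have "norm (of_real q * cis \<phi>) < 1" using q False by (simp add: norm_mult)
    then have "of_real q * cis \<phi> \<noteq> - 1" by (metis less_irrefl norm_minus_cancel norm_one)
    then have "1 + of_real q * cis \<phi> \<noteq> 0" by (simp add: eq_neg_iff_add_eq_0 add.commute)
    then show ?thesis using slim q by (intro tendsto_intros) auto
  qed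
  have "2 * nu_pot x = - ln m + 0 - 1 / qq \<beta> c * cos \<phi> + (1 - (qq \<beta> c)\<^sup>2) / (qq \<beta> c)\<^sup>2 * ln (norm (1 + of_real (qq \<beta> c) * cis \<phi>))"
    using LIMSEQ_unique[OF l1 l2] by (simp add: q_def)
  from potential_scaling[OF this] show ?thesis unfolding m_def by simp
qed

section \<open>Equality on the support and inequality off it\<close>

lemma effective_potential_eq:
  assumes "edge_a \<beta> c \<le> \<bar>x\<bar>" "\<bar>x\<bar> \<le> edge_b \<beta> c"
  shows "\<beta> * nu_pot x + x\<^sup>2 - 2 * c * ln \<bar>x\<bar> = ell"
proof -
  let ?p = "pp \<beta> c" and ?r = "rr \<beta>" and ?q = "qq \<beta> c"
  have pr: "0 < 2 * ?p * ?r" using pp_rr by simp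
  have 1: "(?p - ?r)\<^sup>2 \<le> x\<^sup>2" using assms edge_ab abs_le_square_iff[of "edge_a \<beta> c" x] by (simp add: edges)
  have 2: "x\<^sup>2 \<le> (?p + ?r)\<^sup>2" using assms edge_ab abs_le_square_iff[of x "edge_b \<beta> c"] by (simp add: edges)
  define D where "D = 2 * ?p * ?r"
  define \<phi> where "\<phi> = arccos ((x\<^sup>2 - ?p\<^sup>2 - ?r\<^sup>2) / D)"
  have "cos \<phi> = (x\<^sup>2 - ?p\<^sup>2 - ?r\<^sup>2) / D"
    unfolding \<phi>_def D_def using 1 2 pr
    by (intro cos_arccos) (simp_all add: le_divide_eq divide_le_eq power2_sum power2_diff)
  then have "D * cos \<phi> = x\<^sup>2 - ?p\<^sup>2 - ?r\<^sup>2" using pr unfolding D_def[symmetric] by simp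
  then have x: "x\<^sup>2 = ?p\<^sup>2 + ?r\<^sup>2 + 2 * ?p * ?r * cos \<phi>" by (simp add: D_def)
  define N where "N = norm (1 + of_real ?q * cis \<phi>)"
  \<comment> \<open>For c > 0 this is x^2 = p^2 |1 + q e|^2 in logarithmic form. For c = 0 the point
    x = 0 belongs to the support and the logarithms carry no information, but the factor c removes
    them.\<close>
  have "c * (2 * ln \<bar>x\<bar>) = c * (2 * ln ?p + 2 * ln N)"
  proof (cases "c = 0")
    case False
    then have "?q \<noteq> 1" using rr_consts(5) by auto
    then have q1: "?q < 1" using qq(2) by simp
    have "N\<^sup>2 = (1 + ?q * cos \<phi>)\<^sup>2 + (?q * sin \<phi>)\<^sup>2"
      unfolding N_def cmod_power2 by simp
    also have "\<dots> = 1 + 2 * ?q * cos \<phi> + ?q\<^sup>2 * ((cos \<phi>)\<^sup>2 + (sin \<phi>)\<^sup>2)"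
    proof -
      have "(1 + q * C)\<^sup>2 + (q * S)\<^sup>2 = 1 + 2 * q * C + q\<^sup>2 * (C\<^sup>2 + S\<^sup>2)" for q C S :: real
        by (simp add: power2_eq_square algebra_simps)
      then show ?thesis .
    qed
    finally have N2: "N\<^sup>2 = 1 + ?q\<^sup>2 + 2 * ?q * cos \<phi>" by simp
    have "0 < N\<^sup>2" unfolding N2 by (rule circle_denom_pos[OF qq(1) q1])
    then have N: "0 < N" by (simp add: N_def)
    have "x\<^sup>2 = (?p * N)\<^sup>2"
      unfolding power_mult_distrib N2 x rr_consts(4)[symmetric] by (simp add: power2_eq_square algebra_simps)
    then have "\<bar>x\<bar> = ?p * N" using pp_rr N by (metis abs_of_pos mult_pos_pos power2_eq_iff_nonneg power2_abs abs_ge_zero less_imp_le)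
    then show ?thesis using pp_rr N by (simp add: ln_mult)
  qed simp
  then show ?thesis unfolding potential_circle_parameter[OF x] N_def[symmetric] ell_def x by (simp add: algebra_simps)
qed

text \<open>The difference to \<open>ell\<close> is a function h of \<zeta> that vanishes at \<zeta>
  = 1 and \<zeta> = -1, the parameters of the edges, and is monotone on each admissible range. Since
  x^2 = p^2 (1 + q \<zeta>) (1 + q/\<zeta>), positive \<zeta> describes |x| > b and -1 < \<zeta> <
  -q describes 0 < |x| < a.\<close>

lemma effective_potential_off:
  fixes \<zeta> :: real
  assumes \<zeta>: "\<zeta> \<noteq> 0" "\<bar>\<zeta>\<bar> < 1" "0 < \<zeta> \<or> \<zeta> < - qq \<beta> c"
    and x: "x\<^sup>2 = (pp \<beta> c)\<^sup>2 + (rr \<beta>)\<^sup>2 + pp \<beta> c * rr \<beta> * (\<zeta> + 1 / \<zeta>)"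
  shows "ell \<le> \<beta> * nu_pot x + x\<^sup>2 - 2 * c * ln \<bar>x\<bar>"
proof -
  let ?p = "pp \<beta> c" and ?r = "rr \<beta>" and ?q = "qq \<beta> c"
  define h where "h z = ?r\<^sup>2 * ln (z\<^sup>2) + ?p * ?r * (1 / z - z) + c * (ln (1 + ?q * z) - ln (1 + ?q / z))" for z
  have pos: "0 < 1 + ?q * z" "0 < 1 + ?q / z" if "0 < z \<or> z < - ?q" "- 1 \<le> z" "z \<le> 1" for z
  proof -
    have "0 < 1 + ?q * z \<and> 0 < 1 + ?q / z"
    proof (cases "0 < z")
      case True then show ?thesis using qq(1) by (simp add: add_pos_pos)
    next
      case False
      then have z: "z < - ?q" "z < 0" using that qq(1) by auto
      then have "?q < 1" using that(2) by linarith
      moreover have "?q * (-1) \<le> ?q * z" using qq(1) that(2) by (intro mult_left_mono) auto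
      moreover have "-1 < ?q / z" using z by (simp add: field_simps)
      ultimately show ?thesis by auto
    qed
    then show "0 < 1 + ?q * z" "0 < 1 + ?q / z" by auto
  qed
  \<comment> \<open>The numerator is a square and 1 + q z is positive on both ranges, so the sign of
    the derivative is opposite to that of z + q: h decreases on (0, 1] and increases on the part of
    [-1, -q) considered.\<close>
  have deriv: "(h has_real_derivative - (?p\<^sup>2 * ?q\<^sup>2 * (1 - z\<^sup>2)\<^sup>2 / (z\<^sup>2 * (1 + ?q * z) * (z + ?q)))) (at z)"
    if z: "0 < z \<or> z < - ?q" "- 1 \<le> z" "z \<le> 1" for z
  proof -
    have z0: "z \<noteq> 0" using z qq(1) by auto
    note ps = pos[OF z]
    have zq: "z + ?q \<noteq> 0" using z qq(1) by auto
    have d1: "((\<lambda>z. ln (z\<^sup>2)) has_real_derivative 2 * z / z\<^sup>2) (at z)"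
      using z0 by (auto intro!: derivative_eq_intros)
    have d2: "((\<lambda>z. 1 / z - z) has_real_derivative - 1 / z\<^sup>2 - 1) (at z)"
      using z0 by (auto intro!: derivative_eq_intros simp: power2_eq_square)
    have d3: "((\<lambda>z. ln (1 + ?q * z)) has_real_derivative ?q / (1 + ?q * z)) (at z)"
      using ps by (auto intro!: derivative_eq_intros)
    have d4: "((\<lambda>z. ln (1 + ?q / z)) has_real_derivative (- ?q / z\<^sup>2) / (1 + ?q / z)) (at z)"
      using ps z0 by (auto intro!: derivative_eq_intros simp: power2_eq_square)
    have "(h has_real_derivative ?r\<^sup>2 * (2 * z / z\<^sup>2) + ?p * ?r * (- 1 / z\<^sup>2 - 1) + c * (?q / (1 + ?q * z) - (- ?q / z\<^sup>2) / (1 + ?q / z))) (at z)"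
      unfolding h_def by (rule DERIV_add[OF DERIV_add[OF DERIV_cmult[OF d1] DERIV_cmult[OF d2]] DERIV_cmult[OF DERIV_diff[OF d3 d4]]])
    also have "(- ?q / z\<^sup>2) / (1 + ?q / z) = - ?q / (z * (z + ?q))"
      using z0 zq by (simp add: field_simps power2_eq_square)
    also have "?r\<^sup>2 * (2 * z / z\<^sup>2) + ?p * ?r * (- 1 / z\<^sup>2 - 1) + c * (?q / (1 + ?q * z) - - ?q / (z * (z + ?q)))
      = ?p\<^sup>2 * (?q\<^sup>2 * (2 * z / z\<^sup>2) + ?q * (- 1 / z\<^sup>2 - 1) + (1 - ?q\<^sup>2) * (?q / (1 + ?q * z) + ?q / (z * (z + ?q))))"
    proof -
      have "r\<^sup>2 * A + p * r * B + d * (D - - E / F) = p\<^sup>2 * (q\<^sup>2 * A + q * B + (1 - q\<^sup>2) * (D + E / F))"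
        if "r = p * q" "d = p\<^sup>2 * (1 - q\<^sup>2)" for r p q d A B D E F :: real
        unfolding that by (simp add: power2_eq_square algebra_simps)
      then show ?thesis using rr_consts(4,5) by metis
    qed
    also have "?q\<^sup>2 * (2 * z / z\<^sup>2) + ?q * (- 1 / z\<^sup>2 - 1) + (1 - ?q\<^sup>2) * (?q / (1 + ?q * z) + ?q / (z * (z + ?q)))
      = - (?q\<^sup>2 * (1 - z\<^sup>2)\<^sup>2 / (z\<^sup>2 * (1 + ?q * z) * (z + ?q)))"
    proof -
      have "q\<^sup>2 * (2 * z / z\<^sup>2) + q * (- 1 / z\<^sup>2 - 1) + (1 - q\<^sup>2) * (q / u + q / (z * v)) = - (q\<^sup>2 * (1 - z\<^sup>2)\<^sup>2 / (z\<^sup>2 * u * v))"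
        if "u = 1 + q * z" "v = z + q" "u \<noteq> 0" "v \<noteq> 0" for q u v
      proof -
        have "z\<^sup>2 * u * v * (q\<^sup>2 * (2 * z / z\<^sup>2) + q * (- 1 / z\<^sup>2 - 1) + (1 - q\<^sup>2) * (q / u + q / (z * v)))
           = q\<^sup>2 * (2 * z) * u * v + q * (- 1 - z\<^sup>2) * u * v + (1 - q\<^sup>2) * (q * z\<^sup>2 * v + q * z * u)"
          using that(3,4) z0 by (simp add: field_simps power2_eq_square)
        also have "\<dots> = - (q\<^sup>2 * (1 - z\<^sup>2)\<^sup>2)"
          unfolding that(1,2) by (simp add: power2_eq_square algebra_simps)
        finally have e: "z\<^sup>2 * u * v * (q\<^sup>2 * (2 * z / z\<^sup>2) + q * (- 1 / z\<^sup>2 - 1) + (1 - q\<^sup>2) * (q / u + q / (z * v))) = - (q\<^sup>2 * (1 - z\<^sup>2)\<^sup>2)" .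
        have "E = - (N / Z)" if "Z * E = - N" "Z \<noteq> 0" for E N Z :: real using that by (simp add: field_simps)
        from this[OF e] show ?thesis using that(3,4) z0 by simp
      qed
      then show ?thesis using ps zq by auto
    qed
    finally show ?thesis by (simp only: mult.assoc times_divide_eq_right mult_minus_right)
  qed
  have h0: "0 \<le> h \<zeta>"
  proof (cases "0 < \<zeta>")
    case True
    have "h \<zeta> \<ge> h 1"
    proof (rule DERIV_nonpos_imp_nonincreasing[where f = h])
      fix z assume z: "\<zeta> \<le> z" "z \<le> 1"
      then have "0 < z" using True by simp
      moreover have "0 \<le> ?p\<^sup>2 * ?q\<^sup>2 * (1 - z\<^sup>2)\<^sup>2 / (z\<^sup>2 * (1 + ?q * z) * (z + ?q))"
        using \<open>0 < z\<close> qq(1) by (intro divide_nonneg_pos mult_nonneg_nonneg mult_pos_pos) (auto simp: add_pos_pos)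
      ultimately show "\<exists>y. (h has_real_derivative y) (at z) \<and> y \<le> 0" using deriv[of z] z by (intro exI conjI) auto
    qed (use \<zeta> in auto)
    then show ?thesis by (simp add: h_def)
  next
    case False
    then have zq: "\<zeta> < - ?q" using \<zeta> by auto
    have "h (-1) \<le> h \<zeta>"
    proof (rule DERIV_nonneg_imp_nondecreasing[where f = h])
      fix z assume z: "-1 \<le> z" "z \<le> \<zeta>"
      then have z': "z < - ?q" "z \<le> 1" "z < 0" using zq qq(1) by auto
      then have "0 \<le> ?p\<^sup>2 * ?q\<^sup>2 * (1 - z\<^sup>2)\<^sup>2 / (z\<^sup>2 * (1 + ?q * z) * (- (z + ?q)))"
        using pos[of z] z by (intro divide_nonneg_pos mult_nonneg_nonneg mult_pos_pos) auto
      then have "0 \<le> - (?p\<^sup>2 * ?q\<^sup>2 * (1 - z\<^sup>2)\<^sup>2 / (z\<^sup>2 * (1 + ?q * z) * (z + ?q)))"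
        unfolding mult_minus_right divide_minus_right .
      then show "\<exists>y. (h has_real_derivative y) (at z) \<and> 0 \<le> y" using deriv[of z] z z' by (intro exI conjI) auto
    qed (use \<zeta> in auto)
    then show ?thesis by (simp add: h_def)
  qed
  have ps: "0 < 1 + ?q * \<zeta>" "0 < 1 + ?q / \<zeta>" using pos[of \<zeta>] \<zeta> by auto
  have x': "x\<^sup>2 = ?p\<^sup>2 * ((1 + ?q * \<zeta>) * (1 + ?q / \<zeta>))"
    unfolding x rr_consts(4)[symmetric] using \<zeta>(1) by (simp add: power2_eq_square algebra_simps)
  have "0 < x\<^sup>2" unfolding x' using ps pp_rr(1) by simp
  then have "2 * ln \<bar>x\<bar> = ln (x\<^sup>2)" using ln_realpow[of "\<bar>x\<bar>" 2] by simp
  also have "\<dots> = 2 * ln ?p + ln (1 + ?q * \<zeta>) + ln (1 + ?q / \<zeta>)"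
    unfolding x' using ps pp_rr(1) by (simp add: ln_mult ln_realpow)
  finally have lx: "2 * c * ln \<bar>x\<bar> = c * (2 * ln ?p + ln (1 + ?q * \<zeta>) + ln (1 + ?q / \<zeta>))" by simp
  have lz: "ln (\<zeta>\<^sup>2) = 2 * ln \<bar>\<zeta>\<bar>" using \<zeta>(1) ln_realpow[of "\<bar>\<zeta>\<bar>" 2] by simp
  have "\<beta> * nu_pot x + x\<^sup>2 - 2 * c * ln \<bar>x\<bar> = ell + h \<zeta>"
    unfolding potential_real_parameter[OF \<zeta>(1,2) x] lx x ell_def h_def lz by (simp add: algebra_simps)
  then show ?thesis using h0 by simp
qed

lemma effective_potential_ge:
  assumes "c = 0 \<or> x \<noteq> 0"
  shows "ell \<le> \<beta> * nu_pot x + x\<^sup>2 - 2 * c * ln \<bar>x\<bar>"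
proof (cases "edge_a \<beta> c \<le> \<bar>x\<bar> \<and> \<bar>x\<bar> \<le> edge_b \<beta> c")
  case True then show ?thesis using effective_potential_eq by simp
next
  case False
  let ?p = "pp \<beta> c" and ?r = "rr \<beta>" and ?q = "qq \<beta> c"
  have pr: "0 < ?p * ?r" using pp_rr by simp
  \<comment> \<open>The affine coordinate w of x^2 in which the support becomes [-2, 2]; off the
    support |w| > 2 and the inverse Joukowski map applies.\<close>
  have "\<exists>w. D * w = X" if "0 < D" for D X :: real using that by (intro exI[of _ "X / D"]) simp
  from this[OF pr, of "x\<^sup>2 - ?p\<^sup>2 - ?r\<^sup>2"] obtain w where "?p * ?r * w = x\<^sup>2 - ?p\<^sup>2 - ?r\<^sup>2" by blast
  then have x: "x\<^sup>2 = ?p\<^sup>2 + ?r\<^sup>2 + ?p * ?r * w" by simp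
  show ?thesis
  proof (cases "\<bar>x\<bar> > edge_b \<beta> c")
    case True
    then have "(edge_b \<beta> c)\<^sup>2 < \<bar>x\<bar>\<^sup>2" using edge_ab by (intro power_strict_mono) auto
    then have "?p * ?r * 2 < ?p * ?r * w" by (simp add: edges power2_sum x)
    then have w: "2 < w" using pr mult_less_cancel_left_pos by blast
    then obtain z where z: "z \<noteq> 0" "\<bar>z\<bar> < 1" "z + 1 / z = w" "0 < z * w" using joukowski_surj[of w] by auto
    then have "0 < z" using w by (simp add: zero_less_mult_iff)
    then show ?thesis using effective_potential_off[of z x] z x by simp
  next
    case b: False
    then have a: "\<bar>x\<bar> < edge_a \<beta> c" using False by auto
    then have "?p \<noteq> ?r" by (auto simp: edges)
    then have "c \<noteq> 0" using qq(4) pp_rr(1,2) by (metis diff_add_cancel power2_eq_iff_nonneg less_imp_le add_0)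
    then have x0: "0 < x\<^sup>2" using assms by simp
    have "\<bar>x\<bar>\<^sup>2 < (edge_a \<beta> c)\<^sup>2" using a by (intro power_strict_mono) auto
    then have "?p * ?r * w < ?p * ?r * (- 2)" by (simp add: edges power2_diff x)
    then have w: "w < - 2" using pr mult_less_cancel_left_pos by blast
    then obtain z where z: "z \<noteq> 0" "\<bar>z\<bar> < 1" "z + 1 / z = w" "0 < z * w" using joukowski_surj[of w] by auto
    then have zn: "z < 0" using w by (simp add: zero_less_mult_iff)
    have "x\<^sup>2 = ?p\<^sup>2 * ((1 + ?q * z) * (1 + ?q / z))"
      unfolding x z(3)[symmetric] rr_consts(4)[symmetric] using z(1) by (simp add: power2_eq_square algebra_simps)
    then have "0 < (1 + ?q * z) * (1 + ?q / z)" using x0 pp_rr(1) by (simp add: zero_less_mult_iff)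
    moreover have "0 < 1 + ?q * z"
    proof -
      have "?q * - z \<le> 1 * - z" using qq(2) zn by (intro mult_right_mono) auto
      then show ?thesis using z(2) zn by linarith
    qed
    ultimately have "0 < 1 + ?q / z" by (simp add: zero_less_mult_iff)
    then have "z < - ?q" using zn by (simp add: field_simps)
    then show ?thesis using effective_potential_off[of z x] z x by simp
  qed
qed

section \<open>Moments and the minimal energy in closed form\<close>

lemma second_moment: "integrable (nu_eq \<beta> c) (\<lambda>t. t\<^sup>2)" "(\<integral>t. t\<^sup>2 \<partial>nu_eq \<beta> c) = (pp \<beta> c)\<^sup>2"
proof -
  interpret K: prob_space "circle_measure (qq \<beta> c)" by (rule prob_space_circle_measure)
  let ?q = "qq \<beta> c"
  have co: "continuous_on {0..1::real} (\<lambda>\<tau>. cos (2 * pi * \<tau>))" by (intro continuous_intros)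
  note C = circle_integral_continuous[OF qq(1,2) co circle_weight_integral_cos[OF qq(1,2)]]
  have i: "integrable (circle_measure ?q) (\<lambda>\<tau>. YY \<beta> c \<tau>)" unfolding YY_def using C(1) by simp
  then show "integrable (nu_eq \<beta> c) (\<lambda>t. t\<^sup>2)" using integral_nu_eq_circle(2)[of "\<lambda>s. s"] by simp
  have "(\<integral>t. t\<^sup>2 \<partial>nu_eq \<beta> c) = (\<integral>\<tau>. YY \<beta> c \<tau> \<partial>circle_measure ?q)" using integral_nu_eq_circle(1)[of "\<lambda>s. s"] by simp
  also have "\<dots> = (pp \<beta> c)\<^sup>2 + (rr \<beta>)\<^sup>2 + 2 * pp \<beta> c * rr \<beta> * (- ?q / 2)"
    unfolding YY_def using C K.prob_space by simp
  also have "\<dots> = (pp \<beta> c)\<^sup>2" unfolding rr_consts(4)[symmetric] by (simp add: power2_eq_square)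
  finally show "(\<integral>t. t\<^sup>2 \<partial>nu_eq \<beta> c) = (pp \<beta> c)\<^sup>2" .
qed

lemma log_moment: "integrable (nu_eq \<beta> c) (\<lambda>t. ln \<bar>t\<bar>)" "(\<integral>t. ln \<bar>t\<bar> \<partial>nu_eq \<beta> c) = - nu_pot 0"
  using nu_pot_approx(1)[of 1 0] by (auto simp: nu_pot_def)

text \<open>The origin has parameter \<zeta> = -q, which lies inside the disc because c > 0 gives q
  < 1.\<close>

lemma nu_pot_0:
  assumes "0 < c"
  shows "\<beta> * nu_pot 0 = - \<beta> * ln (pp \<beta> c) + 2 * (rr \<beta>)\<^sup>2 + 2 * c * ln (1 - (qq \<beta> c)\<^sup>2)"
proof -
  let ?p = "pp \<beta> c" and ?r = "rr \<beta>" and ?q = "qq \<beta> c"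
  have "?q \<noteq> 1" using assms rr_consts(5) by auto
  then have q1: "?q < 1" using qq(2) by simp
  have x: "0\<^sup>2 = ?p\<^sup>2 + ?r\<^sup>2 + ?p * ?r * (- ?q + 1 / - ?q)"
    unfolding rr_consts(4)[symmetric] using qq(1) by (simp add: power2_eq_square algebra_simps)
  have lr: "ln \<bar>- ?q\<bar> = ln ?r - ln ?p" using pp_rr(1,2) by (simp add: qq_def ln_div)
  have "\<beta> * nu_pot 0 = - 2 * ?r\<^sup>2 * ln (?p * ?r) + 2 * ?r\<^sup>2 * (ln ?r - ln ?p) + 2 * ?r * (?p * ?q) + 2 * c * ln (1 - ?q\<^sup>2)"
    using potential_real_parameter[of "- ?q" 0, OF _ _ x] qq(1) q1 unfolding lr by (simp add: power2_eq_square mult_ac)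
  also have "\<dots> = - (4 * ?r\<^sup>2) * ln ?p + 2 * ?r\<^sup>2 + 2 * c * ln (1 - ?q\<^sup>2)"
    unfolding rr_consts(4) using pp_rr(1,2) by (simp add: ln_mult power2_eq_square algebra_simps)
  finally show ?thesis using rr_consts(3) by simp
qed

text \<open>Integrating the constancy of the effective potential against the equilibrium measure
  gives \<beta> I + J = \<open>ell\<close>, with I the logarithmic energy and J the integral of the
  external field. Eliminating I from \<beta>/2 I + J leaves this half sum.\<close>

definition "Estar = (ell + (\<integral>t. t\<^sup>2 - 2 * c * ln \<bar>t\<bar> \<partial>nu_eq \<beta> c)) / 2"

lemma Estar_eq:
  "Estar = 3*\<beta>/8 + \<beta>/4 * ln (4/\<beta>) + c * (3/2 + ln (4/\<beta>))
            + (if c = 0 then 0 else 2*c\<^sup>2/\<beta> * ln (4*c/\<beta>))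
            - (2*c\<^sup>2/\<beta> + c + \<beta>/8) * ln (1 + 4*c/\<beta>)"
proof -
  let ?p = "pp \<beta> c" and ?r = "rr \<beta>" and ?q = "qq \<beta> c"
  \<comment> \<open>Since r^2 = \<beta>/4 and p^2 = (\<beta>/4) (1 + 4 c/\<beta>), all logarithms
    reduce to these two, together with ln (4 c/\<beta>) when c > 0.\<close>
  define lb where "lb = ln (4 / \<beta>)"
  define La where "La = ln (1 + 4 * c / \<beta>)"
  have r: "2 * ln ?r = - lb"
  proof -
    have "2 * ln ?r = ln (?r\<^sup>2)" using pp_rr by (simp add: ln_realpow)
    then show ?thesis using \<beta> by (simp add: pp_rr lb_def ln_div)
  qed
  have p: "2 * ln ?p = La - lb"
  proof -
    have "2 * ln ?p = ln (?p\<^sup>2)" using pp_rr(1) ln_realpow[of ?p 2] by simp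
    also have "?p\<^sup>2 = (1 + 4 * c / \<beta>) / (4 / \<beta>)" using \<beta> by (simp add: pp_rr field_simps)
    also have "ln \<dots> = La - lb" 
    proof -
      have "0 < 1 + 4 * c / \<beta>" using \<beta> c by (intro add_pos_nonneg) auto
      then show ?thesis unfolding La_def lb_def using \<beta> by (intro ln_divide_pos) auto
    qed
    finally show ?thesis .
  qed
  have lpr: "2 * ln (?p * ?r) = La - 2 * lb" using p r pp_rr by (simp add: ln_mult)
  have ell: "ell = c + \<beta> / 2 - \<beta> / 4 * (La - 2 * lb) - c * (La - lb)"
    unfolding ell_def lpr[symmetric] p[symmetric] by (simp add: pp_rr)
  have "(\<integral>t. t\<^sup>2 - 2 * c * ln \<bar>t\<bar> \<partial>nu_eq \<beta> c) = ?p\<^sup>2 + 2 * c * nu_pot 0"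
    using second_moment log_moment by simp
  then have E: "2 * Estar = ell + c + \<beta> / 4 + 2 * c * nu_pot 0" by (simp add: Estar_def pp_rr)
  show ?thesis
  proof (cases "c = 0")
    case True
    then have "La = 0" by (simp add: La_def)
    then show ?thesis using E ell True by (simp add: lb_def[symmetric])
  next
    case False
    then have c0: "0 < c" using c by simp
    have "1 - ?q\<^sup>2 = c / ?p\<^sup>2" using rr_consts(5) pp_rr(1) by (simp add: eq_divide_eq mult.commute)
    then have l: "ln (1 - ?q\<^sup>2) = ln c - (La - lb)" using c0 pp_rr(1) p by (simp add: ln_div ln_realpow)
    have l4: "ln (4 * c / \<beta>) = ln c + lb" using c0 \<beta> by (simp add: lb_def ln_div ln_mult)
    have "\<beta> * nu_pot 0 = - (\<beta> / 2) * (La - lb) + \<beta> / 2 + 2 * c * (ln (4 * c / \<beta>) - La)"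
    proof -
      have lp: "ln ?p = (La - lb) / 2" using p by simp
      show ?thesis unfolding nu_pot_0[OF c0] l l4 lp pp_rr by (simp add: algebra_simps diff_divide_distrib)
    qed
    then have U: "nu_pot 0 = (- (\<beta> / 2) * (La - lb) + \<beta> / 2 + 2 * c * (ln (4 * c / \<beta>) - La)) / \<beta>"
      using \<beta> by (simp add: eq_divide_eq mult.commute)
    also have "\<dots> = - (1 / 2) * (La - lb) + 1 / 2 + 2 * c / \<beta> * (ln (4 * c / \<beta>) - La)"
    proof -
      have "(- (\<beta> / 2) * x + \<beta> / 2 + 2 * c * y) / \<beta> = - (1 / 2) * x + 1 / 2 + 2 * c / \<beta> * y" for x y
        using \<beta> by (simp add: field_simps)
      then show ?thesis .
    qed
    finally have "2 * c * nu_pot 0 = 2 * c * (- (1 / 2) * (La - lb) + 1 / 2 + 2 * c / \<beta> * (ln (4 * c / \<beta>) - La))" by simp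
    also have "\<dots> = - c * (La - lb) + c + 4 * c\<^sup>2 / \<beta> * ln (4 * c / \<beta>) - 4 * c\<^sup>2 / \<beta> * La"
    proof -
      have "2 * c * (- (1 / 2) * x + 1 / 2 + 2 * c / \<beta> * (y - z)) = - c * x + c + 4 * c\<^sup>2 / \<beta> * y - 4 * c\<^sup>2 / \<beta> * z" for x y z
        by (simp add: algebra_simps power2_eq_square diff_divide_distrib)
      then show ?thesis .
    qed
    finally have "2 * c * nu_pot 0 = - c * (La - lb) + c + 4 * c\<^sup>2 / \<beta> * ln (4 * c / \<beta>) - 4 * c\<^sup>2 / \<beta> * La" .
    then have "2 * Estar = 2 * (3*\<beta>/8 + \<beta>/4 * lb + c * (3/2 + lb) + 2*c\<^sup>2/\<beta> * ln (4*c/\<beta>) - (2*c\<^sup>2/\<beta> + c + \<beta>/8) * La)"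
      unfolding E ell by (simp add: algebra_simps)
    then show ?thesis using False by (simp add: lb_def[symmetric] La_def[symmetric])
  qed
qed

end

section \<open>The energy\<close>

text \<open>An integrable minorant has finite positive and negative parts; passing to
  \<open>K\<close> enlarges the first and shrinks the second.\<close>

lemma real_integral_le_eint:
  assumes \<phi>: "integrable M \<phi>" and le: "\<And>z. ereal (\<phi> z) \<le> K z"
  shows "ereal (\<integral>z. \<phi> z \<partial>M) \<le> eint M K"
proof -
  let ?p = "\<integral>\<^sup>+z. ennreal (\<phi> z) \<partial>M" and ?n = "\<integral>\<^sup>+z. ennreal (- \<phi> z) \<partial>M"
  have fin: "?p \<noteq> \<infinity>" "?n \<noteq> \<infinity>" using \<phi> unfolding real_integrable_def by auto
  have 1: "?p \<le> (\<integral>\<^sup>+z. e2ennreal (K z) \<partial>M)"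
    by (rule nn_integral_mono) (use le in \<open>metis e2ennreal_ereal e2ennreal_mono\<close>)
  have 2: "(\<integral>\<^sup>+z. e2ennreal (- K z) \<partial>M) \<le> ?n"
  proof (rule nn_integral_mono)
    fix z
    have "- K z \<le> ereal (- \<phi> z)" using le[of z] by (metis ereal_minus_le_minus uminus_ereal.simps(1))
    then show "e2ennreal (- K z) \<le> ennreal (- \<phi> z)" by (metis e2ennreal_ereal e2ennreal_mono)
  qed
  have "ereal (\<integral>z. \<phi> z \<partial>M) = enn2ereal ?p - enn2ereal ?n"
    unfolding real_lebesgue_integral_def[OF \<phi>] using fin
    by (cases ?p; cases ?n) auto
  also have "\<dots> \<le> eint M K"
    unfolding eint_def using 1 2 by (intro ereal_minus_mono) (auto simp: less_eq_ennreal.rep_eq)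
  finally show ?thesis .
qed

lemma eint_AE_real:
  assumes \<phi>: "integrable M \<phi>" and ae: "AE z in M. K z = ereal (\<phi> z)"
  shows "eint M K = ereal (\<integral>z. \<phi> z \<partial>M)"
proof -
  let ?p = "\<integral>\<^sup>+z. ennreal (\<phi> z) \<partial>M" and ?n = "\<integral>\<^sup>+z. ennreal (- \<phi> z) \<partial>M"
  have fin: "?p \<noteq> \<infinity>" "?n \<noteq> \<infinity>" using \<phi> unfolding real_integrable_def by auto
  have "(\<integral>\<^sup>+z. e2ennreal (K z) \<partial>M) = ?p" "(\<integral>\<^sup>+z. e2ennreal (- K z) \<partial>M) = ?n"
    by (intro nn_integral_cong_AE, use ae in eventually_elim, simp)+
  then show ?thesis
    unfolding real_lebesgue_integral_def[OF \<phi>] eint_def using fin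
    by (cases ?p; cases ?n) auto
qed

context log_gas
begin

text \<open>Twice the bound on the equilibrium density: the truncated potential misses the true one
  by at most \<open>gapc * \<epsilon>\<close>.\<close>

definition "gapc = 4 * edge_b \<beta> c / (pi * \<beta>)"

lemma nu_potL_measurable [measurable]: "nu_potL \<epsilon> \<in> borel_measurable borel"
proof -
  interpret N: prob_space "nu_eq \<beta> c" by (rule prob_space_nu_eq)
  show ?thesis unfolding nu_potL_def[abs_def] by measurable
qed

lemma nu_pot_measurable [measurable]: "nu_pot \<in> borel_measurable borel"
proof -
  interpret N: prob_space "nu_eq \<beta> c" by (rule prob_space_nu_eq)
  show ?thesis unfolding nu_pot_def[abs_def] by measurable
qed

lemma nu_pot_integral:
  "integrable (nu_eq \<beta> c) nu_pot" "\<beta> / 2 * (\<integral>t. nu_pot t \<partial>nu_eq \<beta> c) = ell - Estar"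
proof -
  interpret N: prob_space "nu_eq \<beta> c" by (rule prob_space_nu_eq)
  let ?Q = "\<lambda>t. t\<^sup>2 - 2 * c * ln \<bar>t\<bar>"
  have ae: "AE t in nu_eq \<beta> c. nu_pot t = (ell - ?Q t) / \<beta>"
    using AE_nu_eq_support
  proof eventually_elim
    case (elim t)
    then have "\<beta> * nu_pot t = ell - ?Q t" using effective_potential_eq[of t] by simp
    then show ?case using \<beta> by (simp add: eq_divide_eq mult.commute)
  qed
  have iQ: "integrable (nu_eq \<beta> c) ?Q" using second_moment(1) log_moment(1) by simp
  have i: "integrable (nu_eq \<beta> c) (\<lambda>t. (ell - ?Q t) / \<beta>)" using iQ by simp
  show "integrable (nu_eq \<beta> c) nu_pot" by (subst integrable_cong_AE[OF _ _ ae]) (use i in auto)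
  have "(\<integral>t. nu_pot t \<partial>nu_eq \<beta> c) = (\<integral>t. (ell - ?Q t) / \<beta> \<partial>nu_eq \<beta> c)"
    by (rule integral_cong_AE[OF _ _ ae]) auto
  also have "\<dots> = (ell - (\<integral>t. ?Q t \<partial>nu_eq \<beta> c)) / \<beta>" using iQ N.prob_space by simp
  finally show "\<beta> / 2 * (\<integral>t. nu_pot t \<partial>nu_eq \<beta> c) = ell - Estar"
    unfolding Estar_def using \<beta> by (simp add: field_simps)
qed

lemma log_pair_nu_eq:
  assumes "prob_space m" and s: "sets m = sets borel" and "integrable m (\<lambda>x. x)" and "0 < \<epsilon>"
  shows "integrable m (nu_potL \<epsilon>)" "log_pair \<epsilon> m (nu_eq \<beta> c) = (\<integral>x. nu_potL \<epsilon> x \<partial>m)"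
proof -
  interpret N: prob_space "nu_eq \<beta> c" by (rule prob_space_nu_eq)
  interpret m: prob_space m by fact
  interpret P: pair_prob_space m "nu_eq \<beta> c" ..
  note i = integrable_Lk_pair[OF assms(1) prob_space_nu_eq s sets_nu_eq assms(3) integrable_nu_eq_id assms(4)]
  show "integrable m (nu_potL \<epsilon>)" using P.integrable_fst'[OF i] by (simp add: nu_potL_def[abs_def])
  show "log_pair \<epsilon> m (nu_eq \<beta> c) = (\<integral>x. nu_potL \<epsilon> x \<partial>m)"
    unfolding log_pair_def using P.integral_fst'[OF i] by (simp add: nu_potL_def)
qed

lemma log_pair_nu_eq_le:
  assumes "0 < \<epsilon>"
  shows "\<beta> / 2 * log_pair \<epsilon> (nu_eq \<beta> c) (nu_eq \<beta> c) \<le> ell - Estar"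
proof -
  note l = log_pair_nu_eq[OF prob_space_nu_eq sets_nu_eq integrable_nu_eq_id assms]
  have "log_pair \<epsilon> (nu_eq \<beta> c) (nu_eq \<beta> c) \<le> (\<integral>t. nu_pot t \<partial>nu_eq \<beta> c)"
    unfolding l(2) by (rule integral_mono[OF l(1) nu_pot_integral(1)]) (rule nu_pot_approx(2)[OF assms])
  then have "\<beta> / 2 * log_pair \<epsilon> (nu_eq \<beta> c) (nu_eq \<beta> c) \<le> \<beta> / 2 * (\<integral>t. nu_pot t \<partial>nu_eq \<beta> c)"
    using \<beta> by (intro mult_left_mono) auto
  then show ?thesis unfolding nu_pot_integral(2) .
qed

text \<open>The first-order expansion of the truncated energy at the equilibrium measure, as a kernel; it
  lies below the energy kernel pointwise, which avoids any integrability discussion for \<open>log \<bar>t\<bar>\<close>.\<close>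

definition "lin_kernel \<epsilon> s t = \<beta> / 2 * (Lk \<epsilon> (s - t) - nu_potL \<epsilon> s - nu_potL \<epsilon> t) + ell - \<beta> * (gapc * \<epsilon>)"

text \<open>With L the truncated mutual energy, L(m, m) - 2 L(m, \<nu>) = D - L(\<nu>, \<nu>), and
  \<beta>/2 L(\<nu>, \<nu>) is at most the untruncated value \<open>ell - Estar\<close>. Subtracting
  that from \<open>ell\<close> leaves \<open>Estar\<close>.\<close>

lemma lin_kernel_integral:
  assumes "prob_space m" and s: "sets m = sets borel" and "integrable m (\<lambda>x. x)" and "0 < \<epsilon>"
  shows "integrable (m \<Otimes>\<^sub>M m) (\<lambda>z. lin_kernel \<epsilon> (fst z) (snd z))"
    and "\<beta> / 2 * log_energy \<epsilon> m (nu_eq \<beta> c) + Estar - \<beta> * (gapc * \<epsilon>) \<le> (\<integral>z. lin_kernel \<epsilon> (fst z) (snd z) \<partial>(m \<Otimes>\<^sub>M m))"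
proof -
  interpret m: prob_space m by fact
  interpret P: pair_prob_space m m ..
  note l = log_pair_nu_eq[OF assms]
  note i = integrable_Lk_pair[OF assms(1,1) s s assms(3,3,4)]
  note f = integral_pair_fst[OF assms(1,1) l(1)]
  note g = integral_pair_snd[OF assms(1,1) l(1)]
  show "integrable (m \<Otimes>\<^sub>M m) (\<lambda>z. lin_kernel \<epsilon> (fst z) (snd z))"
    unfolding lin_kernel_def using i f(1) g(1) by auto
  have "(\<integral>z. lin_kernel \<epsilon> (fst z) (snd z) \<partial>(m \<Otimes>\<^sub>M m))
      = \<beta> / 2 * (log_pair \<epsilon> m m - log_pair \<epsilon> m (nu_eq \<beta> c) - log_pair \<epsilon> m (nu_eq \<beta> c)) + ell - \<beta> * (gapc * \<epsilon>)"
    unfolding lin_kernel_def l(2) log_pair_def[of \<epsilon> m m] using i f g P.prob_space by simp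
  also have "\<dots> = \<beta> / 2 * log_energy \<epsilon> m (nu_eq \<beta> c) - \<beta> / 2 * log_pair \<epsilon> (nu_eq \<beta> c) (nu_eq \<beta> c) + ell - \<beta> * (gapc * \<epsilon>)"
    unfolding log_energy_def by (simp add: algebra_simps)
  finally show "\<beta> / 2 * log_energy \<epsilon> m (nu_eq \<beta> c) + Estar - \<beta> * (gapc * \<epsilon>) \<le> (\<integral>z. lin_kernel \<epsilon> (fst z) (snd z) \<partial>(m \<Otimes>\<^sub>M m))"
    using log_pair_nu_eq_le[OF assms(4)] by linarith
qed

lemma effective_potential_trunc_ge:
  assumes "c = 0 \<or> x \<noteq> 0" "0 < \<epsilon>"
  shows "ell - \<beta> * nu_potL \<epsilon> x - \<beta> * (gapc * \<epsilon>) \<le> x\<^sup>2 - 2 * c * ln \<bar>x\<bar>"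
proof -
  have "\<beta> * nu_pot x \<le> \<beta> * (nu_potL \<epsilon> x + gapc * \<epsilon>)"
    using nu_pot_approx(3)[OF assms(2), of x] \<beta> unfolding gapc_def by (intro mult_left_mono) auto
  then show ?thesis using effective_potential_ge[OF assms(1)] by (simp add: distrib_left)
qed

section \<open>The equilibrium measure minimises the energy\<close>

definition "energy_kernel s t = ereal (\<beta>/2) * logk s t + Qd c s / 2 + Qd c t / 2"

lemma Qd_real: "c = 0 \<or> x \<noteq> 0 \<Longrightarrow> Qd c x = ereal (x\<^sup>2 - 2 * c * ln \<bar>x\<bar>)"
  by (auto simp: Qd_def ln_div)

lemma energy_kernel_real:
  assumes "s \<noteq> t" "c = 0 \<or> s \<noteq> 0 \<and> t \<noteq> 0"
  shows "energy_kernel s t = ereal (- (\<beta> / 2 * ln \<bar>s - t\<bar>) + (s\<^sup>2 - 2 * c * ln \<bar>s\<bar>) / 2 + (t\<^sup>2 - 2 * c * ln \<bar>t\<bar>) / 2)"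
proof -
  have "logk s t = ereal (- ln \<bar>s - t\<bar>)" using assms(1) by (simp add: logk_def ln_div)
  moreover have "Qd c s = ereal (s\<^sup>2 - 2 * c * ln \<bar>s\<bar>)" "Qd c t = ereal (t\<^sup>2 - 2 * c * ln \<bar>t\<bar>)"
    using assms(2) by (auto intro!: Qd_real)
  ultimately show ?thesis by (simp add: energy_kernel_def)
qed

lemma energy_kernel_infinite:
  assumes "\<not> (s \<noteq> t \<and> (c = 0 \<or> s \<noteq> 0 \<and> t \<noteq> 0))"
  shows "energy_kernel s t = \<infinity>"
proof -
  have Q: "Qd c x / 2 \<noteq> - \<infinity>" for x by (auto simp: Qd_def)
  have L: "ereal (\<beta>/2) * logk s t \<noteq> - \<infinity>" using \<beta> by (auto simp: logk_def)
  have "ereal (\<beta>/2) * logk s t = \<infinity> \<or> Qd c s / 2 = \<infinity> \<or> Qd c t / 2 = \<infinity>"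
    using assms c \<beta> by (auto simp: logk_def Qd_def)
  then show ?thesis unfolding energy_kernel_def using L Q[of s] Q[of t]
    by (cases "ereal (\<beta>/2) * logk s t"; cases "Qd c s / 2"; cases "Qd c t / 2") auto
qed

lemma lin_kernel_le:
  assumes "0 < \<epsilon>"
  shows "ereal (lin_kernel \<epsilon> s t) \<le> energy_kernel s t"
proof (cases "s \<noteq> t \<and> (c = 0 \<or> s \<noteq> 0 \<and> t \<noteq> 0)")
  case True
  have "Lk \<epsilon> (s - t) \<le> - ln \<bar>s - t\<bar>" using True by (intro Lk_le_log assms) auto
  then have "\<beta> / 2 * Lk \<epsilon> (s - t) \<le> \<beta> / 2 * (- ln \<bar>s - t\<bar>)" using \<beta> by (intro mult_left_mono) auto
  moreover have "ell - \<beta> * nu_potL \<epsilon> s - \<beta> * (gapc * \<epsilon>) \<le> s\<^sup>2 - 2 * c * ln \<bar>s\<bar>"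
     "ell - \<beta> * nu_potL \<epsilon> t - \<beta> * (gapc * \<epsilon>) \<le> t\<^sup>2 - 2 * c * ln \<bar>t\<bar>"
    using True by (auto intro!: effective_potential_trunc_ge assms)
  ultimately have "lin_kernel \<epsilon> s t \<le> - (\<beta> / 2 * ln \<bar>s - t\<bar>) + (s\<^sup>2 - 2 * c * ln \<bar>s\<bar>) / 2 + (t\<^sup>2 - 2 * c * ln \<bar>t\<bar>) / 2"
    unfolding lin_kernel_def right_diff_distrib by argo
  then show ?thesis using True by (subst energy_kernel_real) auto
qed (simp add: energy_kernel_infinite)

text \<open>The logarithms grow at most linearly, with coefficient c + \<beta>/2 in |s| and in |t|;
  half of the quadratic term s^2/2 absorbs this at the cost (c + \<beta>/2)^2 for each variable. It
  excludes the value minus infinity and extracts a second moment from finite energy.\<close>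

lemma energy_kernel_coercive:
  "ereal ((s\<^sup>2 + t\<^sup>2) / 4 - 2 * (c + \<beta> / 2)\<^sup>2) \<le> energy_kernel s t"
proof (cases "s \<noteq> t \<and> (c = 0 \<or> s \<noteq> 0 \<and> t \<noteq> 0)")
  case True
  have ln: "ln \<bar>x\<bar> \<le> \<bar>x\<bar>" for x :: real by (cases "x = 0") (use ln_bound[of "\<bar>x\<bar>"] in auto)
  have "ln \<bar>s - t\<bar> \<le> \<bar>s\<bar> + \<bar>t\<bar>" using ln[of "s - t"] by linarith
  then have "\<beta> / 2 * ln \<bar>s - t\<bar> \<le> \<beta> / 2 * (\<bar>s\<bar> + \<bar>t\<bar>)" using \<beta> by (intro mult_left_mono) auto
  moreover have "c * ln \<bar>s\<bar> \<le> c * \<bar>s\<bar>" "c * ln \<bar>t\<bar> \<le> c * \<bar>t\<bar>" using c ln by (auto intro!: mult_left_mono)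
  moreover have "B * \<bar>x\<bar> - B\<^sup>2 \<le> x\<^sup>2 / 4" for x B :: real
  proof -
    have "0 \<le> (\<bar>x\<bar> / 2 - B)\<^sup>2" by simp
    also have "(\<bar>x\<bar> / 2 - B)\<^sup>2 = x\<^sup>2 / 4 - B * \<bar>x\<bar> + B\<^sup>2" by (simp add: power2_diff power_divide)
    finally show ?thesis by simp
  qed
  from this[of "c + \<beta> / 2" s] this[of "c + \<beta> / 2" t]
  have "(c + \<beta> / 2) * \<bar>s\<bar> + (c + \<beta> / 2) * \<bar>t\<bar> - 2 * (c + \<beta> / 2)\<^sup>2 \<le> s\<^sup>2 / 4 + t\<^sup>2 / 4" by simp
  ultimately have "(s\<^sup>2 + t\<^sup>2) / 4 - 2 * (c + \<beta> / 2)\<^sup>2 \<le> - (\<beta> / 2 * ln \<bar>s - t\<bar>) + (s\<^sup>2 - 2 * c * ln \<bar>s\<bar>) / 2 + (t\<^sup>2 - 2 * c * ln \<bar>t\<bar>) / 2"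
    unfolding distrib_left distrib_right by argo
  then show ?thesis using True by (subst energy_kernel_real) auto
qed (simp add: energy_kernel_infinite)

lemma energy_eq: "energy \<beta> c m = eint (m \<Otimes>\<^sub>M m) (\<lambda>z. energy_kernel (fst z) (snd z))"
  unfolding energy_def energy_kernel_def by (simp add: case_prod_unfold)

text \<open>If the positive part of the kernel has infinite integral, coercivity bounds the negative
  part and the energy is infinite. Otherwise coercivity yields a second moment, hence the first
  moment on which the truncated energies rely; then D \<ge> 0 gives the bound up to an error linear
  in \<epsilon>, and \<epsilon> tends to 0.\<close>

lemma energy_ge_Estar:
  assumes "prob_space m" and s: "sets m = sets borel"
  shows "ereal Estar \<le> energy \<beta> c m"
proof (cases "(\<integral>\<^sup>+z. e2ennreal (energy_kernel (fst z) (snd z)) \<partial>(m \<Otimes>\<^sub>M m)) = \<infinity>")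
  case True
  interpret m: prob_space m by fact
  interpret P: pair_prob_space m m ..
  let ?B = "2 * (c + \<beta> / 2)\<^sup>2"
  have "(\<integral>\<^sup>+z. e2ennreal (- energy_kernel (fst z) (snd z)) \<partial>(m \<Otimes>\<^sub>M m)) \<le> (\<integral>\<^sup>+z. ennreal ?B \<partial>(m \<Otimes>\<^sub>M m))"
  proof (rule nn_integral_mono)
    fix z :: "real \<times> real"
    have "ereal (- ?B) \<le> ereal (((fst z)\<^sup>2 + (snd z)\<^sup>2) / 4 - ?B)" by simp
    also note energy_kernel_coercive
    finally have "- energy_kernel (fst z) (snd z) \<le> ereal ?B" by (metis ereal_minus_le_minus ereal_uminus_uminus uminus_ereal.simps(1))
    then show "e2ennreal (- energy_kernel (fst z) (snd z)) \<le> ennreal ?B" by (metis e2ennreal_ereal e2ennreal_mono)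
  qed
  also have "\<dots> = ennreal ?B" using P.emeasure_space_1 by simp
  finally have "(\<integral>\<^sup>+z. e2ennreal (- energy_kernel (fst z) (snd z)) \<partial>(m \<Otimes>\<^sub>M m)) \<noteq> \<infinity>"
    using ennreal_less_top[of ?B] by (auto simp: top_unique)
  then show ?thesis unfolding energy_eq eint_def True
    by (cases "\<integral>\<^sup>+z. e2ennreal (- energy_kernel (fst z) (snd z)) \<partial>(m \<Otimes>\<^sub>M m)") auto
next
  case False
  interpret m: prob_space m by fact
  interpret P: pair_prob_space m m ..
  note [measurable_cong] = s
  let ?B = "2 * (c + \<beta> / 2)\<^sup>2"
  have "(\<integral>\<^sup>+x. ennreal (x\<^sup>2 / 4) \<partial>m) = (\<integral>\<^sup>+z. ennreal ((fst z)\<^sup>2 / 4) \<partial>(m \<Otimes>\<^sub>M m))"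
    by (subst m.nn_integral_fst[symmetric]) (auto simp: m.emeasure_space_1)
  also have "\<dots> \<le> (\<integral>\<^sup>+z. e2ennreal (energy_kernel (fst z) (snd z)) + ennreal ?B \<partial>(m \<Otimes>\<^sub>M m))"
  proof (rule nn_integral_mono)
    fix z :: "real \<times> real"
    let ?k = "((fst z)\<^sup>2 + (snd z)\<^sup>2) / 4 - ?B"
    have "ennreal ((fst z)\<^sup>2 / 4) \<le> ennreal (max 0 ?k + ?B)" 
    proof (rule ennreal_leI)
      have "(fst z)\<^sup>2 / 4 \<le> ?k + ?B" by (simp add: add_divide_distrib)
      then show "(fst z)\<^sup>2 / 4 \<le> max 0 ?k + ?B" using max.cobounded2[of ?k 0] by linarith
    qed
    also have "\<dots> = ennreal (max 0 ?k) + ennreal ?B" by (intro ennreal_plus) auto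
    also have "ennreal (max 0 ?k) = ennreal ?k" by (auto simp: max_def ennreal_neg)
    also have "ennreal ?k \<le> e2ennreal (energy_kernel (fst z) (snd z))"
      using e2ennreal_mono[OF energy_kernel_coercive[of "fst z" "snd z"]] by simp
    finally show "ennreal ((fst z)\<^sup>2 / 4) \<le> e2ennreal (energy_kernel (fst z) (snd z)) + ennreal ?B" by simp
  qed
  also have "\<dots> \<le> (\<integral>\<^sup>+z. e2ennreal (energy_kernel (fst z) (snd z)) \<partial>(m \<Otimes>\<^sub>M m)) + (\<integral>\<^sup>+z. ennreal ?B \<partial>(m \<Otimes>\<^sub>M m))"
    by (subst nn_integral_add) (auto simp: energy_kernel_def logk_def[abs_def] Qd_def[abs_def])
  also have "\<dots> < \<infinity>" using False P.emeasure_space_1 by (simp add: less_top[symmetric])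
  finally have "integrable m (\<lambda>x. x\<^sup>2 / 4)" by (intro integrableI_nonneg) auto
  from Bochner_Integration.integrable_add[OF m.integrable_const[of 1] integrable_mult_right[OF this, of 4]]
  have "integrable m (\<lambda>x. 1 + x\<^sup>2)" by simp
  then have i: "integrable m (\<lambda>x. x)"
  proof (rule Bochner_Integration.integrable_bound)
    have "\<bar>x\<bar> \<le> 1 + x\<^sup>2" for x :: real using sum_squares_bound[of "\<bar>x\<bar>" 1] by simp
    then show "AE x in m. norm x \<le> norm (1 + x\<^sup>2)" by simp
  qed measurable
  have "ereal (Estar - \<beta> * (gapc * \<epsilon>)) \<le> energy \<beta> c m" if "0 < \<epsilon>" for \<epsilon>
  proof -
    have "0 \<le> log_energy \<epsilon> m (nu_eq \<beta> c)"
      by (rule log_energy_nonneg[OF assms(1) prob_space_nu_eq s sets_nu_eq i integrable_nu_eq_id that])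
    then have "0 \<le> \<beta> / 2 * log_energy \<epsilon> m (nu_eq \<beta> c)" using \<beta> by simp
    then have "ereal (Estar - \<beta> * (gapc * \<epsilon>)) \<le> ereal (\<integral>z. lin_kernel \<epsilon> (fst z) (snd z) \<partial>(m \<Otimes>\<^sub>M m))"
      using lin_kernel_integral(2)[OF assms i that] by simp
    also have "\<dots> \<le> energy \<beta> c m"
      unfolding energy_eq by (rule real_integral_le_eint[OF lin_kernel_integral(1)[OF assms i that]]) (rule lin_kernel_le[OF that])
    finally show ?thesis .
  qed
  then have ev: "\<forall>\<^sub>F \<epsilon> in at_right 0. ereal (Estar - \<beta> * (gapc * \<epsilon>)) \<le> energy \<beta> c m"
    by (auto simp: eventually_at_right_less intro: eventually_mono[OF eventually_at_right_less])
  have "((\<lambda>\<epsilon>. ereal (Estar - \<beta> * (gapc * \<epsilon>))) \<longlongrightarrow> ereal (Estar - \<beta> * (gapc * 0))) (at_right 0)"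
    by (intro tendsto_intros)
  from tendsto_upperbound[OF this ev] show ?thesis by simp
qed

lemma log_pair_integrable_nu_eq:
  "integrable (nu_eq \<beta> c \<Otimes>\<^sub>M nu_eq \<beta> c) (\<lambda>z. - ln \<bar>fst z - snd z\<bar>)"
  "(\<integral>z. - ln \<bar>fst z - snd z\<bar> \<partial>(nu_eq \<beta> c \<Otimes>\<^sub>M nu_eq \<beta> c)) = (\<integral>t. nu_pot t \<partial>nu_eq \<beta> c)"
proof -
  let ?N = "nu_eq \<beta> c"
  interpret N: prob_space ?N by (rule prob_space_nu_eq)
  interpret P: pair_prob_space ?N ?N ..
  let ?g = "\<lambda>z. - ln \<bar>fst z - snd z\<bar> - Lk 1 (fst z - snd z)"
  have ae: "AE z in ?N \<Otimes>\<^sub>M ?N. fst z \<noteq> snd z"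
  proof (rule P.AE_pair_measure)
    have "AE y in ?N. fst (x, y) \<noteq> snd (x, y)" for x
      using AE_nu_eq_neq[of x] by eventually_elim auto
    then show "AE x in ?N. AE y in ?N. fst (x, y) \<noteq> snd (x, y)" by simp
  qed measurable
  have nn: "AE z in ?N \<Otimes>\<^sub>M ?N. 0 \<le> ?g z" using ae by eventually_elim (use Lk_le_log[of 1] in auto)
  have "(\<integral>\<^sup>+z. ennreal (?g z) \<partial>(?N \<Otimes>\<^sub>M ?N)) = (\<integral>\<^sup>+x. \<integral>\<^sup>+y. ennreal (- ln \<bar>x - y\<bar> - Lk 1 (x - y)) \<partial>?N \<partial>?N)"
    by (subst N.nn_integral_fst[symmetric]) auto
  also have "\<dots> \<le> (\<integral>\<^sup>+x. ennreal (2 * edge_b \<beta> c / (pi * \<beta>)) * ennreal 2 \<partial>?N)"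
  proof (rule nn_integral_mono)
    fix x :: real
    have "(\<integral>\<^sup>+y. ennreal (- ln \<bar>x - y\<bar> - Lk 1 (x - y)) \<partial>?N) \<le> ennreal (2 * edge_b \<beta> c / (pi * \<beta>)) * (\<integral>\<^sup>+y. ennreal (- ln \<bar>x - y\<bar> - Lk 1 (x - y)) \<partial>lborel)"
      by (rule nn_integral_nu_eq_le) measurable
    also have "\<dots> \<le> ennreal (2 * edge_b \<beta> c / (pi * \<beta>)) * ennreal 2"
      using nn_integral_log_gap[of 1 x] by (intro mult_left_mono) auto
    finally show "(\<integral>\<^sup>+y. ennreal (- ln \<bar>x - y\<bar> - Lk 1 (x - y)) \<partial>?N) \<le> ennreal (2 * edge_b \<beta> c / (pi * \<beta>)) * ennreal 2" .
  qed
  also have "\<dots> < \<infinity>" using N.emeasure_space_1 by (simp add: ennreal_mult_less_top)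
  finally have fin: "(\<integral>\<^sup>+z. ennreal (?g z) \<partial>(?N \<Otimes>\<^sub>M ?N)) < \<infinity>" .
  have ig: "integrable (?N \<Otimes>\<^sub>M ?N) ?g" by (rule integrableI_nonneg[OF _ nn fin]) measurable
  have iL: "integrable (?N \<Otimes>\<^sub>M ?N) (\<lambda>z. Lk 1 (fst z - snd z))"
    by (rule integrable_Lk_pair[OF prob_space_nu_eq prob_space_nu_eq sets_nu_eq sets_nu_eq integrable_nu_eq_id integrable_nu_eq_id]) simp
  from Bochner_Integration.integrable_add[OF ig iL]
  show i: "integrable (?N \<Otimes>\<^sub>M ?N) (\<lambda>z. - ln \<bar>fst z - snd z\<bar>)" by simp
  show "(\<integral>z. - ln \<bar>fst z - snd z\<bar> \<partial>(?N \<Otimes>\<^sub>M ?N)) = (\<integral>t. nu_pot t \<partial>?N)"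
    using P.integral_fst'[OF i] by (simp add: nu_pot_def)
qed

lemma energy_nu_eq: "energy \<beta> c (nu_eq \<beta> c) = ereal Estar"
proof -
  let ?N = "nu_eq \<beta> c" and ?Q = "\<lambda>t. t\<^sup>2 - 2 * c * ln \<bar>t\<bar>"
  interpret N: prob_space ?N by (rule prob_space_nu_eq)
  interpret P: pair_prob_space ?N ?N ..
  let ?k = "\<lambda>z. - (\<beta> / 2 * ln \<bar>fst z - snd z\<bar>) + ?Q (fst z) / 2 + ?Q (snd z) / 2"
  have iQ: "integrable ?N ?Q" using second_moment(1) log_moment(1) by simp
  note f = integral_pair_fst[OF prob_space_nu_eq prob_space_nu_eq iQ]
  note g = integral_pair_snd[OF prob_space_nu_eq prob_space_nu_eq iQ]
  have "integrable (?N \<Otimes>\<^sub>M ?N) (\<lambda>z. \<beta> / 2 * (- ln \<bar>fst z - snd z\<bar>))"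
    by (rule integrable_mult_right[OF log_pair_integrable_nu_eq(1)])
  then have i0: "integrable (?N \<Otimes>\<^sub>M ?N) (\<lambda>z. - (\<beta> / 2 * ln \<bar>fst z - snd z\<bar>))" by simp
  have ik: "integrable (?N \<Otimes>\<^sub>M ?N) ?k"
    using i0 f(1) g(1) by (intro Bochner_Integration.integrable_add integrable_divide_zero) auto
  have "(\<integral>z. - (\<beta> / 2 * ln \<bar>fst z - snd z\<bar>) \<partial>(?N \<Otimes>\<^sub>M ?N)) = (\<integral>z. \<beta> / 2 * (- ln \<bar>fst z - snd z\<bar>) \<partial>(?N \<Otimes>\<^sub>M ?N))" by simp
  also have "\<dots> = \<beta> / 2 * (\<integral>t. nu_pot t \<partial>?N)"
    unfolding log_pair_integrable_nu_eq(2)[symmetric] by (rule integral_mult_right_zero)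
  finally have e0: "(\<integral>z. - (\<beta> / 2 * ln \<bar>fst z - snd z\<bar>) \<partial>(?N \<Otimes>\<^sub>M ?N)) = ell - Estar" unfolding nu_pot_integral(2) .
  have "(\<integral>z. ?k z \<partial>(?N \<Otimes>\<^sub>M ?N)) = (ell - Estar) + (\<integral>t. ?Q t \<partial>?N) / 2 + (\<integral>t. ?Q t \<partial>?N) / 2"
    unfolding e0[symmetric] f(2)[symmetric] 
    by (subst Bochner_Integration.integral_add, (use i0 f(1) g(1) in \<open>intro Bochner_Integration.integrable_add integrable_divide_zero; simp\<close>)+)
       (use i0 f g in \<open>subst Bochner_Integration.integral_add; simp\<close>)
  also have "\<dots> = Estar" by (simp add: Estar_def add_divide_distrib)
  finally have e: "(\<integral>z. ?k z \<partial>(?N \<Otimes>\<^sub>M ?N)) = Estar" .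
  have "AE z in ?N \<Otimes>\<^sub>M ?N. fst z \<noteq> snd z \<and> fst z \<noteq> 0 \<and> snd z \<noteq> 0"
  proof (rule P.AE_pair_measure)
    show "AE x in ?N. AE y in ?N. fst (x, y) \<noteq> snd (x, y) \<and> fst (x, y) \<noteq> 0 \<and> snd (x, y) \<noteq> 0"
      using AE_nu_eq_neq[of 0]
    proof eventually_elim
      case (elim x)
      show ?case using AE_nu_eq_neq[of 0] AE_nu_eq_neq[of x] by eventually_elim (use elim in auto)
    qed
  qed measurable
  then have "AE z in ?N \<Otimes>\<^sub>M ?N. energy_kernel (fst z) (snd z) = ereal (?k z)"
    by eventually_elim (auto simp: energy_kernel_real)
  from eint_AE_real[OF ik this] show ?thesis unfolding energy_eq e .
qed

lemma energy_star_eq: "energy_star \<beta> c = ereal Estar"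
  unfolding energy_star_def
proof (rule antisym)
  show "(INF \<nu>\<in>{\<nu>. prob_space \<nu> \<and> sets \<nu> = sets borel}. energy \<beta> c \<nu>) \<le> ereal Estar"
    unfolding energy_nu_eq[symmetric] by (rule INF_lower) (use prob_space_nu_eq sets_nu_eq in simp)
  show "ereal Estar \<le> (INF \<nu>\<in>{\<nu>. prob_space \<nu> \<and> sets \<nu> = sets borel}. energy \<beta> c \<nu>)"
    by (rule INF_greatest) (use energy_ge_Estar in auto)
qed

end

section \<open>The particle system\<close>

definition emp :: "nat \<Rightarrow> (nat \<Rightarrow> real) \<Rightarrow> real measure" where
  "emp n l = distr (uniform_count_measure {..<n}) borel l"

lemma sets_emp [simp, measurable_cong]: "sets (emp n l) = sets borel"
  by (simp add: emp_def)

lemma measurable_uniform_count: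
  "range f \<subseteq> space N \<Longrightarrow> f \<in> measurable (uniform_count_measure A) N"
  by (rule measurableI) (auto simp: sets_uniform_count_measure space_uniform_count_measure)

lemma prob_space_emp:
  assumes "0 < n"
  shows "prob_space (emp n l)"
proof -
  have "prob_space (uniform_count_measure {..<n})" using assms by (intro prob_space_uniform_count_measure) auto
  then show ?thesis unfolding emp_def by (rule prob_space.prob_space_distr) (rule measurable_uniform_count, simp)
qed

lemma integral_emp:
  fixes f :: "real \<Rightarrow> real"
  assumes [measurable]: "f \<in> borel_measurable borel"
  shows "integrable (emp n l) f" "(\<integral>x. f x \<partial>emp n l) = (\<Sum>i<n. f (l i)) / n"
proof -
  have m: "l \<in> measurable (uniform_count_measure {..<n}) borel" by (rule measurable_uniform_count) simp
  have "integrable (uniform_count_measure {..<n}) (\<lambda>i. f (l i))"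
    unfolding uniform_count_measure_def by (rule integrable_point_measure_finite) simp
  then show "integrable (emp n l) f"
    unfolding emp_def using integrable_distr_eq[OF m assms] by blast
  show "(\<integral>x. f x \<partial>emp n l) = (\<Sum>i<n. f (l i)) / n"
    unfolding emp_def integral_distr[OF m assms] by (subst integral_uniform_count_measure) simp_all
qed

lemma measure_emp:
  assumes [measurable]: "A \<in> sets borel"
  shows "measure (emp n l) A = card {i\<in>{..<n}. l i \<in> A} / n"
proof -
  have m: "l \<in> measurable (uniform_count_measure {..<n}) borel" by (rule measurable_uniform_count) simp
  have eq: "l -` A \<inter> {..<n} = {i\<in>{..<n}. l i \<in> A}" by auto
  have sub: "{i\<in>{..<n}. l i \<in> A} \<subseteq> {..<n}" by auto
  show ?thesis
    unfolding emp_def measure_distr[OF m assms] space_uniform_count_measure eq measure_uniform_count_measure[OF finite_lessThan sub]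
    by simp
qed

text \<open>The diagonal terms i = j are part of the sum; with the truncated kernel each equals the
  finite number 1 - ln \<epsilon>.\<close>

lemma log_pair_emp:
  assumes "0 < n" "0 < \<epsilon>"
  shows "log_pair \<epsilon> (emp n l) (emp n l) = (\<Sum>i<n. \<Sum>j<n. Lk \<epsilon> (l i - l j)) / (real n)\<^sup>2"
proof -
  interpret m: prob_space "emp n l" using assms(1) by (rule prob_space_emp)
  interpret P: pair_prob_space "emp n l" "emp n l" ..
  have i: "integrable (emp n l \<Otimes>\<^sub>M emp n l) (\<lambda>z. Lk \<epsilon> (fst z - snd z))"
    using assms by (intro integrable_Lk_pair prob_space_emp sets_emp integral_emp) auto
  have "log_pair \<epsilon> (emp n l) (emp n l) = (\<integral>x. (\<integral>y. Lk \<epsilon> (x - y) \<partial>emp n l) \<partial>emp n l)"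
    unfolding log_pair_def using P.integral_fst'[OF i] by simp
  also have "\<dots> = (\<integral>x. (\<Sum>j<n. Lk \<epsilon> (x - l j)) / n \<partial>emp n l)" by (subst integral_emp(2)) auto
  also have "\<dots> = (\<Sum>i<n. (\<Sum>j<n. Lk \<epsilon> (l i - l j)) / n) / n" by (subst integral_emp(2)) auto
  finally show ?thesis by (simp add: sum_divide_distrib power2_eq_square)
qed

abbreviation pairs :: "nat \<Rightarrow> (nat \<times> nat) set" where
  "pairs n \<equiv> {(i, j). i < j \<and> j < n}"

lemma finite_pairs: "finite (pairs n)"
  by (rule finite_subset[of _ "{..<n} \<times> {..<n}"]) auto

lemma pairs_Suc: "pairs (Suc n) = pairs n \<union> (\<lambda>i. (i, n)) ` {..<n}" "pairs n \<inter> (\<lambda>i. (i, n)) ` {..<n} = {}"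
  by auto

lemma sum_pairs_Suc: "(\<Sum>p\<in>pairs (Suc n). F p) = (\<Sum>p\<in>pairs n. F p) + (\<Sum>i<n. F (i, n) :: real)"
  unfolding pairs_Suc(1)
  by (subst sum.union_disjoint[OF finite_pairs _ pairs_Suc(2)]) (auto simp: sum.reindex inj_on_def)

lemma sum_square_pairs:
  fixes F :: "nat \<Rightarrow> nat \<Rightarrow> real"
  assumes "\<And>i j. F i j = F j i"
  shows "(\<Sum>i<n. \<Sum>j<n. F i j) = (\<Sum>i<n. F i i) + 2 * (\<Sum>p\<in>pairs n. F (fst p) (snd p))"
proof (induction n)
  case (Suc n)
  have "(\<Sum>j<n. F n j) = (\<Sum>i<n. F i n)" using assms by (intro sum.cong) auto
  then show ?case using Suc unfolding sum_pairs_Suc by (simp add: sum.distrib)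
qed simp

lemma card_pairs: "2 * real (card (pairs n)) = real n * (real n - 1)"
  using sum_square_pairs[of "\<lambda>_ _. 1" n] by (simp add: algebra_simps)

section \<open>The joint density and its upper bound\<close>

definition log_weight :: "real \<Rightarrow> real \<Rightarrow> nat \<Rightarrow> (nat \<Rightarrow> real) \<Rightarrow> real" where
  "log_weight \<beta> c n l = \<beta> * (\<Sum>p\<in>pairs n. ln \<bar>l (fst p) - l (snd p)\<bar>) - n * (\<Sum>i<n. (l i)\<^sup>2 - 2 * c * ln \<bar>l i\<bar>)"

text \<open>On all other configurations the weight is 0, whereas \<open>log_weight\<close> takes a
  meaningless finite value because \<open>ln 0 = 0\<close>. For c = 0 a vanishing coordinate is
  harmless, since \<open>abs_pow 0 0 = 1\<close>.\<close>

definition generic :: "real \<Rightarrow> nat \<Rightarrow> (nat \<Rightarrow> real) \<Rightarrow> bool" where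
  "generic c n l \<longleftrightarrow> (\<forall>i<n. c = 0 \<or> l i \<noteq> 0) \<and> (\<forall>p\<in>pairs n. l (fst p) \<noteq> l (snd p))"

context log_gas
begin

lemma abs_pow_exp: "p = 0 \<or> x \<noteq> 0 \<Longrightarrow> abs_pow x p = exp (p * ln \<bar>x\<bar>)"
  by (auto simp: abs_pow_def powr_def)

lemma weight_generic:
  assumes "generic c n l"
  shows "weight \<beta> n (n * c) l = exp (log_weight \<beta> c n l)"
proof -
  have "(\<Prod>i<n. abs_pow (l i) (2 * (n * c))) = (\<Prod>i<n. exp (2 * (n * c) * ln \<bar>l i\<bar>))"
    using assms by (intro prod.cong refl abs_pow_exp) (auto simp: generic_def)
  also have "\<dots> = exp (\<Sum>i<n. 2 * (n * c) * ln \<bar>l i\<bar>)" by (rule exp_sum[symmetric]) simp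
  finally have 1: "(\<Prod>i<n. abs_pow (l i) (2 * (n * c))) = exp (\<Sum>i<n. 2 * (n * c) * ln \<bar>l i\<bar>)" .
  have "(\<Prod>p\<in>pairs n. abs_pow (l (fst p) - l (snd p)) \<beta>) = (\<Prod>p\<in>pairs n. exp (\<beta> * ln \<bar>l (fst p) - l (snd p)\<bar>))"
    using assms by (intro prod.cong refl abs_pow_exp) (auto simp: generic_def)
  also have "\<dots> = exp (\<Sum>p\<in>pairs n. \<beta> * ln \<bar>l (fst p) - l (snd p)\<bar>)" by (rule exp_sum[symmetric, OF finite_pairs])
  finally have 2: "(\<Prod>p\<in>pairs n. abs_pow (l (fst p) - l (snd p)) \<beta>) = exp (\<Sum>p\<in>pairs n. \<beta> * ln \<bar>l (fst p) - l (snd p)\<bar>)" .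
  have "log_weight \<beta> c n l = - real n * (\<Sum>i<n. (l i)\<^sup>2) + (\<Sum>i<n. 2 * (n * c) * ln \<bar>l i\<bar>) + (\<Sum>p\<in>pairs n. \<beta> * ln \<bar>l (fst p) - l (snd p)\<bar>)"
  proof -
    have "real n * (\<Sum>i<n. 2 * c * ln \<bar>l i\<bar>) = (\<Sum>i<n. 2 * (n * c) * ln \<bar>l i\<bar>)"
      by (simp add: sum_distrib_left mult_ac)
    moreover have "\<beta> * (\<Sum>p\<in>pairs n. ln \<bar>l (fst p) - l (snd p)\<bar>) = (\<Sum>p\<in>pairs n. \<beta> * ln \<bar>l (fst p) - l (snd p)\<bar>)"
      by (rule sum_distrib_left)
    ultimately show ?thesis unfolding log_weight_def sum_subtractf right_diff_distrib by linarith
  qed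
  then show ?thesis unfolding weight_def 1 2 by (simp only: exp_add)
qed

lemma weight_not_generic:
  assumes "\<not> generic c n l"
  shows "weight \<beta> n (n * c) l = 0"
proof -
  consider i where "i < n" "c \<noteq> 0" "l i = 0" | p where "p \<in> pairs n" "l (fst p) = l (snd p)"
    using assms unfolding generic_def by blast
  then show ?thesis
  proof cases
    case 1
    then have "abs_pow (l i) (2 * (n * c)) = 0" by (simp add: abs_pow_def)
    then have "\<exists>i\<in>{..<n}. abs_pow (l i) (2 * (n * c)) = 0" using \<open>i < n\<close> by blast
    then have "(\<Prod>i<n. abs_pow (l i) (2 * (n * c))) = 0" by (rule prod_zero[OF finite_lessThan])
    then show ?thesis by (simp add: weight_def)
  next
    case 2
    then have "abs_pow (l (fst p) - l (snd p)) \<beta> = 0" using \<beta> by (simp add: abs_pow_def)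
    then have "(\<Prod>p\<in>pairs n. abs_pow (l (fst p) - l (snd p)) \<beta>) = 0" 
      using 2(1) by (intro prod_zero[OF finite_pairs]) blast
    then show ?thesis by (simp add: weight_def)
  qed
qed

text \<open>The slack in the variational inequality. Keeping it in the upper bound for the density
  is what makes that bound integrable over all particle positions.\<close>

definition "excess x = \<beta> * nu_pot x + x\<^sup>2 - 2 * c * ln \<bar>x\<bar> - ell"

lemma excess_measurable [measurable]: "excess \<in> borel_measurable borel"
  unfolding excess_def[abs_def] by measurable

definition "excessc = (\<beta> + 2 * c)\<^sup>2 / 2 + \<beta> * edge_b \<beta> c + ell"

lemma nu_pot_ge: "- \<bar>x\<bar> - edge_b \<beta> c \<le> nu_pot x"
proof -
  interpret N: prob_space "nu_eq \<beta> c" by (rule prob_space_nu_eq)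
  have ln: "ln \<bar>x\<bar> \<le> \<bar>x\<bar>" for x :: real by (cases "x = 0") (use ln_bound[of "\<bar>x\<bar>"] in auto)
  have "(\<integral>t. - \<bar>x\<bar> - edge_b \<beta> c \<partial>nu_eq \<beta> c) \<le> nu_pot x"
    unfolding nu_pot_def
  proof (rule integral_mono_AE)
    show "AE t in nu_eq \<beta> c. - \<bar>x\<bar> - edge_b \<beta> c \<le> - ln \<bar>x - t\<bar>"
      using AE_nu_eq_support
    proof eventually_elim
      case (elim t)
      then show ?case using ln[of "x - t"] by linarith
    qed
  qed (use nu_pot_approx(1)[of 1 x] in auto)
  then show ?thesis using N.prob_space by simp
qed

text \<open>The potential is at least -|x| - b and the logarithm is at most |x|; half of x^2 absorbs
  the resulting linear term (\<beta> + 2 c) |x|.\<close>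

lemma excess_ge: "x\<^sup>2 / 2 - excessc \<le> excess x"
proof -
  have ln: "ln \<bar>x\<bar> \<le> \<bar>x\<bar>" for x :: real by (cases "x = 0") (use ln_bound[of "\<bar>x\<bar>"] in auto)
  have "\<beta> * (- \<bar>x\<bar> - edge_b \<beta> c) \<le> \<beta> * nu_pot x" using nu_pot_ge \<beta> by (intro mult_left_mono) auto
  then have "- (\<beta> * \<bar>x\<bar>) - \<beta> * edge_b \<beta> c \<le> \<beta> * nu_pot x" by (simp add: right_diff_distrib)
  moreover have "c * ln \<bar>x\<bar> \<le> c * \<bar>x\<bar>" using ln c by (intro mult_left_mono)
  moreover have "B * \<bar>x\<bar> \<le> x\<^sup>2 / 2 + B\<^sup>2 / 2" for B using sum_squares_bound[of B "\<bar>x\<bar>"] by simp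
  then have "(\<beta> + 2 * c) * \<bar>x\<bar> \<le> x\<^sup>2 / 2 + (\<beta> + 2 * c)\<^sup>2 / 2" .
  then have "\<beta> * \<bar>x\<bar> + 2 * (c * \<bar>x\<bar>) \<le> x\<^sup>2 / 2 + (\<beta> + 2 * c)\<^sup>2 / 2" by (simp add: distrib_right)
  ultimately show ?thesis unfolding excess_def excessc_def by linarith
qed

text \<open>The linearised energy inequality at the empirical measure. The diagonal, absent from the
  sum over pairs, costs \<beta>/2 n (1 - ln \<epsilon>), and truncating the potential costs n^2
  \<beta> \<open>gapc\<close> \<epsilon>. The excesses remain as a sum over single
  particles.\<close>

lemma log_weight_le:
  assumes n: "0 < n" and \<epsilon>: "0 < \<epsilon>" and g: "generic c n l"
  shows "log_weight \<beta> c n l \<le> - (real n)\<^sup>2 * (Estar + \<beta> / 2 * log_energy \<epsilon> (emp n l) (nu_eq \<beta> c) - \<beta> * (gapc * \<epsilon>))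
      + \<beta> / 2 * real n * (1 - ln \<epsilon>) - n * (\<Sum>i<n. excess (l i))"
proof -
  define N where "N = real n"
  have N: "0 < N" using n by (simp add: N_def)
  define SL where "SL = (\<Sum>i<n. \<Sum>j<n. Lk \<epsilon> (l i - l j))"
  define SU where "SU = (\<Sum>i<n. nu_potL \<epsilon> (l i))"
  define SE where "SE = (\<Sum>i<n. excess (l i))"
  define SP where "SP = (\<Sum>p\<in>pairs n. ln \<bar>l (fst p) - l (snd p)\<bar>)"
  define SQ where "SQ = (\<Sum>i<n. (l i)\<^sup>2 - 2 * c * ln \<bar>l i\<bar>)"
  have "SL = (\<Sum>i<n. Lk \<epsilon> (l i - l i)) + 2 * (\<Sum>p\<in>pairs n. Lk \<epsilon> (l (fst p) - l (snd p)))"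
    unfolding SL_def by (rule sum_square_pairs) (rule Lk_minus)
  then have "SL = N * (1 - ln \<epsilon>) + 2 * (\<Sum>p\<in>pairs n. Lk \<epsilon> (l (fst p) - l (snd p)))" using Lk_0[OF \<epsilon>] by (simp add: N_def)
  moreover have "(\<Sum>p\<in>pairs n. Lk \<epsilon> (l (fst p) - l (snd p))) \<le> (\<Sum>p\<in>pairs n. - ln \<bar>l (fst p) - l (snd p)\<bar>)"
    using g by (intro sum_mono Lk_le_log \<epsilon>) (auto simp: generic_def)
  ultimately have "2 * SP \<le> N * (1 - ln \<epsilon>) - SL" by (simp add: SP_def sum_negf)
  from mult_left_mono[OF this, of "\<beta> / 2"] have P: "\<beta> * SP \<le> \<beta> / 2 * N * (1 - ln \<epsilon>) - \<beta> / 2 * SL"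
    using \<beta> by (simp add: right_diff_distrib)
  have "(\<Sum>i<n. ell - \<beta> * nu_potL \<epsilon> (l i) - \<beta> * (gapc * \<epsilon>) + excess (l i)) \<le> SQ"
    unfolding SQ_def
  proof (rule sum_mono)
    fix i assume "i \<in> {..<n}"
    have "\<beta> * nu_pot (l i) \<le> \<beta> * (nu_potL \<epsilon> (l i) + gapc * \<epsilon>)"
      using nu_pot_approx(3)[OF \<epsilon>, of "l i"] \<beta> unfolding gapc_def by (intro mult_left_mono) auto
    then show "ell - \<beta> * nu_potL \<epsilon> (l i) - \<beta> * (gapc * \<epsilon>) + excess (l i) \<le> (l i)\<^sup>2 - 2 * c * ln \<bar>l i\<bar>"
      unfolding excess_def by (simp add: distrib_left)
  qed
  then have "N * ell - \<beta> * SU - N * (\<beta> * (gapc * \<epsilon>)) + SE \<le> SQ"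
    by (simp add: sum.distrib sum_subtractf SU_def SE_def N_def sum_distrib_left)
  from mult_left_mono[OF this, of N] have Q: "N\<^sup>2 * ell - \<beta> * N * SU - N\<^sup>2 * (\<beta> * (gapc * \<epsilon>)) + N * SE \<le> N * SQ"
    using N by (simp add: power2_eq_square algebra_simps)
  have lp: "log_pair \<epsilon> (emp n l) (emp n l) = SL / N\<^sup>2" using log_pair_emp[OF n \<epsilon>] by (simp add: SL_def N_def)
  have lu: "log_pair \<epsilon> (emp n l) (nu_eq \<beta> c) = SU / N"
    using log_pair_nu_eq(2)[OF prob_space_emp[OF n] sets_emp integral_emp(1) \<epsilon>, of l] integral_emp(2)[of "nu_potL \<epsilon>" n l]
    by (simp add: SU_def N_def)
  have "N\<^sup>2 * log_energy \<epsilon> (emp n l) (nu_eq \<beta> c) = SL - 2 * N * SU + N\<^sup>2 * log_pair \<epsilon> (nu_eq \<beta> c) (nu_eq \<beta> c)"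
    unfolding log_energy_def lp lu using N by (simp add: algebra_simps power2_eq_square)
  then have "\<beta> / 2 * (N\<^sup>2 * log_energy \<epsilon> (emp n l) (nu_eq \<beta> c)) = \<beta> / 2 * (SL - 2 * N * SU + N\<^sup>2 * log_pair \<epsilon> (nu_eq \<beta> c) (nu_eq \<beta> c))"
    by simp
  then have D: "N\<^sup>2 * (\<beta> / 2 * log_energy \<epsilon> (emp n l) (nu_eq \<beta> c)) = \<beta> / 2 * SL - \<beta> * N * SU + N\<^sup>2 * (\<beta> / 2 * log_pair \<epsilon> (nu_eq \<beta> c) (nu_eq \<beta> c))"
    by (simp add: algebra_simps)
  have "N\<^sup>2 * (\<beta> / 2 * log_pair \<epsilon> (nu_eq \<beta> c) (nu_eq \<beta> c)) \<le> N\<^sup>2 * (ell - Estar)"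
    using log_pair_nu_eq_le[OF \<epsilon>] by (intro mult_left_mono) auto
  then have E: "N\<^sup>2 * (\<beta> / 2 * log_pair \<epsilon> (nu_eq \<beta> c) (nu_eq \<beta> c)) \<le> N\<^sup>2 * ell - N\<^sup>2 * Estar" by (simp add: right_diff_distrib)
  have "log_weight \<beta> c n l = \<beta> * SP - N * SQ" by (simp add: log_weight_def SP_def SQ_def N_def)
  also have "\<dots> \<le> \<beta> / 2 * N * (1 - ln \<epsilon>) - N\<^sup>2 * Estar - N\<^sup>2 * (\<beta> / 2 * log_energy \<epsilon> (emp n l) (nu_eq \<beta> c)) + N\<^sup>2 * (\<beta> * (gapc * \<epsilon>)) - N * SE"
    using P Q D E by linarith
  also have "\<dots> = - N\<^sup>2 * (Estar + \<beta> / 2 * log_energy \<epsilon> (emp n l) (nu_eq \<beta> c) - \<beta> * (gapc * \<epsilon>)) + \<beta> / 2 * N * (1 - ln \<epsilon>) - N * SE"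
    by (simp add: algebra_simps)
  finally show ?thesis by (simp add: N_def SE_def)
qed

definition "tailc = exp excessc * sqrt (2 * pi)"

text \<open>Away from 0 the excess is nonnegative, so for n \<ge> 1 the exponential decreases when n
  replaces 1; the case n = 1 is below a Gaussian of total mass \<open>tailc\<close>. Hence the bound
  does not depend on n.\<close>

lemma nn_integral_excess_le:
  assumes "1 \<le> n"
  shows "(\<integral>\<^sup>+x. ennreal (exp (- real n * excess x)) \<partial>lborel) \<le> ennreal tailc"
proof -
  have "(\<integral>\<^sup>+x. ennreal (exp (- real n * excess x)) \<partial>lborel) \<le> (\<integral>\<^sup>+x. ennreal tailc * ennreal (normal_density 0 1 x) \<partial>lborel)"
  proof (rule nn_integral_mono_AE)
    show "AE x in lborel. ennreal (exp (- real n * excess x)) \<le> ennreal tailc * ennreal (normal_density 0 1 x)"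
      using AE_lborel_neq[of 0]
    proof eventually_elim
      case (elim x)
      have "0 \<le> excess x" using effective_potential_ge[of x] elim by (simp add: excess_def)
      from mult_right_mono[OF _ this, of 1 "real n"] have "- real n * excess x \<le> - excess x" using assms by simp
      also have "- excess x \<le> excessc - x\<^sup>2 / 2" using excess_ge[of x] by simp
      finally have "exp (- real n * excess x) \<le> exp (excessc - x\<^sup>2 / 2)" by simp
      also have "\<dots> = tailc * normal_density 0 1 x"
      proof -
        have "normal_density 0 1 x = 1 / sqrt (2 * pi) * exp (- (x\<^sup>2 / 2))" by (simp add: normal_density_def)
        moreover have "exp (excessc - x\<^sup>2 / 2) = exp excessc * exp (- (x\<^sup>2 / 2))" unfolding exp_add[symmetric] by simp
        ultimately show ?thesis by (simp add: tailc_def)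
      qed
      finally show ?case by (simp add: ennreal_mult[symmetric] tailc_def ennreal_leI)
    qed
  qed
  also have "\<dots> = ennreal tailc * (\<integral>\<^sup>+x. ennreal (normal_density 0 1 x) \<partial>lborel)"
    by (rule nn_integral_cmult) simp
  also have "(\<integral>\<^sup>+x. ennreal (normal_density 0 1 x) \<partial>lborel) = 1"
    using prob_space.emeasure_space_1[OF prob_space_normal_density[of 1 0]] by (simp add: emeasure_density)
  finally show ?thesis by simp
qed

lemma weight_nonneg: "0 \<le> weight \<beta> n m l"
  unfolding weight_def abs_pow_def by (intro mult_nonneg_nonneg prod_nonneg) auto

text \<open>The pointwise bound is a constant times a product over particles, so the integral over
  all n positions is at most that constant times \<open>tailc\<close> to the power n.\<close>

lemma nn_integral_weight_le:
  assumes n: "1 \<le> n" and \<epsilon>: "0 < \<epsilon>" 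
    and D: "\<And>l. l \<in> B \<Longrightarrow> d \<le> log_energy \<epsilon> (emp n l) (nu_eq \<beta> c)"
  shows "(\<integral>\<^sup>+l. ennreal (weight \<beta> n (n * c) l) * indicator B l \<partial>Lebn n)
    \<le> ennreal (exp (- (real n)\<^sup>2 * (Estar + \<beta> / 2 * d - \<beta> * (gapc * \<epsilon>)) + \<beta> / 2 * real n * (1 - ln \<epsilon>)) * tailc ^ n)"
proof -
  interpret L: product_sigma_finite "\<lambda>_::nat. lborel :: real measure" by standard
  let ?a = "- (real n)\<^sup>2 * (Estar + \<beta> / 2 * d - \<beta> * (gapc * \<epsilon>)) + \<beta> / 2 * real n * (1 - ln \<epsilon>)"
  have pw: "ennreal (weight \<beta> n (n * c) l) * indicator B l \<le> ennreal (exp ?a) * (\<Prod>i<n. ennreal (exp (- real n * excess (l i))))" for l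
  proof (cases "l \<in> B \<and> generic c n l")
    case True
    have "\<beta> / 2 * d \<le> \<beta> / 2 * log_energy \<epsilon> (emp n l) (nu_eq \<beta> c)" using D[of l] True \<beta> by (intro mult_left_mono) auto
    then have "(real n)\<^sup>2 * (Estar + \<beta> / 2 * d - \<beta> * (gapc * \<epsilon>)) \<le> (real n)\<^sup>2 * (Estar + \<beta> / 2 * log_energy \<epsilon> (emp n l) (nu_eq \<beta> c) - \<beta> * (gapc * \<epsilon>))"
      by (intro mult_left_mono) auto
    then have "log_weight \<beta> c n l \<le> ?a - n * (\<Sum>i<n. excess (l i))"
    proof -
      have "0 < n" using n by simp
      from log_weight_le[OF this \<epsilon> conjunct2[OF True]] show ?thesis
        using \<open>(real n)\<^sup>2 * (Estar + \<beta> / 2 * d - \<beta> * (gapc * \<epsilon>)) \<le> _\<close> unfolding mult_minus_left by linarith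
    qed
    also have "\<dots> = ?a + (\<Sum>i<n. - real n * excess (l i))" by (simp add: sum_distrib_left sum_negf)
    finally have "weight \<beta> n (n * c) l \<le> exp (?a + (\<Sum>i<n. - real n * excess (l i)))"
      using True by (simp add: weight_generic)
    also have "\<dots> = exp ?a * (\<Prod>i<n. exp (- real n * excess (l i)))" unfolding exp_add by (simp only: exp_sum[OF finite_lessThan])
    finally have "ennreal (weight \<beta> n (n * c) l) \<le> ennreal (exp ?a * (\<Prod>i<n. exp (- real n * excess (l i))))" by (rule ennreal_leI)
    also have "\<dots> = ennreal (exp ?a) * (\<Prod>i<n. ennreal (exp (- real n * excess (l i))))"
      by (subst ennreal_mult) (auto simp: prod_ennreal prod_nonneg)
    finally show ?thesis using True by simp
  next
    case False
    then show ?thesis by (auto simp: weight_not_generic indicator_def)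
  qed
  have "(\<integral>\<^sup>+l. ennreal (weight \<beta> n (n * c) l) * indicator B l \<partial>Lebn n)
     \<le> (\<integral>\<^sup>+l. ennreal (exp ?a) * (\<Prod>i<n. ennreal (exp (- real n * excess (l i)))) \<partial>Lebn n)"
    by (rule nn_integral_mono) (rule pw)
  also have "\<dots> = ennreal (exp ?a) * (\<integral>\<^sup>+l. (\<Prod>i<n. ennreal (exp (- real n * excess (l i)))) \<partial>Lebn n)"
    unfolding Lebn_def by (rule nn_integral_cmult) measurable
  also have "(\<integral>\<^sup>+l. (\<Prod>i<n. ennreal (exp (- real n * excess (l i)))) \<partial>Lebn n) = (\<Prod>i<n. \<integral>\<^sup>+x. ennreal (exp (- real n * excess x)) \<partial>lborel)"
    unfolding Lebn_def using L.product_nn_integral_prod[of "{..<n}" "\<lambda>_ x. ennreal (exp (- real n * excess x))"] by simp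
  also have "ennreal (exp ?a) * \<dots> \<le> ennreal (exp ?a) * (\<Prod>i<n. ennreal tailc)"
    using power_mono[OF nn_integral_excess_le[OF n], of n] by (intro mult_left_mono) simp_all
  also have "\<dots> = ennreal (exp ?a * tailc ^ n)"
    by (simp add: ennreal_mult[symmetric] ennreal_power tailc_def)
  finally show ?thesis .
qed

section \<open>Lower bound for the normalising constant\<close>

definition "densc = 2 * edge_b \<beta> c / (pi * \<beta>)"

text \<open>The pointwise bound on the equilibrium density, applied to one coordinate at a time;
  each coordinate contributes one factor \<open>densc\<close>.\<close>

lemma nn_integral_PiM_nu_eq_le:
  assumes "finite I" and "G \<in> borel_measurable (PiM I (\<lambda>_::nat. borel :: real measure))"
  shows "(\<integral>\<^sup>+l. G l \<partial>PiM I (\<lambda>_. nu_eq \<beta> c)) \<le> ennreal densc ^ card I * (\<integral>\<^sup>+l. G l \<partial>PiM I (\<lambda>_. lborel))"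
  using assms
proof (induction I arbitrary: G rule: finite_induct)
  case empty
  then show ?case by (simp add: PiM_empty)
next
  case (insert i I)
  interpret N: prob_space "nu_eq \<beta> c" by (rule prob_space_nu_eq)
  interpret P: product_prob_space "\<lambda>_::nat. nu_eq \<beta> c" by standard
  interpret L: product_sigma_finite "\<lambda>_::nat. lborel :: real measure" by standard
  have sN: "sets (PiM J (\<lambda>_::nat. nu_eq \<beta> c)) = sets (PiM J (\<lambda>_. borel))" for J by (rule sets_PiM_cong) auto
  have sL: "sets (PiM J (\<lambda>_::nat. lborel :: real measure)) = sets (PiM J (\<lambda>_. borel))" for J by (rule sets_PiM_cong) auto
  note G[measurable] = insert.prems
  have GN: "G \<in> borel_measurable (PiM (insert i I) (\<lambda>_. nu_eq \<beta> c))" using G by (simp add: measurable_cong_sets[OF sN refl])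
  have GL: "G \<in> borel_measurable (PiM (insert i I) (\<lambda>_. lborel))" using G by (simp add: measurable_cong_sets[OF sL refl])
  define H where "H x = (\<integral>\<^sup>+y. G (x(i := y)) \<partial>lborel)" for x
  have H: "H \<in> borel_measurable (PiM I (\<lambda>_. borel))" unfolding H_def[abs_def] by measurable
  have "(\<integral>\<^sup>+l. G l \<partial>PiM (insert i I) (\<lambda>_. nu_eq \<beta> c)) = (\<integral>\<^sup>+x. \<integral>\<^sup>+y. G (x(i := y)) \<partial>nu_eq \<beta> c \<partial>PiM I (\<lambda>_. nu_eq \<beta> c))"
    using insert.hyps GN by (rule P.product_nn_integral_insert)
  also have "\<dots> \<le> (\<integral>\<^sup>+x. ennreal densc * H x \<partial>PiM I (\<lambda>_. nu_eq \<beta> c))"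
  proof (rule nn_integral_mono)
    fix x :: "nat \<Rightarrow> real" assume "x \<in> space (PiM I (\<lambda>_. nu_eq \<beta> c))"
    then have x: "x \<in> space (PiM I (\<lambda>_. borel))" using sets_eq_imp_space_eq[OF sN[of I]] by simp
    have "(\<lambda>y. G (x(i := y))) \<in> borel_measurable borel" using x by measurable
    then show "(\<integral>\<^sup>+y. G (x(i := y)) \<partial>nu_eq \<beta> c) \<le> ennreal densc * H x"
      unfolding H_def densc_def by (rule nn_integral_nu_eq_le)
  qed
  also have "\<dots> = ennreal densc * (\<integral>\<^sup>+x. H x \<partial>PiM I (\<lambda>_. nu_eq \<beta> c))"
    by (rule nn_integral_cmult) (simp add: measurable_cong_sets[OF sN refl] H)
  also have "\<dots> \<le> ennreal densc * (ennreal densc ^ card I * (\<integral>\<^sup>+x. H x \<partial>PiM I (\<lambda>_. lborel)))"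
    by (rule mult_left_mono[OF insert.IH[OF H]]) simp
  also have "(\<integral>\<^sup>+x. H x \<partial>PiM I (\<lambda>_. lborel)) = (\<integral>\<^sup>+l. G l \<partial>PiM (insert i I) (\<lambda>_. lborel))"
    unfolding H_def using insert.hyps GL by (rule L.product_nn_integral_insert[symmetric])
  finally show ?case using insert.hyps by (simp add: mult_ac)
qed

lemma distr_PiM_pair:
  assumes "i \<in> I" "j \<in> I" "i \<noteq> (j :: nat)" "prob_space N"
  shows "distr (PiM I (\<lambda>_. N)) (N \<Otimes>\<^sub>M N) (\<lambda>l. (l i, l j)) = N \<Otimes>\<^sub>M N"
proof (rule pair_measure_eqI[symmetric])
  interpret N: prob_space N by fact
  interpret P: product_prob_space "\<lambda>_::nat. N" I by standard
  have m: "(\<lambda>l. (l i, l j)) \<in> measurable (PiM I (\<lambda>_. N)) (N \<Otimes>\<^sub>M N)" using assms by measurable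
  fix A B assume AB: "A \<in> sets N" "B \<in> sets N"
  have "(\<lambda>l. (l i, l j)) -` (A \<times> B) \<inter> space (PiM I (\<lambda>_. N)) = {l \<in> space (PiM I (\<lambda>_. N)). \<forall>k\<in>{i, j}. l k \<in> (if k = i then A else B)}"
    using assms by auto
  then have "emeasure (distr (PiM I (\<lambda>_. N)) (N \<Otimes>\<^sub>M N) (\<lambda>l. (l i, l j))) (A \<times> B)
     = emeasure (PiM I (\<lambda>_. N)) {l \<in> space (PiM I (\<lambda>_. N)). \<forall>k\<in>{i, j}. l k \<in> (if k = i then A else B)}"
    using AB by (simp add: emeasure_distr[OF m])
  also have "\<dots> = (\<Prod>k\<in>{i, j}. emeasure N (if k = i then A else B))"
    using assms AB by (intro P.emeasure_PiM_Collect) auto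
  also have "\<dots> = emeasure N A * emeasure N B" using assms by simp
  finally show "emeasure N A * emeasure N B = emeasure (distr (PiM I (\<lambda>_. N)) (N \<Otimes>\<^sub>M N) (\<lambda>l. (l i, l j))) (A \<times> B)" ..
qed (use prob_space_imp_sigma_finite[OF assms(4)] in auto)

definition "nu_prod n = PiM {..<n::nat} (\<lambda>_. nu_eq \<beta> c)"

text \<open>Each of the n (n - 1)/2 pairs contributes the same mean, and so does each particle in
  the external field. Were there n^2/2 pairs, the result would be -n^2 \<open>Estar\<close>; the n/2
  missing ones produce the correction n (\<open>ell - Estar\<close>).\<close>

lemma integral_log_weight:
  shows "integrable (nu_prod n) (log_weight \<beta> c n)"
    and "(\<integral>l. log_weight \<beta> c n l \<partial>nu_prod n) = - (real n)\<^sup>2 * Estar + real n * (ell - Estar)"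
    and "AE l in nu_prod n. generic c n l"
proof -
  let ?N = "nu_eq \<beta> c" and ?Q = "\<lambda>t. t\<^sup>2 - 2 * c * ln \<bar>t\<bar>"
  interpret N: prob_space ?N by (rule prob_space_nu_eq)
  interpret P: product_prob_space "\<lambda>_::nat. ?N" "{..<n}" by standard
  have iQ: "integrable ?N ?Q" using second_moment(1) log_moment(1) by simp
  have d1: "distr (nu_prod n) ?N (\<lambda>l. l i) = ?N" if "i < n" for i unfolding nu_prod_def using that by (intro P.PiM_component) auto
  have m1: "(\<lambda>l. l i) \<in> measurable (nu_prod n) ?N" if "i < n" for i
    unfolding nu_prod_def using that by (intro measurable_component_singleton) simp
  have Q1: "integrable (nu_prod n) (\<lambda>l. ?Q (l i))" "(\<integral>l. ?Q (l i) \<partial>nu_prod n) = (\<integral>t. ?Q t \<partial>?N)" if "i < n" for i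
    using integrable_distr_eq[OF m1[OF that], of ?Q] integral_distr[OF m1[OF that], of ?Q] iQ unfolding d1[OF that] by auto
  have pd: "fst p < n" "snd p < n" "fst p \<noteq> snd p" if "p \<in> pairs n" for p using that by auto
  have d2: "distr (nu_prod n) (?N \<Otimes>\<^sub>M ?N) (\<lambda>l. (l (fst p), l (snd p))) = ?N \<Otimes>\<^sub>M ?N" if "p \<in> pairs n" for p
    unfolding nu_prod_def using pd[OF that] by (intro distr_PiM_pair prob_space_nu_eq) auto
  have m2: "(\<lambda>l. (l (fst p), l (snd p))) \<in> measurable (nu_prod n) (?N \<Otimes>\<^sub>M ?N)" if "p \<in> pairs n" for p
    using m1[OF pd(1)[OF that]] m1[OF pd(2)[OF that]] by (rule measurable_Pair)
  let ?L = "\<lambda>z. - ln \<bar>fst z - snd z\<bar>"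
  have L1: "integrable (nu_prod n) (\<lambda>l. - ln \<bar>l (fst p) - l (snd p)\<bar>)" "(\<integral>l. - ln \<bar>l (fst p) - l (snd p)\<bar> \<partial>nu_prod n) = (\<integral>t. nu_pot t \<partial>?N)" if "p \<in> pairs n" for p
    using integrable_distr_eq[OF m2[OF that], of ?L] integral_distr[OF m2[OF that], of ?L] log_pair_integrable_nu_eq unfolding d2[OF that] by auto
  have L2: "integrable (nu_prod n) (\<lambda>l. ln \<bar>l (fst p) - l (snd p)\<bar>)" "(\<integral>l. ln \<bar>l (fst p) - l (snd p)\<bar> \<partial>nu_prod n) = - (\<integral>t. nu_pot t \<partial>?N)" if "p \<in> pairs n" for p
    using L1[OF that] by auto
  have iS: "integrable (nu_prod n) (\<lambda>l. \<Sum>p\<in>pairs n. ln \<bar>l (fst p) - l (snd p)\<bar>)" by (rule Bochner_Integration.integrable_sum) (rule L2)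
  have iT: "integrable (nu_prod n) (\<lambda>l. \<Sum>i<n. ?Q (l i))" by (rule Bochner_Integration.integrable_sum) (rule Q1, simp)
  show "integrable (nu_prod n) (log_weight \<beta> c n)" unfolding log_weight_def[abs_def]
    by (intro Bochner_Integration.integrable_diff integrable_mult_right iS iT)
  have "(\<integral>l. log_weight \<beta> c n l \<partial>nu_prod n) = \<beta> * (\<integral>l. (\<Sum>p\<in>pairs n. ln \<bar>l (fst p) - l (snd p)\<bar>) \<partial>nu_prod n) - n * (\<integral>l. (\<Sum>i<n. ?Q (l i)) \<partial>nu_prod n)"
    unfolding log_weight_def
    by (subst Bochner_Integration.integral_diff[OF integrable_mult_right[OF iS] integrable_mult_right[OF iT]]) simp
  also have "(\<integral>l. (\<Sum>p\<in>pairs n. ln \<bar>l (fst p) - l (snd p)\<bar>) \<partial>nu_prod n) = (\<Sum>p\<in>pairs n. - (\<integral>t. nu_pot t \<partial>?N))"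
  proof -
    have "(\<integral>l. (\<Sum>p\<in>pairs n. ln \<bar>l (fst p) - l (snd p)\<bar>) \<partial>nu_prod n) = (\<Sum>p\<in>pairs n. \<integral>l. ln \<bar>l (fst p) - l (snd p)\<bar> \<partial>nu_prod n)"
      by (rule Bochner_Integration.integral_sum) (rule L2(1))
    also have "\<dots> = (\<Sum>p\<in>pairs n. - (\<integral>t. nu_pot t \<partial>?N))" by (rule sum.cong[OF refl L2(2)])
    finally show ?thesis .
  qed
  also have "(\<integral>l. (\<Sum>i<n. ?Q (l i)) \<partial>nu_prod n) = (\<Sum>i<n. \<integral>t. ?Q t \<partial>?N)"
  proof -
    have "(\<integral>l. (\<Sum>i<n. ?Q (l i)) \<partial>nu_prod n) = (\<Sum>i<n. \<integral>l. ?Q (l i) \<partial>nu_prod n)"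
      by (rule Bochner_Integration.integral_sum) (rule Q1, simp)
    also have "\<dots> = (\<Sum>i<n. \<integral>t. ?Q t \<partial>?N)" by (rule sum.cong[OF refl]) (rule Q1, simp)
    finally show ?thesis .
  qed
  also have "(\<integral>t. ?Q t \<partial>?N) = 2 * Estar - ell" by (simp add: Estar_def add_divide_distrib)
  finally have "(\<integral>l. log_weight \<beta> c n l \<partial>nu_prod n) = - (2 * real (card (pairs n))) * (\<beta> / 2 * (\<integral>t. nu_pot t \<partial>?N)) - n * (n * (2 * Estar - ell))"
    by simp
  then show "(\<integral>l. log_weight \<beta> c n l \<partial>nu_prod n) = - (real n)\<^sup>2 * Estar + real n * (ell - Estar)"
    unfolding card_pairs nu_pot_integral(2) by (simp add: algebra_simps power2_eq_square)
  have a1: "AE l in nu_prod n. l i \<noteq> 0" if "i < n" for i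
    using AE_distrD[OF m1[OF that], of "\<lambda>t. t \<noteq> 0"] AE_nu_eq_neq[of 0] unfolding d1[OF that] by simp
  interpret PP: pair_prob_space ?N ?N ..
  have ne: "AE z in ?N \<Otimes>\<^sub>M ?N. fst z \<noteq> snd z"
  proof (rule PP.AE_pair_measure)
    have "AE y in ?N. fst (x, y) \<noteq> snd (x, y)" for x
      using AE_nu_eq_neq[of x] by eventually_elim auto
    then show "AE x in ?N. AE y in ?N. fst (x, y) \<noteq> snd (x, y)" by simp
  qed measurable
  have a2: "AE l in nu_prod n. l (fst p) \<noteq> l (snd p)" if "p \<in> pairs n" for p
    using AE_distrD[OF m2[OF that], unfolded d2[OF that], OF ne] by simp
  have "AE l in nu_prod n. \<forall>i\<in>{..<n}. l i \<noteq> 0" using a1 by (intro AE_finite_allI) auto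
  moreover have "AE l in nu_prod n. \<forall>p\<in>pairs n. l (fst p) \<noteq> l (snd p)" using a2 finite_pairs by (intro AE_finite_allI) auto
  ultimately show "AE l in nu_prod n. generic c n l" by eventually_elim (auto simp: generic_def)
qed

lemma weight_measurable: "weight \<beta> n m \<in> borel_measurable (PiM {..<n} (\<lambda>_. borel))"
proof -
  have a: "(\<lambda>x. abs_pow x p) \<in> borel_measurable borel" for p
    unfolding abs_pow_def[abs_def] by measurable
  have comp: "(\<lambda>l. l i) \<in> borel_measurable (PiM {..<n} (\<lambda>_. borel :: real measure))" if "i < n" for i
    using that by (intro measurable_component_singleton) simp
  have 1: "(\<lambda>l. exp (- real n * (\<Sum>i<n. (l i)\<^sup>2))) \<in> borel_measurable (PiM {..<n} (\<lambda>_. borel :: real measure))"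
    by (intro measurable_compose[OF _ borel_measurable_exp] borel_measurable_times borel_measurable_const borel_measurable_sum borel_measurable_power comp) simp
  have 2: "(\<lambda>l. \<Prod>i<n. abs_pow (l i) (2 * m)) \<in> borel_measurable (PiM {..<n} (\<lambda>_. borel :: real measure))"
    by (intro borel_measurable_prod measurable_compose[OF comp a]) simp
  have 3: "(\<lambda>l. \<Prod>p\<in>pairs n. abs_pow (l (fst p) - l (snd p)) \<beta>) \<in> borel_measurable (PiM {..<n} (\<lambda>_. borel :: real measure))"
    by (intro borel_measurable_prod measurable_compose[OF borel_measurable_diff a] comp) auto
  show ?thesis unfolding weight_def[abs_def] by (intro borel_measurable_times 1 2 3)
qed

lemma integral_le_nn_integral:
  assumes "integrable M (g :: _ \<Rightarrow> real)"
  shows "ennreal (\<integral>x. g x \<partial>M) \<le> (\<integral>\<^sup>+x. ennreal (g x) \<partial>M)"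
proof -
  have i: "integrable M (\<lambda>x. max 0 (g x))" using assms by (intro integrable_max) auto
  have "ennreal (\<integral>x. g x \<partial>M) \<le> ennreal (\<integral>x. max 0 (g x) \<partial>M)"
    by (intro ennreal_leI integral_mono assms i) auto
  also have "\<dots> = (\<integral>\<^sup>+x. ennreal (max 0 (g x)) \<partial>M)" by (rule nn_integral_eq_integral[symmetric, OF i]) simp
  also have "\<dots> = (\<integral>\<^sup>+x. ennreal (g x) \<partial>M)" by (intro nn_integral_cong) (simp add: max_def ennreal_neg)
  finally show ?thesis .
qed

lemma nn_integral_weight_ge:
  "ennreal (exp (- (real n)\<^sup>2 * Estar + real n * (ell - Estar))) \<le> ennreal densc ^ n * (\<integral>\<^sup>+l. ennreal (weight \<beta> n (n * c) l) \<partial>Lebn n)"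
proof -
  let ?PN = "PiM {..<n} (\<lambda>_. nu_eq \<beta> c)"
  interpret N: prob_space "nu_eq \<beta> c" by (rule prob_space_nu_eq)
  interpret P: product_prob_space "\<lambda>_::nat. nu_eq \<beta> c" "{..<n}" by standard
  have tot: "measure ?PN (space ?PN) = 1" by (rule prob_space.prob_space[OF prob_space_PiM[OF prob_space_nu_eq]])
  note w = integral_log_weight[of n, unfolded nu_prod_def]
  define a where "a = - (real n)\<^sup>2 * Estar + real n * (ell - Estar)"
  \<comment> \<open>Jensen's inequality in tangent form: exp y \<ge> exp a (1 + y - a), with a the
    mean of the logarithm of the weight. The right-hand side is integrable with integral exp a, so
    the weight itself enters only through a nonnegative integral.\<close>
  let ?g = "\<lambda>l. exp a * (1 + (log_weight \<beta> c n l - a))"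
  have ig: "integrable ?PN ?g" using w(1) by (intro integrable_mult_right Bochner_Integration.integrable_add Bochner_Integration.integrable_diff) auto
  have "(\<integral>l. ?g l \<partial>?PN) = exp a" using w(1,2) tot by (simp add: a_def)
  then have "ennreal (exp a) \<le> (\<integral>\<^sup>+l. ennreal (?g l) \<partial>?PN)"
    using integral_le_nn_integral[OF ig] by simp
  also have "\<dots> \<le> (\<integral>\<^sup>+l. ennreal (weight \<beta> n (n * c) l) \<partial>?PN)"
  proof (rule nn_integral_mono_AE, use w(3) in eventually_elim)
    case (elim l)
    have "?g l \<le> exp a * exp (log_weight \<beta> c n l - a)" by (intro mult_left_mono) auto
    also have "\<dots> = weight \<beta> n (n * c) l" using elim by (simp add: weight_generic exp_add[symmetric])
    finally show ?case by (rule ennreal_leI)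
  qed
  also have "\<dots> \<le> ennreal densc ^ n * (\<integral>\<^sup>+l. ennreal (weight \<beta> n (n * c) l) \<partial>Lebn n)"
    using nn_integral_PiM_nu_eq_le[of "{..<n}" "\<lambda>l. ennreal (weight \<beta> n (n * c) l)"] weight_measurable by (simp add: Lebn_def)
  finally show ?thesis unfolding a_def .
qed

end

section \<open>Convergence of the mean empirical measures\<close>

context log_gas
begin

lemma sets_Lebn: "sets (Lebn n) = sets (PiM {..<n} (\<lambda>_. borel))"
  unfolding Lebn_def by (rule sets_PiM_cong) auto

lemma weight_measurable': "weight \<beta> n m \<in> borel_measurable (Lebn n)"
  using weight_measurable[of n m] by (simp add: measurable_cong_sets[OF sets_Lebn refl])

lemma tailc_pos: "0 < tailc" by (simp add: tailc_def)

lemma densc_pos: "0 < densc" unfolding densc_def using edge_ab \<beta> by simp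

text \<open>Finiteness is the upper bound on all configurations with D \<ge> 0 and \<epsilon> = 1,
  and positivity is the Jensen bound. Finiteness matters for \<open>Zn\<close>: a Bochner integral
  of a non-integrable function would be 0 by convention.\<close>

lemma Zn_pos:
  assumes n: "1 \<le> n"
  shows "(\<integral>\<^sup>+l. ennreal (weight \<beta> n (n * c) l) \<partial>Lebn n) = ennreal (Zn \<beta> n (n * c))"
    and "0 < Zn \<beta> n (n * c)"
    and "exp (- (real n)\<^sup>2 * Estar + real n * (ell - Estar)) \<le> densc ^ n * Zn \<beta> n (n * c)"
proof -
  let ?W = "\<integral>\<^sup>+l. ennreal (weight \<beta> n (n * c) l) \<partial>Lebn n"
  have "0 \<le> log_energy 1 (emp n l) (nu_eq \<beta> c)" for l
    using n by (intro log_energy_nonneg prob_space_emp prob_space_nu_eq sets_emp sets_nu_eq integral_emp integrable_nu_eq_id) auto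
  from nn_integral_weight_le[OF n zero_less_one this, of UNIV]
  have "?W < \<infinity>" by (simp add: le_less_trans)
  then have i: "integrable (Lebn n) (weight \<beta> n (n * c))"
    using weight_measurable' weight_nonneg by (intro integrableI_nonneg) auto
  then show e: "?W = ennreal (Zn \<beta> n (n * c))"
    unfolding Zn_def using weight_nonneg by (intro nn_integral_eq_integral) auto
  have Z0: "0 \<le> Zn \<beta> n (n * c)" unfolding Zn_def using weight_nonneg by (intro integral_nonneg_AE) auto
  have "ennreal (exp (- (real n)\<^sup>2 * Estar + real n * (ell - Estar))) \<le> ennreal (densc ^ n * Zn \<beta> n (n * c))"
    using nn_integral_weight_ge[of n] densc_pos Z0 unfolding e by (simp add: ennreal_mult ennreal_power)
  then show le: "exp (- (real n)\<^sup>2 * Estar + real n * (ell - Estar)) \<le> densc ^ n * Zn \<beta> n (n * c)"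
    using densc_pos Z0 by (subst (asm) ennreal_le_iff) auto
  have "0 < densc ^ n * Zn \<beta> n (n * c)" by (rule less_le_trans[OF exp_gt_zero le])
  then show "0 < Zn \<beta> n (n * c)" using densc_pos by (simp add: zero_less_mult_iff)
qed

lemma emeasure_Pn:
  assumes n: "1 \<le> n" and B: "B \<in> sets (Lebn n)"
  shows "emeasure (Pn \<beta> n (n * c)) B = (\<integral>\<^sup>+l. ennreal (weight \<beta> n (n * c) l) * indicator B l \<partial>Lebn n) / ennreal (Zn \<beta> n (n * c))"
proof -
  note Z = Zn_pos(2)[OF n]
  have "emeasure (Pn \<beta> n (n * c)) B = (\<integral>\<^sup>+l. ennreal (weight \<beta> n (n * c) l / Zn \<beta> n (n * c)) * indicator B l \<partial>Lebn n)"
    unfolding Pn_def using weight_measurable'[of n "n * c"] B by (intro emeasure_density) auto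
  also have "\<dots> = (\<integral>\<^sup>+l. (ennreal (weight \<beta> n (n * c) l) * indicator B l) / ennreal (Zn \<beta> n (n * c)) \<partial>Lebn n)"
    using Z weight_nonneg by (intro nn_integral_cong) (auto simp: divide_ennreal[symmetric] split: split_indicator)
  also have "\<dots> = (\<integral>\<^sup>+l. ennreal (weight \<beta> n (n * c) l) * indicator B l \<partial>Lebn n) / ennreal (Zn \<beta> n (n * c))"
    using weight_measurable'[of n "n * c"] B by (intro nn_integral_divide) auto
  finally show ?thesis .
qed

lemma sets_Pn: "sets (Pn \<beta> n m) = sets (Lebn n)" by (simp add: Pn_def)

lemma space_Pn: "space (Pn \<beta> n m) = space (Lebn n)" by (simp add: Pn_def)

lemma prob_space_Pn:
  assumes n: "1 \<le> n"
  shows "prob_space (Pn \<beta> n (n * c))"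
proof (rule prob_spaceI)
  have "(\<integral>\<^sup>+l. ennreal (weight \<beta> n (n * c) l) * indicator (space (Lebn n)) l \<partial>Lebn n) = ennreal (Zn \<beta> n (n * c))"
    unfolding Zn_pos(1)[OF n, symmetric] by (intro nn_integral_cong) auto
  then show "emeasure (Pn \<beta> n (n * c)) (space (Pn \<beta> n (n * c))) = 1"
    unfolding space_Pn emeasure_Pn[OF n sets.top] using Zn_pos(2)[OF n] by (simp add: divide_ennreal)
qed

text \<open>All costs of order n in the exponent: the diagonal, the factors \<open>tailc\<close> and
  \<open>densc\<close>, and the lower bound -\<beta> b for \<open>ell - Estar\<close>.\<close>

definition "ratec \<epsilon> = \<beta> / 2 * (1 - ln \<epsilon>) + ln tailc + ln densc + \<beta> * edge_b \<beta> c"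

lemma ell_Estar_ge: "- (\<beta> * edge_b \<beta> c) \<le> ell - Estar"
proof -
  interpret N: prob_space "nu_eq \<beta> c" by (rule prob_space_nu_eq)
  have "(\<integral>t. - 2 * edge_b \<beta> c \<partial>nu_eq \<beta> c) \<le> (\<integral>t. nu_pot t \<partial>nu_eq \<beta> c)"
  proof (rule integral_mono_AE[OF _ nu_pot_integral(1)])
    show "AE t in nu_eq \<beta> c. - 2 * edge_b \<beta> c \<le> nu_pot t"
      using AE_nu_eq_support
    proof eventually_elim
      case (elim t)
      then show ?case using nu_pot_ge[of t] by linarith
    qed
  qed simp
  then have "- 2 * edge_b \<beta> c \<le> (\<integral>t. nu_pot t \<partial>nu_eq \<beta> c)" using N.prob_space by simp
  then have "\<beta> / 2 * (- 2 * edge_b \<beta> c) \<le> \<beta> / 2 * (\<integral>t. nu_pot t \<partial>nu_eq \<beta> c)" using \<beta> by (intro mult_left_mono) auto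
  then show ?thesis unfolding nu_pot_integral(2) by simp
qed

text \<open>The upper bound for the integral over B and the lower bound for \<open>Zn\<close>
  contain the same term n^2 \<open>Estar\<close>, which cancels exactly in the quotient. At order
  n^2 only the energy gain and the truncation error are left.\<close>

lemma measure_Pn_le:
  assumes n: "1 \<le> n" and B: "B \<in> sets (Lebn n)" and \<epsilon>: "0 < \<epsilon>"
    and D: "\<And>l. l \<in> B \<Longrightarrow> d \<le> log_energy \<epsilon> (emp n l) (nu_eq \<beta> c)"
  shows "measure (Pn \<beta> n (n * c)) B \<le> exp (- (real n)\<^sup>2 * (\<beta> / 2 * d - \<beta> * (gapc * \<epsilon>)) + real n * ratec \<epsilon>)"
proof -
  let ?Z = "Zn \<beta> n (n * c)"
  interpret P: prob_space "Pn \<beta> n (n * c)" by (rule prob_space_Pn[OF n])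
  define A1 where "A1 = - (real n)\<^sup>2 * (Estar + \<beta> / 2 * d - \<beta> * (gapc * \<epsilon>)) + \<beta> / 2 * real n * (1 - ln \<epsilon>)"
  define A2 where "A2 = - (real n)\<^sup>2 * Estar + real n * (ell - Estar)"
  note Z = Zn_pos(2)[OF n]
  have "emeasure (Pn \<beta> n (n * c)) B \<le> ennreal (exp A1 * tailc ^ n) / ennreal ?Z"
    unfolding emeasure_Pn[OF n B] A1_def by (rule divide_right_mono_ennreal[OF nn_integral_weight_le[OF n \<epsilon> D]])
  then have "measure (Pn \<beta> n (n * c)) B \<le> exp A1 * tailc ^ n / ?Z"
    using Z tailc_pos by (simp add: P.emeasure_eq_measure divide_ennreal)
  also have "\<dots> \<le> exp A1 * tailc ^ n / (exp A2 / densc ^ n)"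
  proof (rule divide_left_mono)
    show "exp A2 / densc ^ n \<le> ?Z" using Zn_pos(3)[OF n] densc_pos by (simp add: A2_def divide_le_eq mult.commute)
  qed (use Z densc_pos tailc_pos in auto)
  also have "\<dots> = exp A1 / exp A2 * (exp (real n * ln tailc) * exp (real n * ln densc))"
    using tailc_pos densc_pos by (simp add: exp_of_nat_mult)
  also have "\<dots> = exp (A1 - A2 + real n * ln tailc + real n * ln densc)" by (simp add: exp_diff exp_add)
  also have "\<dots> \<le> exp (- (real n)\<^sup>2 * (\<beta> / 2 * d - \<beta> * (gapc * \<epsilon>)) + real n * ratec \<epsilon>)"
  proof -
    have "real n * (- (\<beta> * edge_b \<beta> c)) \<le> real n * (ell - Estar)" by (rule mult_left_mono[OF ell_Estar_ge]) simp
    moreover have "A1 - A2 + real n * ln tailc + real n * ln densc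
       = - (real n)\<^sup>2 * (\<beta> / 2 * d - \<beta> * (gapc * \<epsilon>)) + real n * ratec \<epsilon> - (real n * (ell - Estar) - real n * (- (\<beta> * edge_b \<beta> c)))"
      by (simp add: A1_def A2_def ratec_def algebra_simps)
    ultimately show ?thesis by (simp only: exp_le_cancel_iff)
  qed
  finally show ?thesis .
qed

lemma measure_emp_measurable:
  assumes A: "A \<in> sets borel"
  shows "(\<lambda>l. measure (emp n l) A) \<in> borel_measurable (Lebn n)"
proof -
  have "measure (emp n l) A = (\<Sum>i<n. indicator A (l i)) / real n" for l
    using integral_emp(2)[of "indicator A" n l] A by simp
  moreover have "(\<lambda>l. (\<Sum>i<n. indicator A (l i)) / real n) \<in> borel_measurable (Lebn n)"
  proof (intro borel_measurable_divide borel_measurable_sum borel_measurable_const)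
    fix i assume "i \<in> {..<n}"
    then have "(\<lambda>l. l i) \<in> measurable (Lebn n) borel"
      unfolding measurable_cong_sets[OF sets_Lebn refl] by (rule measurable_component_singleton)
    then show "(\<lambda>l. indicator A (l i) :: real) \<in> borel_measurable (Lebn n)"
      by (rule measurable_compose) (use A in simp)
  qed
  ultimately show ?thesis by simp
qed

text \<open>Since \<open>nun\<close> is built with \<open>measure_of\<close>, it agrees with its set
  function only once countable additivity is checked; this passes from the empirical measures to
  their mean by exchanging sum and integral.\<close>

lemma emeasure_nun:
  assumes n: "1 \<le> n" and A: "A \<in> sets borel"
  shows "emeasure (nun \<beta> n (n * c)) A = (\<integral>\<^sup>+l. ennreal (measure (emp n l) A) \<partial>Pn \<beta> n (n * c))"
proof -
  let ?P = "Pn \<beta> n (n * c)"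
  have m: "(\<lambda>l. ennreal (measure (emp n l) A)) \<in> borel_measurable ?P" if "A \<in> sets borel" for A
    using measure_emp_measurable[OF that, of n] by (simp add: measurable_cong_sets[OF sets_Pn refl])
  have em: "emeasure (emp n l) A = ennreal (measure (emp n l) A)" for l A
    using prob_space_emp[of n l] n by (simp add: finite_measure.emeasure_eq_measure prob_space.finite_measure)
  have eq: "(\<integral>\<^sup>+ l. ennreal (card {i\<in>{..<n}. l i \<in> A} / real n) \<partial>?P) = (\<integral>\<^sup>+l. ennreal (measure (emp n l) A) \<partial>?P)"
    if "A \<in> sets borel" for A using measure_emp[OF that, of n] by simp
  show ?thesis unfolding eq[OF A, symmetric]
  proof (rule emeasure_measure_of[OF nun_def])
    show "positive (sets (nun \<beta> n (n * c))) (\<lambda>A. \<integral>\<^sup>+ l. ennreal (card {i\<in>{..<n}. l i \<in> A} / real n) \<partial>?P)"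
      by (simp add: positive_def)
    have sn: "sets (nun \<beta> n (n * c)) = sets borel" unfolding nun_def by (simp add: sets_measure_of_conv sets.sigma_sets_eq[of borel, simplified])
    then show "A \<in> sets (nun \<beta> n (n * c))" using A by simp
    show "countably_additive (sets (nun \<beta> n (n * c))) (\<lambda>A. \<integral>\<^sup>+ l. ennreal (card {i\<in>{..<n}. l i \<in> A} / real n) \<partial>?P)"
      unfolding sn
    proof (rule countably_additiveI)
      fix F :: "nat \<Rightarrow> real set" assume F: "range F \<subseteq> sets borel" "disjoint_family F" "\<Union> (range F) \<in> sets borel"
      have "(\<Sum>i. \<integral>\<^sup>+ l. ennreal (card {j\<in>{..<n}. l j \<in> F i} / real n) \<partial>?P) = (\<Sum>i. \<integral>\<^sup>+l. ennreal (measure (emp n l) (F i)) \<partial>?P)"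
        using F by (intro suminf_cong eq) auto
      also have "\<dots> = (\<integral>\<^sup>+l. (\<Sum>i. ennreal (measure (emp n l) (F i))) \<partial>?P)"
        using F m by (intro nn_integral_suminf[symmetric]) auto
      also have "\<dots> = (\<integral>\<^sup>+l. ennreal (measure (emp n l) (\<Union> (range F))) \<partial>?P)"
        unfolding em[symmetric] using F by (intro nn_integral_cong suminf_emeasure) auto
      also have "\<dots> = (\<integral>\<^sup>+ l. ennreal (card {j\<in>{..<n}. l j \<in> \<Union> (range F)} / real n) \<partial>?P)"
        using F by (intro eq[symmetric]) auto
      finally show "(\<Sum>i. \<integral>\<^sup>+ l. ennreal (card {j\<in>{..<n}. l j \<in> F i} / real n) \<partial>?P) = (\<integral>\<^sup>+ l. ennreal (card {j\<in>{..<n}. l j \<in> \<Union> (range F)} / real n) \<partial>?P)" .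
    qed
  qed auto
qed

lemma sets_nun: "sets (nun \<beta> n m) = sets borel"
  unfolding nun_def by (simp add: sets_measure_of_conv sets.sigma_sets_eq[of borel, simplified])

lemma space_nun: "space (nun \<beta> n m) = UNIV"
  unfolding nun_def by (simp add: space_measure_of_conv)

lemma prob_space_nun:
  assumes n: "1 \<le> n"
  shows "prob_space (nun \<beta> n (n * c))"
proof (rule prob_spaceI)
  interpret P: prob_space "Pn \<beta> n (n * c)" by (rule prob_space_Pn[OF n])
  have "measure (emp n l) UNIV = 1" for l
    using n by (simp add: measure_emp)
  then show "emeasure (nun \<beta> n (n * c)) (space (nun \<beta> n (n * c))) = 1"
    unfolding space_nun using emeasure_nun[OF n, of UNIV] P.emeasure_space_1 by simp
qed

text \<open>Configurations whose empirical mass in the larger interval falls short by \<eta> have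
  energy distance bounded below, hence tiny probability. On the others the bound holds pointwise,
  and the expectation combines the two.\<close>

lemma nun_interval_ge:
  assumes n: "1 \<le> n" and \<epsilon>: "0 < \<epsilon>" "\<epsilon> \<le> q - p" and \<delta>: "0 < \<delta>" and \<eta>: "0 \<le> \<eta>"
  shows "measure (nu_eq \<beta> c) {p + 2 * \<delta>..q} - \<eta>
     - exp (- (real n)\<^sup>2 * (\<beta> / 2 * (\<delta> * \<eta> / (q - p + \<delta>))\<^sup>2 - \<beta> * (gapc * \<epsilon>)) + real n * ratec \<epsilon>)
    \<le> measure (nun \<beta> n (n * c)) {p<..q + 2 * \<delta>}"
proof -
  let ?P = "Pn \<beta> n (n * c)" and ?I = "{p<..q + 2 * \<delta>}" and ?J = "{p + 2 * \<delta>..q}"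
  interpret P: prob_space ?P by (rule prob_space_Pn[OF n])
  interpret N: prob_space "nu_eq \<beta> c" by (rule prob_space_nu_eq)
  interpret nn: prob_space "nun \<beta> n (n * c)" by (rule prob_space_nun[OF n])
  define B where "B = {l \<in> space (Lebn n). measure (emp n l) ?I \<le> measure (nu_eq \<beta> c) ?J - \<eta>}"
  have mI: "(\<lambda>l. measure (emp n l) ?I) \<in> borel_measurable (Lebn n)" by (rule measure_emp_measurable) simp
  have B: "B \<in> sets (Lebn n)" unfolding B_def using mI by measurable
  have "(\<delta> * \<eta> / (q - p + \<delta>))\<^sup>2 \<le> log_energy \<epsilon> (emp n l) (nu_eq \<beta> c)" if "l \<in> B" for l
    using that n unfolding B_def
    by (intro log_energy_detects_deficit prob_space_emp prob_space_nu_eq sets_emp sets_nu_eq integral_emp integrable_nu_eq_id \<epsilon> \<delta> \<eta>) auto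
  from measure_Pn_le[OF n B \<epsilon>(1) this]
  have PB: "measure ?P B \<le> exp (- (real n)\<^sup>2 * (\<beta> / 2 * (\<delta> * \<eta> / (q - p + \<delta>))\<^sup>2 - \<beta> * (gapc * \<epsilon>)) + real n * ratec \<epsilon>)" .
  have le1: "measure (emp n l) ?I \<le> 1" for l using prob_space.prob_le_1[OF prob_space_emp[of n l]] n by simp
  have mI': "(\<lambda>l. measure (emp n l) ?I) \<in> borel_measurable ?P" using mI by (simp add: measurable_cong_sets[OF sets_Pn refl])
  have iI: "integrable ?P (\<lambda>l. measure (emp n l) ?I)"
    by (rule P.integrable_const_bound[where B = 1]) (use le1 mI' in auto)
  have "emeasure (nun \<beta> n (n * c)) ?I = ennreal (\<integral>l. measure (emp n l) ?I \<partial>?P)"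
    using emeasure_nun[OF n, of ?I] nn_integral_eq_integral[OF iI] by simp
  then have e: "measure (nun \<beta> n (n * c)) ?I = (\<integral>l. measure (emp n l) ?I \<partial>?P)"
    by (simp add: measure_def integral_nonneg_AE)
  have BP: "B \<in> sets ?P" using B by (simp add: sets_Pn)
  have iB: "integrable ?P (indicator B :: _ \<Rightarrow> real)" using BP by (simp add: integrable_indicator_iff P.emeasure_eq_measure)
  have "measure (nu_eq \<beta> c) ?J - \<eta> - measure ?P B = (\<integral>l. measure (nu_eq \<beta> c) ?J - \<eta> - indicator B l \<partial>?P)"
    using iB P.prob_space BP sets.sets_into_space[OF BP] by (simp add: Int_absorb2)
  also have "\<dots> \<le> (\<integral>l. measure (emp n l) ?I \<partial>?P)"
  proof (rule integral_mono[OF _ iI])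
    show "integrable ?P (\<lambda>l. measure (nu_eq \<beta> c) ?J - \<eta> - indicator B l)" using iB by auto
    fix l assume l: "l \<in> space ?P"
    show "measure (nu_eq \<beta> c) ?J - \<eta> - indicator B l \<le> measure (emp n l) ?I"
    proof (cases "l \<in> B")
      case True
      then have "indicator B l = (1 :: real)" by simp
      then show ?thesis using N.prob_le_1[of ?J] \<eta> measure_nonneg[of "emp n l" ?I] by linarith
    next
      case False
      then show ?thesis using l by (auto simp: B_def space_Pn)
    qed
  qed
  finally show ?thesis using PB e by linarith
qed

lemma nu_eq_interval_le:
  assumes "x \<le> y"
  shows "measure (nu_eq \<beta> c) {x..y} \<le> densc * (y - x)"
proof -
  interpret N: prob_space "nu_eq \<beta> c" by (rule prob_space_nu_eq)
  have "emeasure (nu_eq \<beta> c) {x..y} = (\<integral>\<^sup>+t. indicator {x..y} t \<partial>nu_eq \<beta> c)" by simp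
  also have "\<dots> \<le> ennreal densc * (\<integral>\<^sup>+t. indicator {x..y} t \<partial>lborel)"
    unfolding densc_def by (rule nn_integral_nu_eq_le) simp
  also have "\<dots> = ennreal (densc * (y - x))" using assms densc_pos by (simp add: ennreal_mult)
  finally show ?thesis using assms densc_pos by (simp add: N.emeasure_eq_measure)
qed

text \<open>Lower bounds for the mass of intervals suffice: applied to the left and to the right of \<open>x\<close>, they
  bound the distribution function from both sides, because both measures are probabilities.\<close>

lemma cdf_nun_close:
  assumes n: "1 \<le> n" and L: "edge_b \<beta> c \<le> L" "\<bar>x\<bar> \<le> L" and \<delta>: "0 < \<delta>" "\<delta> \<le> 1" and \<eta>: "0 \<le> \<eta>" and \<epsilon>: "0 < \<epsilon>" "\<epsilon> \<le> 1"
  shows "\<bar>measure (nun \<beta> n (n * c)) {..x} - measure (nu_eq \<beta> c) {..x}\<bar>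
    \<le> 2 * \<delta> * densc + \<eta> + exp (- (real n)\<^sup>2 * (\<beta> / 2 * (\<delta> * \<eta> / (2 * L + 8))\<^sup>2 - \<beta> * (gapc * \<epsilon>)) + real n * ratec \<epsilon>)"
proof -
  interpret N: prob_space "nu_eq \<beta> c" by (rule prob_space_nu_eq)
  interpret nn: prob_space "nun \<beta> n (n * c)" by (rule prob_space_nun[OF n])
  note [simp] = sets_nun
  have L0: "0 \<le> L" using L(2) by linarith
  let ?E = "exp (- (real n)\<^sup>2 * (\<beta> / 2 * (\<delta> * \<eta> / (2 * L + 8))\<^sup>2 - \<beta> * (gapc * \<epsilon>)) + real n * ratec \<epsilon>)"
  have E: "exp (- (real n)\<^sup>2 * (\<beta> / 2 * (\<delta> * \<eta> / (q - p + \<delta>))\<^sup>2 - \<beta> * (gapc * \<epsilon>)) + real n * ratec \<epsilon>) \<le> ?E"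
    if "0 < q - p" "q - p \<le> 2 * L + 7" for p q
  proof -
    have "\<delta> * \<eta> / (2 * L + 8) \<le> \<delta> * \<eta> / (q - p + \<delta>)" using that \<delta> \<eta> L0 by (intro divide_left_mono) auto
    then have "(\<delta> * \<eta> / (2 * L + 8))\<^sup>2 \<le> (\<delta> * \<eta> / (q - p + \<delta>))\<^sup>2" using \<delta> \<eta> L0 by (intro power_mono) auto
    then have "\<beta> / 2 * (\<delta> * \<eta> / (2 * L + 8))\<^sup>2 \<le> \<beta> / 2 * (\<delta> * \<eta> / (q - p + \<delta>))\<^sup>2" using \<beta> by (intro mult_left_mono) auto
    then have "(real n)\<^sup>2 * (\<beta> / 2 * (\<delta> * \<eta> / (2 * L + 8))\<^sup>2 - \<beta> * (gapc * \<epsilon>)) \<le> (real n)\<^sup>2 * (\<beta> / 2 * (\<delta> * \<eta> / (q - p + \<delta>))\<^sup>2 - \<beta> * (gapc * \<epsilon>))"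
      by (intro mult_left_mono) auto
    then show ?thesis by simp
  qed
  have supp: "measure (nu_eq \<beta> c) {..x} = measure (nu_eq \<beta> c) {- L..x}"
  proof (rule N.finite_measure_eq_AE)
    show "AE t in nu_eq \<beta> c. (t \<in> {..x}) = (t \<in> {- L..x})"
      using AE_nu_eq_support by eventually_elim (use L in auto)
  qed auto
  have supp2: "measure (nu_eq \<beta> c) {x<..} = measure (nu_eq \<beta> c) {x<..L}"
  proof (rule N.finite_measure_eq_AE)
    show "AE t in nu_eq \<beta> c. (t \<in> {x<..}) = (t \<in> {x<..L})"
      using AE_nu_eq_support by eventually_elim (use L in auto)
  qed auto
  have low: "measure (nu_eq \<beta> c) {..x} - 2 * \<delta> * densc - \<eta> - ?E \<le> measure (nun \<beta> n (n * c)) {..x}"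
  proof -
    \<comment> \<open>Chosen so that \<open>?q + 2 * \<delta>\<close> is x and the inner interval
      still reaches to the left of -L. The additional 1 keeps the length at least 1, hence at least
      \<epsilon>, even for x = -L.\<close>
    let ?p = "- L - 1 - 4 * \<delta>" and ?q = "x - 2 * \<delta>"
    have pq: "\<epsilon> \<le> ?q - ?p" "?q - ?p \<le> 2 * L + 7" using L \<delta> \<epsilon> by auto
    have "measure (nu_eq \<beta> c) {- L..x} \<le> measure (nu_eq \<beta> c) ({?p + 2 * \<delta>..?q} \<union> {?q..x})"
      by (rule N.finite_measure_mono) (use \<delta> in auto)
    also have "\<dots> \<le> measure (nu_eq \<beta> c) {?p + 2 * \<delta>..?q} + measure (nu_eq \<beta> c) {?q..x}"
      by (rule measure_Un_le) auto
    also have "measure (nu_eq \<beta> c) {?q..x} \<le> densc * (x - ?q)" using \<delta> by (intro nu_eq_interval_le) auto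
    finally have 1: "measure (nu_eq \<beta> c) {..x} - 2 * \<delta> * densc \<le> measure (nu_eq \<beta> c) {?p + 2 * \<delta>..?q}" by (simp add: supp mult_ac)
    have "measure (nun \<beta> n (n * c)) {?p<..?q + 2 * \<delta>} \<le> measure (nun \<beta> n (n * c)) {..x}"
      by (rule nn.finite_measure_mono) auto
    then show ?thesis using 1 nun_interval_ge[OF n \<epsilon>(1) pq(1) \<delta>(1) \<eta>] E[of ?q ?p] pq \<epsilon> by linarith
  qed
  have up: "measure (nu_eq \<beta> c) {x<..} - 2 * \<delta> * densc - \<eta> - ?E \<le> measure (nun \<beta> n (n * c)) {x<..}"
  proof -
    \<comment> \<open>The mirror image: the enlarged interval starts at x, the inner one ends beyond
      L, and its margin again keeps the length at least 1 when x = L.\<close>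
    let ?p = "x" and ?q = "L + 1 + 2 * \<delta>"
    have pq: "\<epsilon> \<le> ?q - ?p" "?q - ?p \<le> 2 * L + 7" using L \<delta> \<epsilon> by auto
    have "measure (nu_eq \<beta> c) {x<..L} \<le> measure (nu_eq \<beta> c) ({?p..?p + 2 * \<delta>} \<union> {?p + 2 * \<delta>..?q})"
      by (rule N.finite_measure_mono) (use \<delta> in auto)
    also have "\<dots> \<le> measure (nu_eq \<beta> c) {?p..?p + 2 * \<delta>} + measure (nu_eq \<beta> c) {?p + 2 * \<delta>..?q}"
      by (rule measure_Un_le) auto
    also have "measure (nu_eq \<beta> c) {?p..?p + 2 * \<delta>} \<le> densc * (?p + 2 * \<delta> - ?p)" using \<delta> by (intro nu_eq_interval_le) auto
    finally have 1: "measure (nu_eq \<beta> c) {x<..} - 2 * \<delta> * densc \<le> measure (nu_eq \<beta> c) {?p + 2 * \<delta>..?q}" by (simp add: supp2 mult_ac)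
    have "measure (nun \<beta> n (n * c)) {?p<..?q + 2 * \<delta>} \<le> measure (nun \<beta> n (n * c)) {x<..}"
      by (rule nn.finite_measure_mono) auto
    then show ?thesis using 1 nun_interval_ge[OF n \<epsilon>(1) pq(1) \<delta>(1) \<eta>] E[of ?q ?p] pq \<epsilon> by linarith
  qed
  have "measure (nun \<beta> n (n * c)) {x<..} = 1 - measure (nun \<beta> n (n * c)) {..x}"
    using nn.prob_compl[of "{..x}"] by (simp add: space_nun Compl_eq_Diff_UNIV[symmetric] Compl_atMost)
  moreover have "measure (nu_eq \<beta> c) {x<..} = 1 - measure (nu_eq \<beta> c) {..x}"
    using N.prob_compl[of "{..x}"] by (simp add: Compl_eq_Diff_UNIV[symmetric] Compl_atMost)
  ultimately show ?thesis using low up by linarith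
qed

end

section \<open>Parameters that vary with n\<close>

lemma tendsto_pp: "(cs \<longlongrightarrow> c) F \<Longrightarrow> ((\<lambda>n. pp \<beta> (cs n)) \<longlongrightarrow> pp \<beta> c) F"
  unfolding pp_def by (intro tendsto_intros)

lemma exp_quadratic_decay:
  fixes k g :: real
  assumes "0 < k"
  shows "(\<lambda>n. exp (- (real n)\<^sup>2 * k + real n * g)) \<longlonglongrightarrow> 0"
proof -
  have "filterlim (\<lambda>n::nat. - (real n)\<^sup>2 * k + real n * g) at_bot sequentially"
    using assms by real_asymp
  then show ?thesis by (rule filterlim_compose[OF exp_at_bot])
qed

context
  fixes \<beta> c :: real and cs :: "nat \<Rightarrow> real"
  assumes \<beta>: "0 < \<beta>" and cs: "\<And>n. 0 \<le> cs n" and lim: "cs \<longlonglongrightarrow> c"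
begin

lemma c_nonneg: "0 \<le> c"
  using lim cs by (rule LIMSEQ_le_const[OF _ exI, OF _ allI, OF _ impI])

lemma log_gas_cs: "log_gas \<beta> (cs n)" "log_gas \<beta> c"
  using \<beta> cs c_nonneg by (auto intro: log_gas.intro)

lemma tendsto_edges:
  "(\<lambda>n. edge_a \<beta> (cs n)) \<longlonglongrightarrow> edge_a \<beta> c" "(\<lambda>n. edge_b \<beta> (cs n)) \<longlonglongrightarrow> edge_b \<beta> c"
  unfolding log_gas.edges[OF log_gas_cs(1)] log_gas.edges[OF log_gas_cs(2)]
  by (intro tendsto_intros tendsto_pp lim)+

text \<open>The constants in the estimates for finite n are continuous in c. Along the sequence they
  are therefore eventually dominated by fixed numbers, and the estimates become uniform.\<close>

lemma tendsto_consts: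
  "(\<lambda>n. log_gas.densc \<beta> (cs n)) \<longlonglongrightarrow> log_gas.densc \<beta> c"
  "(\<lambda>n. log_gas.gapc \<beta> (cs n)) \<longlonglongrightarrow> log_gas.gapc \<beta> c"
  "(\<lambda>n. log_gas.ratec \<beta> (cs n) \<epsilon>) \<longlonglongrightarrow> log_gas.ratec \<beta> c \<epsilon>"
proof -
  interpret log_gas \<beta> c by (rule log_gas_cs)
  show d: "(\<lambda>n. log_gas.densc \<beta> (cs n)) \<longlonglongrightarrow> log_gas.densc \<beta> c"
    unfolding log_gas.densc_def[OF log_gas_cs(1)] densc_def using \<beta> by (intro tendsto_intros tendsto_edges) auto
  show "(\<lambda>n. log_gas.gapc \<beta> (cs n)) \<longlonglongrightarrow> log_gas.gapc \<beta> c"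
    unfolding log_gas.gapc_def[OF log_gas_cs(1)] gapc_def using \<beta> by (intro tendsto_intros tendsto_edges) auto
  have l: "(\<lambda>n. log_gas.ell \<beta> (cs n)) \<longlonglongrightarrow> log_gas.ell \<beta> c"
    unfolding log_gas.ell_def[OF log_gas_cs(1)] ell_def using pp_rr(1,2) by (intro tendsto_intros tendsto_pp lim) auto
  have "(\<lambda>n. log_gas.excessc \<beta> (cs n)) \<longlonglongrightarrow> log_gas.excessc \<beta> c"
    unfolding log_gas.excessc_def[OF log_gas_cs(1)] excessc_def by (intro tendsto_intros tendsto_edges lim l) auto
  then have "(\<lambda>n. log_gas.tailc \<beta> (cs n)) \<longlonglongrightarrow> log_gas.tailc \<beta> c"
    unfolding log_gas.tailc_def[OF log_gas_cs(1)] tailc_def by (intro tendsto_intros)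
  then show "(\<lambda>n. log_gas.ratec \<beta> (cs n) \<epsilon>) \<longlonglongrightarrow> log_gas.ratec \<beta> c \<epsilon>"
    unfolding log_gas.ratec_def[OF log_gas_cs(1)] ratec_def using tailc_pos densc_pos
    by (intro tendsto_intros tendsto_edges d) auto
qed

text \<open>Dominated convergence: the positive-part form of the density is continuous in the edges,
  and bounded convergent edges and density bounds give the majorant M on one fixed interval
  [-L, L].\<close>

lemma tendsto_cdf_nu_eq: "(\<lambda>n. measure (nu_eq \<beta> (cs n)) {..x}) \<longlonglongrightarrow> measure (nu_eq \<beta> c) {..x}"
proof -
  obtain L where L: "\<And>n. \<bar>edge_b \<beta> (cs n)\<bar> \<le> L"
    using convergent_imp_Bseq[OF convergentI[OF tendsto_edges(2)]] unfolding Bseq_def by auto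
  obtain M where M: "\<And>n. \<bar>log_gas.densc \<beta> (cs n)\<bar> \<le> M"
    using convergent_imp_Bseq[OF convergentI[OF tendsto_consts(1)]] unfolding Bseq_def by auto
  have eq: "measure (nu_eq \<beta> d) {..x} = (\<integral>t. eq_density \<beta> d t * indicator {..x} t \<partial>lborel)"
    if "log_gas \<beta> d" for d
  proof -
    interpret log_gas \<beta> d by fact
    interpret N: prob_space "nu_eq \<beta> d" by (rule prob_space_nu_eq)
    have "measure (nu_eq \<beta> d) {..x} = (\<integral>t. indicator {..x} t \<partial>nu_eq \<beta> d)" by simp
    also have "\<dots> = (\<integral>t. eq_density \<beta> d t * indicator {..x} t \<partial>lborel)"
      unfolding nu_eq_def using eq_density_nonneg by (subst integral_density) auto
    finally show ?thesis .
  qed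
  have "(\<lambda>n. \<integral>t. eq_density \<beta> (cs n) t * indicator {..x} t \<partial>lborel) \<longlonglongrightarrow> (\<integral>t. eq_density \<beta> c t * indicator {..x} t \<partial>lborel)"
  proof (rule integral_dominated_convergence[where w = "\<lambda>t. M * indicator {-L..L} t"])
    show "(\<lambda>t. eq_density \<beta> c t * indicator {..x} t) \<in> borel_measurable lborel"
      using log_gas.eq_density_measurable[OF log_gas_cs(2)] by simp
    show "(\<lambda>t. eq_density \<beta> (cs n) t * indicator {..x} t) \<in> borel_measurable lborel" for n
      using log_gas.eq_density_measurable[OF log_gas_cs(1)] by simp
    have "integrable lborel (indicator {-L..L} :: real \<Rightarrow> real)"
      by (rule integrable_real_indicator) (auto simp: emeasure_lborel_Icc_eq)
    then show "integrable lborel (\<lambda>t. M * indicator {-L..L} t)" by simp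
    have "(\<lambda>n. eq_density \<beta> (cs n) t) \<longlonglongrightarrow> eq_density \<beta> c t" for t
      unfolding log_gas.eq_density_eq[OF log_gas_cs(1)] log_gas.eq_density_eq[OF log_gas_cs(2)]
      by (intro tendsto_intros tendsto_edges)
    then show "AE t in lborel. (\<lambda>n. eq_density \<beta> (cs n) t * indicator {..x} t) \<longlonglongrightarrow> eq_density \<beta> c t * indicator {..x} t"
      by (intro AE_I2 tendsto_mult tendsto_const) auto
    show "AE t in lborel. norm (eq_density \<beta> (cs n) t * indicator {..x} t) \<le> M * indicator {-L..L} t" for n
    proof (rule AE_I2)
      fix t :: real
      interpret log_gas \<beta> "cs n" by (rule log_gas_cs)
      have "eq_density \<beta> (cs n) t \<le> M" using eq_density_le[of t] M[of n] unfolding densc_def by linarith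
      moreover have "0 \<le> eq_density \<beta> (cs n) t" by (rule eq_density_nonneg)
      moreover have "eq_density \<beta> (cs n) t = 0" if "t \<notin> {-L..L}"
        using that L[of n] by (auto simp: eq_density_def Let_def)
      ultimately show "norm (eq_density \<beta> (cs n) t * indicator {..x} t) \<le> M * indicator {-L..L} t"
        by (cases "t \<in> {-L..L}") (auto simp: indicator_def)
    qed
  qed
  then show ?thesis using eq log_gas_cs by simp
qed

lemma tendsto_cdf_nun: "(\<lambda>n. measure (nun \<beta> n (n * cs n)) {..x}) \<longlonglongrightarrow> measure (nu_eq \<beta> c) {..x}"
proof -
  have "(\<lambda>n. measure (nun \<beta> n (n * cs n)) {..x} - measure (nu_eq \<beta> (cs n)) {..x}) \<longlonglongrightarrow> 0"
  proof (rule LIMSEQ_I)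
    fix e :: real assume e: "0 < e"
    \<comment> \<open>Here L, M, K and, further down, g exceed the limits of the edge,
      \<open>densc\<close>, \<open>gapc\<close> and \<open>ratec \<epsilon>\<close> by at least 1,
      so they bound these quantities for all large n.\<close>
    define L where "L = \<bar>edge_b \<beta> c\<bar> + 1 + \<bar>x\<bar>"
    define M where "M = \<bar>log_gas.densc \<beta> c\<bar> + 1"
    define K where "K = \<bar>log_gas.gapc \<beta> c\<bar> + 1"
    define \<delta> where "\<delta> = min 1 (e / (8 * M))"
    define \<eta> where "\<eta> = e / 4"
    define \<kappa> where "\<kappa> = \<beta> / 2 * (\<delta> * \<eta> / (2 * L + 8))\<^sup>2"
    have M: "0 < M" and K: "0 < K" and L: "0 \<le> L" by (auto simp: M_def K_def L_def)
    have \<delta>: "0 < \<delta>" "\<delta> \<le> 1" "\<delta> \<le> e / (8 * M)" using e M by (auto simp: \<delta>_def)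
    have \<eta>: "0 < \<eta>" using e by (simp add: \<eta>_def)
    have \<kappa>: "0 < \<kappa>" unfolding \<kappa>_def using \<beta> \<delta> \<eta> L by (intro mult_pos_pos zero_less_power divide_pos_pos) auto
    \<comment> \<open>The truncation is fixed after \<delta> and \<eta>, so that its error takes at
      most half of the energy gain \<kappa>. Only then does n grow, because \<open>ratec\<close>
      depends on \<epsilon> and multiplies n, while the gain multiplies n^2.\<close>
    define \<epsilon> where "\<epsilon> = min 1 (\<kappa> / (2 * \<beta> * K))"
    have \<epsilon>: "0 < \<epsilon>" "\<epsilon> \<le> 1" using \<kappa> \<beta> K by (auto simp: \<epsilon>_def)
    have "\<epsilon> \<le> \<kappa> / (2 * \<beta> * K)" by (simp add: \<epsilon>_def)
    then have \<epsilon>3: "\<beta> * (K * \<epsilon>) \<le> \<kappa> / 2" using \<beta> K by (simp add: le_divide_eq mult_ac)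
    have \<delta>M: "2 * \<delta> * M \<le> e / 4" using \<delta>(3) M by (simp add: le_divide_eq mult_ac)
    define g where "g = log_gas.ratec \<beta> c \<epsilon> + 1"
    have ev1: "\<forall>\<^sub>F n in sequentially. edge_b \<beta> (cs n) < L"
      using order_tendstoD(2)[OF tendsto_edges(2), of L] by (auto simp: L_def)
    have ev2: "\<forall>\<^sub>F n in sequentially. log_gas.densc \<beta> (cs n) < M"
      using order_tendstoD(2)[OF tendsto_consts(1), of M] by (auto simp: M_def)
    have ev3: "\<forall>\<^sub>F n in sequentially. log_gas.gapc \<beta> (cs n) < K"
      using order_tendstoD(2)[OF tendsto_consts(2), of K] by (auto simp: K_def)
    have ev4: "\<forall>\<^sub>F n in sequentially. log_gas.ratec \<beta> (cs n) \<epsilon> < g"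
      using order_tendstoD(2)[OF tendsto_consts(3), of \<epsilon> g] by (auto simp: g_def)
    have ev5: "\<forall>\<^sub>F n in sequentially. exp (- (real n)\<^sup>2 * (\<kappa> / 2) + real n * g) < e / 4"
      using order_tendstoD(2)[OF exp_quadratic_decay[of "\<kappa> / 2" g], of "e / 4"] \<kappa> e by auto
    have "\<forall>\<^sub>F n in sequentially. norm (measure (nun \<beta> n (n * cs n)) {..x} - measure (nu_eq \<beta> (cs n)) {..x} - 0) < e"
      using ev1 ev2 ev3 ev4 ev5 eventually_ge_at_top[of 1]
    proof eventually_elim
      case (elim n)
      interpret log_gas \<beta> "cs n" by (rule log_gas_cs)
      have "gapc * \<epsilon> \<le> K * \<epsilon>" using elim(3) \<epsilon> by (intro mult_right_mono) auto
      then have "\<beta> * (gapc * \<epsilon>) \<le> \<beta> * (K * \<epsilon>)" using \<beta> by (intro mult_left_mono) auto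
      then have "\<kappa> / 2 \<le> \<kappa> - \<beta> * (gapc * \<epsilon>)" using \<epsilon>3 by linarith
      then have 1: "(real n)\<^sup>2 * (\<kappa> / 2) \<le> (real n)\<^sup>2 * (\<kappa> - \<beta> * (gapc * \<epsilon>))" by (intro mult_left_mono) auto
      have 2: "real n * ratec \<epsilon> \<le> real n * g" using elim(4) by (intro mult_left_mono) auto
      have "- (real n)\<^sup>2 * (\<kappa> - \<beta> * (gapc * \<epsilon>)) + real n * ratec \<epsilon> \<le> - (real n)\<^sup>2 * (\<kappa> / 2) + real n * g"
        using 1 2 unfolding mult_minus_left by linarith
      then have 3: "exp (- (real n)\<^sup>2 * (\<kappa> - \<beta> * (gapc * \<epsilon>)) + real n * ratec \<epsilon>) < e / 4"
        using elim(5) by (meson exp_le_cancel_iff le_less_trans)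
      have 4: "2 * \<delta> * densc \<le> 2 * \<delta> * M" using elim(2) \<delta> by (intro mult_left_mono) auto
      have "\<bar>measure (nun \<beta> n (n * cs n)) {..x} - measure (nu_eq \<beta> (cs n)) {..x}\<bar>
         \<le> 2 * \<delta> * densc + \<eta> + exp (- (real n)\<^sup>2 * (\<kappa> - \<beta> * (gapc * \<epsilon>)) + real n * ratec \<epsilon>)"
        unfolding \<kappa>_def using elim(1,6) \<delta> \<eta> \<epsilon> by (intro cdf_nun_close) (auto simp: L_def)
      then show ?case using 3 4 \<delta>M e unfolding \<eta>_def by simp
    qed
    then show "\<exists>N. \<forall>n\<ge>N. norm (measure (nun \<beta> n (n * cs n)) {..x} - measure (nu_eq \<beta> (cs n)) {..x} - 0) < e"
      by (simp add: eventually_sequentially)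
  qed
  from tendsto_add[OF this tendsto_cdf_nu_eq[of x]] show ?thesis by simp
qed

text \<open>Convergence of the distribution functions at every point implies weak convergence. The
  sequence is shifted by one because for n = 0 there are no particles and \<open>nun\<close> is the
  zero measure rather than a probability.\<close>

lemma nun_weak_convergence:
  fixes f :: "real \<Rightarrow> real"
  assumes f: "continuous_on UNIV f" "bounded (range f)"
  shows "(\<lambda>n. \<integral>t. f t \<partial>nun \<beta> n (n * cs n)) \<longlonglongrightarrow> (\<integral>t. f t \<partial>nu_eq \<beta> c)"
proof -
  interpret log_gas \<beta> c by (rule log_gas_cs)
  have rd: "real_distribution (nun \<beta> (Suc n) (Suc n * cs (Suc n)))" for n
  proof -
    interpret L: log_gas \<beta> "cs (Suc n)" by (rule log_gas_cs)
    show ?thesis unfolding real_distribution_def real_distribution_axioms_def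
      using L.prob_space_nun[of "Suc n"] L.sets_nun L.space_nun by simp
  qed
  have rd0: "real_distribution (nu_eq \<beta> c)"
    unfolding real_distribution_def real_distribution_axioms_def using prob_space_nu_eq by simp
  have wc: "weak_conv_m (\<lambda>n. nun \<beta> (Suc n) (Suc n * cs (Suc n))) (nu_eq \<beta> c)"
    unfolding weak_conv_m_def weak_conv_def cdf_def using LIMSEQ_Suc[OF tendsto_cdf_nun] by simp
  obtain B where B: "\<And>x. norm (f x) \<le> B" using f(2) unfolding bounded_iff by auto
  have cont: "isCont f x" for x using f(1) by (simp add: continuous_on_eq_continuous_at)
  have "(\<lambda>n. \<integral>t. f t \<partial>nun \<beta> (Suc n) (Suc n * cs (Suc n))) \<longlonglongrightarrow> (\<integral>t. f t \<partial>nu_eq \<beta> c)"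
    by (rule weak_conv_imp_integral_bdd_continuous_conv) (fact rd, fact rd0, fact wc, fact cont, fact B)
  then show ?thesis by (rule LIMSEQ_imp_Suc)
qed

end

theorem theorem4p1:
  fixes \<beta> c :: real and \<mu> :: "nat \<Rightarrow> real"
  assumes "\<beta> > 0"
    and "\<And>n. n \<ge> 1 \<Longrightarrow> \<mu> n \<ge> 0"
    and "c \<ge> 0"
    and "(\<lambda>n. \<mu> n / real n) \<longlonglongrightarrow> c"
  shows "(\<forall>f :: real \<Rightarrow> real. continuous_on UNIV f \<and> bounded (range f) \<longrightarrow>
            (\<lambda>n. \<integral>t. f t \<partial>nun \<beta> n (\<mu> n)) \<longlonglongrightarrow> (\<integral>t. f t \<partial>nu_eq \<beta> c))
       \<and> energy_star \<beta> c = energy \<beta> c (nu_eq \<beta> c)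
       \<and> energy_star \<beta> c = ereal
           (3*\<beta>/8 + \<beta>/4 * ln (4/\<beta>) + c * (3/2 + ln (4/\<beta>))
            + (if c = 0 then 0 else 2*c\<^sup>2/\<beta> * ln (4*c/\<beta>))
            - (2*c\<^sup>2/\<beta> + c + \<beta>/8) * ln (1 + 4*c/\<beta>))"
proof (intro conjI allI impI)
  interpret log_gas \<beta> c using assms by unfold_locales
  show "energy_star \<beta> c = energy \<beta> c (nu_eq \<beta> c)" by (simp only: energy_star_eq energy_nu_eq)
  show "energy_star \<beta> c = ereal
           (3*\<beta>/8 + \<beta>/4 * ln (4/\<beta>) + c * (3/2 + ln (4/\<beta>))
            + (if c = 0 then 0 else 2*c\<^sup>2/\<beta> * ln (4*c/\<beta>))
            - (2*c\<^sup>2/\<beta> + c + \<beta>/8) * ln (1 + 4*c/\<beta>))"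
    unfolding energy_star_eq Estar_eq ..
  fix f :: "real \<Rightarrow> real" assume f: "continuous_on UNIV f \<and> bounded (range f)"
  \<comment> \<open>The value at n = 0 is 0 because \<open>x / 0 = 0\<close>, so the quotients are
    nonnegative for every n although the sign of the initial term is unknown.\<close>
  have nonneg: "0 \<le> \<mu> n / real n" for n using assms(2)[of n] by (cases "n = 0") auto
  have "(\<lambda>n. \<integral>t. f t \<partial>nun \<beta> n (n * (\<mu> n / real n))) \<longlonglongrightarrow> (\<integral>t. f t \<partial>nu_eq \<beta> c)"
    by (rule nun_weak_convergence[OF assms(1) nonneg assms(4)]) (use f in auto)
  moreover have "\<forall>\<^sub>F n in sequentially. (\<integral>t. f t \<partial>nun \<beta> n (n * (\<mu> n / real n))) = (\<integral>t. f t \<partial>nun \<beta> n (\<mu> n))"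
    using eventually_ge_at_top[of 1] by eventually_elim simp
  ultimately show "(\<lambda>n. \<integral>t. f t \<partial>nun \<beta> n (\<mu> n)) \<longlonglongrightarrow> (\<integral>t. f t \<partial>nu_eq \<beta> c)"
    by (rule Lim_transform_eventually)
qed

end
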